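(* Let $k\ge 3$. Every graph $G\in\mathcal{G}_k$ has a $k$-balanced decomposition $\mathcal{D}$ in which every cycle has length $2k$.
   Context: All graphs are finite and simple; length = number of edges; girth = length of a shortest cycle. For $k\ge3$, $\mathcal{G}_k$ is the class of all $2k$-regular graphs of girth at least $2k-2$ admitting a pair of disjoint perfect matchings. A decomposition of a graph is a set of subgraphs whose edge sets partition its edge set. For $N\subset\mathbb{N}$, an $N$-decomposition is a decomposition into paths and cycles all of whose lengths lie in $N$. Given a $\{2k-1,2k,2k+1\}$-decomposition $\mathcal{D}$ of a graph and a vertex $v$, $\mathcal{D}$ is $k$-balanced at $v$ if the number of paths of $\mathcal{D}$ of length at most $2k$ having $v$ as an end vertex is at least the number of paths of $\mathcal{D}$ of length at least $2k+1$ having $v$ as an end vertex. $\mathcal{D}$ is a $k$-balanced decomposition if it is $k$-balanced at every vertex and the number of paths of length $2k-1$ in $\mathcal{D}$ equals the number of paths of length $2k+1$ in $\mathcal{D}$. *)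

theory Defs
  imports Main
begin

definition simple_graph :: "'a set \<Rightarrow> 'a set set \<Rightarrow> bool" where
  "simple_graph V E \<longleftrightarrow> finite V \<and>
     (\<forall>e\<in>E. \<exists>u v. e = {u, v} \<and> u \<noteq> v \<and> u \<in> V \<and> v \<in> V)"

definition degree :: "'a set set \<Rightarrow> 'a \<Rightarrow> nat" where
  "degree E v = card {e\<in>E. v \<in> e}"

definition regular :: "nat \<Rightarrow> 'a set \<Rightarrow> 'a set set \<Rightarrow> bool" where
  "regular d V E \<longleftrightarrow> (\<forall>v\<in>V. degree E v = d)"

definition path_edges :: "'a list \<Rightarrow> 'a set set" where
  "path_edges vs = (\<lambda>(a, b). {a, b}) ` set (zip vs (tl vs))"

definition cycle_edges :: "'a list \<Rightarrow> 'a set set" where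
  "cycle_edges vs = path_edges vs \<union> {{last vs, hd vs}}"

text \<open>A subgraph (given by its edge set) is a path / a cycle; its length is its number of edges.\<close>
definition is_path :: "'a set set \<Rightarrow> bool" where
  "is_path H \<longleftrightarrow> (\<exists>vs. distinct vs \<and> length vs \<ge> 2 \<and> H = path_edges vs)"

definition is_cycle :: "'a set set \<Rightarrow> bool" where
  "is_cycle H \<longleftrightarrow> (\<exists>vs. distinct vs \<and> length vs \<ge> 3 \<and> H = cycle_edges vs)"

definition path_end :: "'a set set \<Rightarrow> 'a \<Rightarrow> bool" where
  "path_end H v \<longleftrightarrow> (\<exists>vs. distinct vs \<and> length vs \<ge> 2 \<and> H = path_edges vs \<and> (v = hd vs \<or> v = last vs))"

definition girth_at_least :: "nat \<Rightarrow> 'a set set \<Rightarrow> bool" where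
  "girth_at_least g E \<longleftrightarrow> (\<forall>H. H \<subseteq> E \<and> is_cycle H \<longrightarrow> card H \<ge> g)"

definition perfect_matching :: "'a set \<Rightarrow> 'a set set \<Rightarrow> 'a set set \<Rightarrow> bool" where
  "perfect_matching V E M \<longleftrightarrow> M \<subseteq> E \<and> (\<forall>v\<in>V. \<exists>!e. e \<in> M \<and> v \<in> e)"

definition class_G :: "nat \<Rightarrow> 'a set \<Rightarrow> 'a set set \<Rightarrow> bool" where
  "class_G k V E \<longleftrightarrow> simple_graph V E \<and> regular (2*k) V E \<and> girth_at_least (2*k - 2) E \<and>
     (\<exists>M1 M2. perfect_matching V E M1 \<and> perfect_matching V E M2 \<and> M1 \<inter> M2 = {})"

definition decomposition :: "'a set set \<Rightarrow> 'a set set set \<Rightarrow> bool" where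
  "decomposition E D \<longleftrightarrow> \<Union>D = E \<and> {} \<notin> D \<and>
     (\<forall>H1\<in>D. \<forall>H2\<in>D. H1 \<noteq> H2 \<longrightarrow> H1 \<inter> H2 = {})"

definition N_decomposition :: "nat set \<Rightarrow> 'a set set \<Rightarrow> 'a set set set \<Rightarrow> bool" where
  "N_decomposition N E D \<longleftrightarrow> decomposition E D \<and>
     (\<forall>H\<in>D. (is_path H \<or> is_cycle H) \<and> card H \<in> N)"

definition balanced_at :: "nat \<Rightarrow> 'a set set set \<Rightarrow> 'a \<Rightarrow> bool" where
  "balanced_at k D v \<longleftrightarrow>
     card {H\<in>D. is_path H \<and> card H \<le> 2*k \<and> path_end H v}
       \<ge> card {H\<in>D. is_path H \<and> card H \<ge> 2*k + 1 \<and> path_end H v}"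

definition k_balanced_decomposition :: "nat \<Rightarrow> 'a set \<Rightarrow> 'a set set \<Rightarrow> 'a set set set \<Rightarrow> bool" where
  "k_balanced_decomposition k V E D \<longleftrightarrow>
     N_decomposition {2*k - 1, 2*k, 2*k + 1} E D \<and>
     (\<forall>v\<in>V. balanced_at k D v) \<and>
     card {H\<in>D. is_path H \<and> card H = 2*k - 1} = card {H\<in>D. is_path H \<and> card H = 2*k + 1}"

end

(* Idea. Remove one perfect matching M1. The rest is (2k-1)-regular with a perfect matching M2, and its
   other edges are the arcs {x, pi x} of k-1 permutations of the vertices (balanced orientation and Hall's
   theorem). Prolong the edges of M2 at both ends along these permutations, one after the other. Every
   vertex is always the end of exactly one path, and the girth rules out closed walks until the last
   permutation rho; there a bad edge joins the two ends of the same path. The last two permutations can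
   be chosen such that all bad edges are repaired by local exchanges, which gives paths P of length 2k-1.

   Then the edges of M1 have to be attached to ends of the paths. Let mu be the partner in M1 and tau the
   other end of the path. The graph formed by mu and tau consists of even cycles, so its vertices split
   into heads (the set U) and tails. An edge {v, mu v} that fits neither at v nor at mu v is a chord of
   both paths ending there; the path at mu v is rotated along this chord, which frees an edge {v, z}
   that can be attached at v instead. If this collides with an edge attached at the other end of the
   same path, then that edge is pushed on to the rotated path, which ends at z. The number of pieces is
   right, so the balance conditions follow by counting path ends and attached edges at every vertex. *)

theory Submission
  imports Defs "HOL-Combinatorics.Permutations" "HOL-Combinatorics.Cycles"
begin

section \<open>Balanced orientations and permutations\<close>

text \<open>The constants come from one count. An edge outside a path of \<open>n\<close> vertices
  that joins its last vertex to position \<open>i\<close> (counted from 0) closes a cycle of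
  \<open>n - i\<close> edges, so girth \<open>2*k - 2\<close> forces
  \<open>i \<le> n - (2*k - 2)\<close>. Before each of the first \<open>k - 2\<close> rounds the
  growing paths have at most \<open>2*k - 4\<close> vertices, so nothing closes; before the last
  round they have \<open>2*k - 2\<close>, and only the other end can be hit. When M1 is attached
  they have \<open>2*k\<close> vertices, so a chord from an end reaches only the three farthest
  vertices, and conflicts reduce to small case analyses that often end in a triangle. Repairing the
  bad edges is a 2-colouring problem: for each bad vertex of a certain permutation, exactly one of
  it and its successor is to be exchanged. Odd cycles of bad vertices obstruct this; an extremal
  choice of the last two permutations leaves only such cycles of length 2. A cycle of the final
  decomposition arises only when an attached edge joins the two ends of a path of length
  \<open>2*k - 1\<close>, hence its length \<open>2*k\<close>.\<close>

lemma hall_marriage: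
  fixes A :: "'i \<Rightarrow> 'a set"
  assumes "finite I" "\<And>i. i \<in> I \<Longrightarrow> finite (A i)"
    and "\<And>J. J \<subseteq> I \<Longrightarrow> card J \<le> card (\<Union>(A ` J))"
  shows "\<exists>R. inj_on R I \<and> (\<forall>i\<in>I. R i \<in> A i)"
  using assms
proof (induction "card I" arbitrary: I A rule: less_induct)
  case less
  note fin = less.prems(1) and finA = less.prems(2) and hc = less.prems(3)
  show ?case
  proof (cases "I = {}")
    case True
    then show ?thesis by simp
  next
    case False
    show ?thesis
    \<comment> \<open>Halmos-Vaughan dichotomy: a tight proper subfamily is matched inside its own
      union, and the other members avoid that union; if there is none, every proper subfamily has a
      spare element, so one value can be fixed freely.\<close>
    proof (cases "\<exists>J. J \<subset> I \<and> J \<noteq> {} \<and> card J = card (\<Union>(A ` J))")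
      case True
      then obtain J where J: "J \<subset> I" "J \<noteq> {}" "card J = card (\<Union>(A ` J))" by blast
      let ?B = "\<Union>(A ` J)"
      have finJ: "finite J" using J fin finite_subset by blast
      have finB: "finite ?B" using J finA finJ by blast
      have "card J < card I" by (rule psubset_card_mono[OF fin J(1)])
      then have "\<exists>R. inj_on R J \<and> (\<forall>i\<in>J. R i \<in> A i)"
        using less.hyps[of J A] finJ finA hc J(1) by (meson psubset_imp_subset subsetD subset_trans)
      then obtain R1 where R1: "inj_on R1 J" "\<forall>i\<in>J. R1 i \<in> A i" by blast
      have "card (I - J) < card I"
        by (rule psubset_card_mono[OF fin]) (use J in auto)
      moreover have "card K \<le> card (\<Union>((\<lambda>i. A i - ?B) ` K))" if K: "K \<subseteq> I - J" for K
      proof -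
        have finK: "finite K" using K fin by (meson finite_Diff finite_subset)
        have "card K + card J = card (K \<union> J)"
          using K finK finJ by (subst card_Un_disjoint) auto
        also have "\<dots> \<le> card (\<Union>(A ` (K \<union> J)))" using hc[of "K \<union> J"] K J by blast
        finally have 1: "card K + card J \<le> card (\<Union>(A ` (K \<union> J)))" .
        have "\<Union>((\<lambda>i. A i - ?B) ` K) = \<Union>(A ` (K \<union> J)) - ?B" by auto
        then have "card (\<Union>((\<lambda>i. A i - ?B) ` K)) = card (\<Union>(A ` (K \<union> J))) - card ?B"
          using finB by (simp add: card_Diff_subset)
        with 1 J(3) show ?thesis by simp
      qed
      ultimately have "\<exists>R. inj_on R (I - J) \<and> (\<forall>i\<in>I - J. R i \<in> A i - ?B)"
        using less.hyps[of "I - J" "\<lambda>i. A i - ?B"] fin finA by auto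
      then obtain R2 where R2: "inj_on R2 (I - J)" "\<forall>i\<in>I - J. R2 i \<in> A i - ?B" by blast
      define R where "R = (\<lambda>i. if i \<in> J then R1 i else R2 i)"
      have "inj_on R I"
      proof (rule inj_onI)
        fix i j assume ij: "i \<in> I" "j \<in> I" "R i = R j"
        have RB: "R l \<in> ?B \<longleftrightarrow> l \<in> J" if "l \<in> I" for l
          using that R1(2) R2(2) by (cases "l \<in> J") (auto simp: R_def)
        have "i \<in> J \<longleftrightarrow> j \<in> J" using RB[OF ij(1)] RB[OF ij(2)] ij(3) by simp
        then show "i = j"
          using ij inj_onD[OF R1(1), of i j] inj_onD[OF R2(1), of i j]
          by (cases "i \<in> J") (simp_all add: R_def)
      qed
      moreover have "\<forall>i\<in>I. R i \<in> A i" using R1 R2 by (auto simp: R_def)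
      ultimately show ?thesis by blast
    next
      case noJ: False
      obtain i0 where i0: "i0 \<in> I" using False by blast
      have "card {i0} \<le> card (\<Union>(A ` {i0}))" using hc[of "{i0}"] i0 by blast
      then have "A i0 \<noteq> {}" by auto
      then obtain x where x: "x \<in> A i0" by blast
      have "card (I - {i0}) < card I" using i0 fin by (meson card_Diff1_less)
      moreover have "card K \<le> card (\<Union>((\<lambda>i. A i - {x}) ` K))" if K: "K \<subseteq> I - {i0}" for K
      proof (cases "K = {}")
        case False
        have "K \<subset> I" using K i0 by blast
        then have "card K < card (\<Union>(A ` K))"
          using noJ False hc[of K] by (metis le_neq_implies_less psubset_imp_subset)
        moreover have "\<Union>((\<lambda>i. A i - {x}) ` K) = \<Union>(A ` K) - {x}" by auto
        moreover have "card (\<Union>(A ` K)) - 1 \<le> card (\<Union>(A ` K) - {x})"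
          by (simp add: card_Diff_singleton_if)
        ultimately show ?thesis by simp
      qed simp
      ultimately have "\<exists>R. inj_on R (I - {i0}) \<and> (\<forall>i\<in>I - {i0}. R i \<in> A i - {x})"
        using less.hyps[of "I - {i0}" "\<lambda>i. A i - {x}"] fin finA by auto
      then obtain R where R: "inj_on R (I - {i0})" "\<forall>i\<in>I - {i0}. R i \<in> A i - {x}" by blast
      have "inj_on (R(i0 := x)) (insert i0 (I - {i0}))"
        unfolding inj_on_insert using R by (auto intro!: inj_on_fun_updI)
      then have "inj_on (R(i0 := x)) I" using i0 by (simp add: insert_absorb)
      moreover have "\<forall>i\<in>I. (R(i0 := x)) i \<in> A i" using R x by auto
      ultimately show ?thesis by blast
    qed
  qed
qed

text \<open>Two edges at a common vertex \<open>v\<close> are merged into one edge between their other ends; an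
  orientation of the merged edge lifts to a directed path through \<open>v\<close>, which changes no net flow.\<close>

lemma balanced_orientation:
  fixes s t :: "'e \<Rightarrow> 'v"
  assumes "finite I"
  shows "\<exists>p q. (\<forall>e\<in>I. (p e = s e \<and> q e = t e) \<or> (p e = t e \<and> q e = s e)) \<and>
    (\<forall>v. \<bar>\<Sum>e\<in>I. of_bool (p e = v) - of_bool (q e = v) :: int\<bar> \<le> 1)"
  using assms
proof (induction "card I" arbitrary: I s t rule: less_induct)
  case less
  show ?case
  proof (cases "\<exists>e\<in>I. \<exists>f\<in>I. e \<noteq> f \<and> {s e, t e} \<inter> {s f, t f} \<noteq> {}")
    case True
    then obtain e f v where ef: "e \<in> I" "f \<in> I" "e \<noteq> f" and "v \<in> {s e, t e}" "v \<in> {s f, t f}"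
      by blast
    \<comment> \<open>The merged edge keeps the index \<open>e\<close> and may be a loop or parallel
      to another edge; therefore edges are indices with end maps \<open>s\<close>, \<open>t\<close>
      and not pairs of vertices.\<close>
    define a b where "a = (if s e = v then t e else s e)" and "b = (if s f = v then t f else s f)"
    have a: "(s e = v \<and> t e = a) \<or> (s e = a \<and> t e = v)"
      using \<open>v \<in> {s e, t e}\<close> by (auto simp: a_def)
    have b: "(s f = v \<and> t f = b) \<or> (s f = b \<and> t f = v)"
      using \<open>v \<in> {s f, t f}\<close> by (auto simp: b_def)
    have "card (I - {f}) < card I" using ef less.prems by (meson card_Diff1_less)
    then obtain p q where
      pq: "\<forall>x\<in>I - {f}. (p x = (s(e := a)) x \<and> q x = (t(e := b)) x) \<or>
             (p x = (t(e := b)) x \<and> q x = (s(e := a)) x)"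
      and bal: "\<And>v. \<bar>\<Sum>x\<in>I - {f}. of_bool (p x = v) - of_bool (q x = v) :: int\<bar> \<le> 1"
      using less.hyps[of "I - {f}" "s(e := a)" "t(e := b)"] less.prems by auto
    have pqe: "(p e = a \<and> q e = b) \<or> (p e = b \<and> q e = a)" using bspec[OF pq, of e] ef by simp
    define p' where "p' = (if p e = a \<and> q e = b then p(e := a, f := v) else p(e := v, f := b))"
    define q' where "q' = (if p e = a \<and> q e = b then q(e := v, f := b) else q(e := a, f := v))"
    have "\<forall>x\<in>I. (p' x = s x \<and> q' x = t x) \<or> (p' x = t x \<and> q' x = s x)"
    proof
      fix x assume x: "x \<in> I"
      consider "x = e" | "x = f" | "x \<noteq> e" "x \<noteq> f" by blast
      then show "(p' x = s x \<and> q' x = t x) \<or> (p' x = t x \<and> q' x = s x)"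
      proof cases
        case 1
        then show ?thesis using a ef(3) by (auto simp: p'_def q'_def)
      next
        case 2
        then show ?thesis using b ef(3) by (auto simp: p'_def q'_def)
      next
        case 3
        then show ?thesis using bspec[OF pq, of x] x by (simp add: p'_def q'_def)
      qed
    qed
    moreover have "(\<Sum>x\<in>I. of_bool (p' x = w) - of_bool (q' x = w) :: int) =
        (\<Sum>x\<in>I - {f}. of_bool (p x = w) - of_bool (q x = w))" for w
    proof -
      let ?g = "\<lambda>x. of_bool (p x = w) - of_bool (q x = w) :: int"
      let ?g' = "\<lambda>x. of_bool (p' x = w) - of_bool (q' x = w) :: int"
      have e1: "e \<in> I - {f}" using ef by auto
      have "sum ?g' I = ?g' f + sum ?g' (I - {f})" by (rule sum.remove[OF less.prems ef(2)])
      also have "sum ?g' (I - {f}) = ?g' e + sum ?g' (I - {f} - {e})"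
        using e1 less.prems by (intro sum.remove) auto
      also have "sum ?g' (I - {f} - {e}) = sum ?g (I - {f} - {e})"
        by (rule sum.cong) (auto simp: p'_def q'_def)
      also have "?g' f + (?g' e + sum ?g (I - {f} - {e})) = ?g e + sum ?g (I - {f} - {e})"
      proof -
        have "?g' f + ?g' e = ?g e"
          using ef(3) pqe by (cases "p e = a \<and> q e = b") (auto simp: p'_def q'_def)
        then show ?thesis by simp
      qed
      also have "\<dots> = sum ?g (I - {f})"
        using e1 less.prems by (intro sum.remove[symmetric]) auto
      finally show ?thesis .
    qed
    ultimately show ?thesis using bal by metis
  next
    case False
    have "\<bar>\<Sum>e\<in>I. of_bool (s e = v) - of_bool (t e = v) :: int\<bar> \<le> 1" for v
    proof (cases "\<exists>e\<in>I. v \<in> {s e, t e}")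
      case True
      then obtain e where e: "e \<in> I" "v \<in> {s e, t e}" by blast
      have "(\<Sum>e\<in>I. of_bool (s e = v) - of_bool (t e = v) :: int) =
        (of_bool (s e = v) - of_bool (t e = v)) +
        (\<Sum>e\<in>I - {e}. of_bool (s e = v) - of_bool (t e = v))"
        using e less.prems by (simp add: sum.remove)
      also have "(\<Sum>e\<in>I - {e}. of_bool (s e = v) - of_bool (t e = v) :: int) = 0"
        using False e by (intro sum.neutral) (auto simp: disjoint_iff)
      finally show ?thesis by auto
    next
      case False
      then have "(\<Sum>e\<in>I. of_bool (s e = v) - of_bool (t e = v) :: int) = 0"
        by (intro sum.neutral) auto
      then show ?thesis by simp
    qed
    then show ?thesis by blast
  qed
qed

section \<open>Orienting regular graphs of even degree and splitting them into permutations\<close>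

definition diregular :: "nat \<Rightarrow> 'a set \<Rightarrow> ('a \<times> 'a) set \<Rightarrow> bool" where
  "diregular d V D \<longleftrightarrow> D \<subseteq> V \<times> V \<and>
     (\<forall>v\<in>V. card {y. (v, y) \<in> D} = d \<and> card {x. (x, v) \<in> D} = d)"

text \<open>Parity: outdegree and indegree add up to \<open>2 * d\<close> and differ by at most 1,
  so both are \<open>d\<close>. Asymmetry of \<open>D\<close> expresses that each edge of the simple
  graph carries a single arc.\<close>

lemma eulerian_orientation:
  assumes "simple_graph V F" "regular (2 * d) V F"
  shows "\<exists>D. diregular d V D \<and> (\<lambda>(x, y). {x, y}) ` D = F \<and> asym D"
proof -
  have finV: "finite V" and edge: "\<And>e. e \<in> F \<Longrightarrow> \<exists>u v. e = {u, v} \<and> u \<noteq> v \<and> u \<in> V \<and> v \<in> V"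
    using assms(1) by (auto simp: simple_graph_def)
  have "F \<subseteq> Pow V" using edge by blast
  then have finF: "finite F" using finV by (meson finite_Pow_iff finite_subset)
  from edge obtain s t where st: "\<And>e. e \<in> F \<Longrightarrow> e = {s e, t e} \<and> s e \<noteq> t e \<and> s e \<in> V \<and> t e \<in> V"
    by metis
  from balanced_orientation[OF finF, of s t] obtain p q where
    pq: "\<forall>e\<in>F. (p e = s e \<and> q e = t e) \<or> (p e = t e \<and> q e = s e)"
    and bal: "\<And>v. \<bar>\<Sum>e\<in>F. of_bool (p e = v) - of_bool (q e = v) :: int\<bar> \<le> 1"
    by auto
  have pqF: "e = {p e, q e}" "p e \<noteq> q e" "p e \<in> V" "q e \<in> V" if "e \<in> F" for e
  proof -
    have 1: "(p e = s e \<and> q e = t e) \<or> (p e = t e \<and> q e = s e)" using pq that by blast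
    have 2: "e = {s e, t e}" "s e \<noteq> t e" "s e \<in> V" "t e \<in> V" using st[OF that] by blast+
    have "{p e, q e} = {s e, t e}" using 1 by (elim disjE) (simp_all add: insert_commute)
    then show "e = {p e, q e}" using 2(1) by simp
    show "p e \<noteq> q e" "p e \<in> V" "q e \<in> V" using 1 2(2-4) by (elim disjE; simp)+
  qed
  define D where "D = (\<lambda>e. (p e, q e)) ` F"
  have img: "(\<lambda>(x, y). {x, y}) ` D = F"
  proof -
    have "(\<lambda>(x, y). {x, y}) ` D = (\<lambda>e. {p e, q e}) ` F" by (simp add: D_def image_image)
    also have "\<dots> = (\<lambda>e. e) ` F" using pqF(1) by (intro image_cong) auto
    finally show ?thesis by simp
  qed
  have asy: "asym D"
  proof (rule asymI)
    fix x y assume "(x, y) \<in> D" 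
    then obtain e where e: "e \<in> F" "x = p e" "y = q e" by (auto simp: D_def)
    show "(y, x) \<notin> D"
    proof
      assume "(y, x) \<in> D"
      then obtain e' where e': "e' \<in> F" "y = p e'" "x = q e'" by (auto simp: D_def)
      have "e = e'" using pqF(1)[OF e(1)] pqF(1)[OF e'(1)] e e' by (metis insert_commute)
      then show False using e e' pqF(2)[OF e(1)] by auto
    qed
  qed
  have "card {y. (v, y) \<in> D} = d \<and> card {x. (x, v) \<in> D} = d" if v: "v \<in> V" for v
  proof -
    let ?P = "{e \<in> F. p e = v}" and ?Q = "{e \<in> F. q e = v}"
    have "{y. (v, y) \<in> D} = q ` ?P" by (auto simp: D_def)
    moreover have "inj_on q ?P"
      using pqF(1) by (intro inj_onI) (metis (mono_tags, lifting) mem_Collect_eq)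
    ultimately have out: "card {y. (v, y) \<in> D} = card ?P" by (simp add: card_image)
    have "{x. (x, v) \<in> D} = p ` ?Q" by (auto simp: D_def)
    moreover have "inj_on p ?Q"
      using pqF(1) by (intro inj_onI) (metis (mono_tags, lifting) mem_Collect_eq)
    ultimately have inn: "card {x. (x, v) \<in> D} = card ?Q" by (simp add: card_image)
    have "v \<in> e \<longleftrightarrow> p e = v \<or> q e = v" if "e \<in> F" for e
      using pqF(1)[OF that] by (metis insert_iff singleton_iff)
    then have "{e \<in> F. v \<in> e} = ?P \<union> ?Q" by auto
    moreover have "?P \<inter> ?Q = {}"
    proof (rule equals0I)
      fix e assume "e \<in> ?P \<inter> ?Q"
      then show False using pqF(2)[of e] by simp
    qed
    ultimately have "card {e \<in> F. v \<in> e} = card ?P + card ?Q"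
      using finF by (simp add: card_Un_disjoint)
    then have sum: "card ?P + card ?Q = 2 * d"
      using assms(2) v by (simp add: regular_def degree_def)
    have "(\<Sum>e\<in>F. of_bool (p e = v) - of_bool (q e = v) :: int) = int (card ?P) - int (card ?Q)"
      using finF by (simp add: sum_subtractf Int_def)
    then have "\<bar>int (card ?P) - int (card ?Q)\<bar> \<le> 1" using bal[of v] by simp
    then have "card ?P = d \<and> card ?Q = d" using sum by linarith
    then show ?thesis using out inn by simp
  qed
  moreover have "D \<subseteq> V \<times> V" using pqF by (auto simp: D_def)
  ultimately have "diregular d V D" by (auto simp: diregular_def)
  then show ?thesis using img asy by blast
qed

text \<open>The arcs form a \<open>d\<close>-regular bipartite graph between two copies of
  \<open>V\<close>. Counting the \<open>d * card J\<close> arcs that leave \<open>J\<close> by their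
  heads gives Hall's condition, and the representatives form the permutation. Removing its arcs
  lowers all degrees by one, so the step can be iterated.\<close>

lemma diregular_permutation:
  assumes "finite V" "diregular d V D" "0 < d"
  shows "\<exists>\<pi>. \<pi> permutes V \<and> (\<forall>v\<in>V. (v, \<pi> v) \<in> D) \<and>
    diregular (d - 1) V (D - (\<lambda>v. (v, \<pi> v)) ` V)"
proof -
  let ?A = "\<lambda>v. {y. (v, y) \<in> D}"
  have sub: "D \<subseteq> V \<times> V" and out: "\<And>v. v \<in> V \<Longrightarrow> card (?A v) = d"
    and inn: "\<And>v. v \<in> V \<Longrightarrow> card {x. (x, v) \<in> D} = d"
    using assms(2) by (auto simp: diregular_def)
  have finA: "finite (?A v)" for v
    by (rule finite_subset[OF _ assms(1)]) (use sub in auto)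
  have finB: "finite {x. (x, v) \<in> D}" for v
    by (rule finite_subset[OF _ assms(1)]) (use sub in auto)
  have "\<exists>R. inj_on R V \<and> (\<forall>v\<in>V. R v \<in> ?A v)"
  proof (rule hall_marriage[OF assms(1) finA])
    fix J assume J: "J \<subseteq> V"
    let ?N = "\<Union>(?A ` J)"
    have finJ: "finite J" using J assms(1) finite_subset by blast
    have NV: "?N \<subseteq> V" using sub by auto
    then have finN: "finite ?N" using assms(1) finite_subset by blast
    have "d * card J = (\<Sum>v\<in>J. card (?A v))" using out J by (simp add: subset_iff)
    also have "\<dots> = card (SIGMA v:J. ?A v)" using finJ finA by simp
    also have "\<dots> = card ((\<lambda>(x, y). (y, x)) ` (SIGMA v:J. ?A v))"
      by (rule card_image[symmetric]) (auto simp: inj_on_def)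
    also have "\<dots> \<le> card (SIGMA v:?N. {x. (x, v) \<in> D})"
      by (rule card_mono) (use finN finB in auto)
    also have "\<dots> = (\<Sum>v\<in>?N. card {x. (x, v) \<in> D})" using finN finB by simp
    also have "\<dots> = d * card ?N" using inn NV by (simp add: subset_iff)
    finally show "card J \<le> card ?N" using assms(3) by simp
  qed
  then obtain R where R: "inj_on R V" "\<And>v. v \<in> V \<Longrightarrow> (v, R v) \<in> D" by auto
  define \<pi> where "\<pi> = (\<lambda>v. if v \<in> V then R v else v)"
  have "R ` V \<subseteq> V" using R sub by auto
  then have "R ` V = V" using R(1) assms(1) by (simp add: endo_inj_surj)
  then have "bij_betw \<pi> V V" using R(1) by (auto simp: bij_betw_def \<pi>_def inj_on_def)
  then have perm: "\<pi> permutes V" by (rule bij_imp_permutes) (simp add: \<pi>_def)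
  have mem: "\<And>v. v \<in> V \<Longrightarrow> (v, \<pi> v) \<in> D" using R by (simp add: \<pi>_def)
  let ?D = "D - (\<lambda>v. (v, \<pi> v)) ` V"
  have "card {y. (v, y) \<in> ?D} = d - 1 \<and> card {x. (x, v) \<in> ?D} = d - 1" if v: "v \<in> V" for v
  proof
    have "{y. (v, y) \<in> ?D} = ?A v - {\<pi> v}" using v by auto
    then show "card {y. (v, y) \<in> ?D} = d - 1" using mem[OF v] out[OF v] finA by simp
    have iv: "inv \<pi> v \<in> V" "\<pi> (inv \<pi> v) = v"
      using perm v by (simp_all add: permutes_in_image permutes_inv permutes_inverses)
    have "{x. (x, v) \<in> ?D} = {x. (x, v) \<in> D} - {inv \<pi> v}"
      using iv perm by (auto simp: permutes_inverses)
    then show "card {x. (x, v) \<in> ?D} = d - 1" using mem[OF iv(1)] iv inn[OF v] finB by simp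
  qed
  then have "diregular (d - 1) V ?D" using sub by (auto simp: diregular_def)
  then show ?thesis using perm mem by blast
qed

section \<open>Paths, cycles and girth\<close>

lemma path_edges_simps [simp]:
  "path_edges [] = {}" "path_edges [a] = {}"
  "path_edges (a # b # xs) = insert {a, b} (path_edges (b # xs))"
  by (simp_all add: path_edges_def)

lemma path_edges_Cons: "xs \<noteq> [] \<Longrightarrow> path_edges (a # xs) = insert {a, hd xs} (path_edges xs)"
  by (cases xs) auto

lemma path_edges_append:
  "xs \<noteq> [] \<Longrightarrow> ys \<noteq> [] \<Longrightarrow>
    path_edges (xs @ ys) = insert {last xs, hd ys} (path_edges xs \<union> path_edges ys)"
proof (induction xs)
  case (Cons a xs)
  then show ?case by (cases xs) (auto simp: path_edges_Cons)
qed simp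

lemma path_edges_snoc: "xs \<noteq> [] \<Longrightarrow> path_edges (xs @ [a]) = insert {last xs, a} (path_edges xs)"
  by (simp add: path_edges_append)

lemma path_edges_rev [simp]: "path_edges (rev xs) = path_edges xs"
proof (induction xs)
  case (Cons a xs)
  then show ?case
    by (cases "xs = []") (auto simp: path_edges_snoc path_edges_Cons last_rev insert_commute)
qed simp

lemma path_edges_conv_nth: "path_edges xs = {{xs ! i, xs ! Suc i} | i. Suc i < length xs}"
proof (induction xs rule: induct_list012)
  case (3 a b xs)
  have "{{(a # b # xs) ! i, (a # b # xs) ! Suc i} | i. Suc i < length (a # b # xs)} =
    insert {a, b} {{(b # xs) ! i, (b # xs) ! Suc i} | i. Suc i < length (b # xs)}" (is "?L = ?R")
  proof (rule set_eqI, rule iffI)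
    fix e assume "e \<in> ?L"
    then obtain i where i: "Suc i < length (a # b # xs)" "e = {(a # b # xs) ! i, (a # b # xs) ! Suc i}"
      by blast
    show "e \<in> ?R"
    proof (cases i)
      case 0
      then show ?thesis using i by simp
    next
      case (Suc j)
      then have "Suc j < length (b # xs)" "e = {(b # xs) ! j, (b # xs) ! Suc j}" using i by simp_all
      then show ?thesis by blast
    qed
  next
    fix e assume "e \<in> ?R"
    then consider "e = {a, b}" | j where "Suc j < length (b # xs)" "e = {(b # xs) ! j, (b # xs) ! Suc j}"
      by blast
    then show "e \<in> ?L"
    proof cases
      case 1
      then have "Suc 0 < length (a # b # xs)" "e = {(a # b # xs) ! 0, (a # b # xs) ! Suc 0}" by simp_all
      then show ?thesis by blast
    next
      case 2
      then have "Suc (Suc j) < length (a # b # xs)"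
        "e = {(a # b # xs) ! Suc j, (a # b # xs) ! Suc (Suc j)}" by simp_all
      then show ?thesis by blast
    qed
  qed
  then show ?case using 3 by simp
qed simp_all

lemma path_edgesI: "Suc i < length xs \<Longrightarrow> {xs ! i, xs ! Suc i} \<in> path_edges xs"
  by (auto simp: path_edges_conv_nth)

lemma path_edges_subset_set: "e \<in> path_edges xs \<Longrightarrow> e \<subseteq> set xs"
  by (auto simp: path_edges_conv_nth)

lemma finite_path_edges [simp]: "finite (path_edges xs)"
  by (simp add: path_edges_def)

lemma path_edges_nth_consecutive:
  assumes "distinct xs" "i < j" "j < length xs" "{xs ! i, xs ! j} \<in> path_edges xs"
  shows "j = Suc i"
proof -
  from assms(4) obtain l where l: "Suc l < length xs" "{xs ! i, xs ! j} = {xs ! l, xs ! Suc l}"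
    by (auto simp: path_edges_conv_nth)
  then have "(xs ! i = xs ! l \<and> xs ! j = xs ! Suc l) \<or> (xs ! i = xs ! Suc l \<and> xs ! j = xs ! l)"
    by (simp add: doubleton_eq_iff)
  then have "(i = l \<and> j = Suc l) \<or> (i = Suc l \<and> j = l)"
    using assms(1-3) l(1) by (auto simp: nth_eq_iff_index_eq)
  then show ?thesis using assms(2) by auto
qed

lemma path_edges_hd_unique:
  assumes "distinct xs" "e \<in> path_edges xs" "hd xs \<in> e"
  shows "e = {hd xs, xs ! 1}"
proof -
  from assms(2) obtain l where l: "Suc l < length xs" "e = {xs ! l, xs ! Suc l}"
    by (auto simp: path_edges_conv_nth)
  then have "xs \<noteq> []" by auto
  then have "xs ! 0 \<in> e" using assms(3) by (simp add: hd_conv_nth)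
  then have "xs ! 0 = xs ! l \<or> xs ! 0 = xs ! Suc l" using l by simp
  moreover have "0 < length xs" "l < length xs" using l(1) by linarith+
  ultimately have "l = 0" using l(1) nth_eq_iff_index_eq[OF assms(1), of 0 l]
      nth_eq_iff_index_eq[OF assms(1), of 0 "Suc l"] by blast
  then show ?thesis using l \<open>xs \<noteq> []\<close> by (simp add: hd_conv_nth)
qed

lemma path_edges_interior:
  assumes "distinct xs" "v \<in> set xs" "v \<noteq> hd xs" "v \<noteq> last xs"
  shows "\<exists>e\<in>path_edges xs. \<exists>f\<in>path_edges xs. e \<noteq> f \<and> v \<in> e \<and> v \<in> f"
proof -
  from assms(2) obtain i where i: "i < length xs" "v = xs ! i" by (auto simp: in_set_conv_nth)
  have "xs \<noteq> []" using i by auto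
  then have "i \<noteq> 0" using assms(3) i by (metis hd_conv_nth)
  moreover have "i \<noteq> length xs - 1" using \<open>xs \<noteq> []\<close> assms(4) i by (metis last_conv_nth)
  ultimately have j: "Suc (i - 1) = i" "Suc i < length xs" using i(1) by linarith+
  let ?e = "{xs ! (i - 1), xs ! i}" and ?f = "{xs ! i, xs ! Suc i}"
  have "?e \<in> path_edges xs" using path_edgesI[of "i - 1" xs] j by simp
  moreover have "?f \<in> path_edges xs" using path_edgesI j by blast
  moreover have "xs ! (i - 1) \<noteq> xs ! Suc i" "xs ! (i - 1) \<noteq> xs ! i"
    using j nth_eq_iff_index_eq[OF assms(1), of "i - 1" "Suc i"]
      nth_eq_iff_index_eq[OF assms(1), of "i - 1" i] by linarith+
  then have "?e \<noteq> ?f" by (simp add: doubleton_eq_iff)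
  ultimately show ?thesis unfolding i(2) by (intro bexI[of _ ?e] bexI[of _ ?f]) simp_all
qed

lemma Union_path_edges: "2 \<le> length xs \<Longrightarrow> \<Union>(path_edges xs) = set xs"
proof (induction xs)
  case (Cons a xs)
  then show ?case by (cases xs; cases "tl xs") (auto simp: path_edges_Cons)
qed simp

lemma card_path_edges: "distinct xs \<Longrightarrow> card (path_edges xs) = length xs - 1"
proof (induction xs)
  case (Cons a xs)
  show ?case
  proof (cases "xs = []")
    case False
    have "{a, hd xs} \<notin> path_edges xs" using path_edges_subset_set Cons.prems by fastforce
    then show ?thesis using Cons False by (cases xs) (simp_all add: path_edges_Cons)
  qed simp
qed simp

lemma card_cycle_edges:
  assumes "distinct xs" "3 \<le> length xs"
  shows "card (cycle_edges xs) = length xs"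
proof -
  have "xs \<noteq> []" using assms by auto
  have "{last xs, hd xs} \<notin> path_edges xs"
  proof
    assume "{last xs, hd xs} \<in> path_edges xs"
    then have "{xs ! 0, xs ! (length xs - 1)} \<in> path_edges xs"
      using \<open>xs \<noteq> []\<close> by (simp add: hd_conv_nth last_conv_nth insert_commute)
    from path_edges_nth_consecutive[OF assms(1) _ _ this] have "length xs - 1 = 1"
      using assms(2) by (simp add: Suc_le_eq)
    then show False using assms(2) by simp
  qed
  then show ?thesis using assms by (simp add: cycle_edges_def card_path_edges)
qed

lemma path_end_unique_edge:
  assumes "path_end H v" "e \<in> H" "f \<in> H" "v \<in> e" "v \<in> f"
  shows "e = f"
proof -
  from assms(1) obtain vs where vs: "distinct vs" "H = path_edges vs" "v = hd vs \<or> v = last vs"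
    by (auto simp: path_end_def)
  from vs(3) show ?thesis
  proof
    assume "v = hd vs"
    then show ?thesis using path_edges_hd_unique[OF vs(1)] assms vs(2) by metis
  next
    assume "v = last vs"
    then have "v = hd (rev vs)" by (simp add: hd_rev)
    moreover have "distinct (rev vs)" "H = path_edges (rev vs)" using vs by simp_all
    ultimately show ?thesis using path_edges_hd_unique[of "rev vs"] assms by metis
  qed
qed

text \<open>\<open>path_end\<close> quantifies over all vertex lists with the same edge set. The
  ends do not depend on the list, because an end lies on one edge only and an inner vertex on
  two.\<close>

lemma path_end_path_edges:
  assumes "distinct vs" "2 \<le> length vs" "path_end (path_edges vs) v"
  shows "v = hd vs \<or> v = last vs"
proof (rule ccontr)
  assume neg: "\<not> ?thesis"
  obtain ws where ws: "distinct ws" "2 \<le> length ws" "path_edges vs = path_edges ws" "v = hd ws \<or> v = last ws"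
    using assms(3) unfolding path_end_def by blast
  then have "v \<in> set ws" by (cases ws) auto
  then have "v \<in> set vs" using Union_path_edges assms(2) ws(2,3) by metis
  from path_edges_interior[OF assms(1) this] neg path_end_unique_edge[OF assms(3)]
  show False by blast
qed

lemma cycle_edges_two:
  assumes "distinct vs" "3 \<le> length vs" "v \<in> set vs"
  shows "\<exists>e\<in>cycle_edges vs. \<exists>f\<in>cycle_edges vs. e \<noteq> f \<and> v \<in> e \<and> v \<in> f"
proof (cases "v = hd vs \<or> v = last vs")
  case False
  then show ?thesis using path_edges_interior[OF assms(1,3)] by (auto simp: cycle_edges_def)
next
  case True
  have ne: "vs \<noteq> []" using assms by auto
  let ?n = "length vs - 1"
  have n: "?n = Suc (?n - 1)" using assms(2) by simp
  have e: "{vs ! 0, vs ! 1} \<in> path_edges vs" using path_edgesI[of 0 vs] assms(2) by simp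
  have f: "{vs ! (?n - 1), vs ! ?n} \<in> path_edges vs" using path_edgesI[of "?n - 1" vs] assms(2) n by simp
  have g: "{vs ! ?n, vs ! 0} \<in> cycle_edges vs"
    using ne by (simp add: cycle_edges_def hd_conv_nth last_conv_nth)
  have idx: "vs ! i \<noteq> vs ! j" if "i < length vs" "j < length vs" "i \<noteq> j" for i j
    using that assms(1) by (simp add: nth_eq_iff_index_eq)
  have "vs ! 0 \<noteq> vs ! 1" by (rule idx) (use assms(2) in auto)
  moreover have "vs ! 1 \<noteq> vs ! ?n" by (rule idx) (use assms(2) in auto)
  moreover have "vs ! ?n \<noteq> vs ! (?n - 1)" by (rule idx) (use assms(2) in auto)
  moreover have "vs ! (?n - 1) \<noteq> vs ! 0" by (rule idx) (use assms(2) in auto)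
  ultimately have "{vs ! 0, vs ! 1} \<noteq> {vs ! ?n, vs ! 0}" "{vs ! (?n - 1), vs ! ?n} \<noteq> {vs ! ?n, vs ! 0}"
    by (simp_all add: doubleton_eq_iff)
  moreover have "v = vs ! 0 \<or> v = vs ! ?n" using True ne by (simp add: hd_conv_nth last_conv_nth)
  moreover have "{vs ! 0, vs ! 1} \<in> cycle_edges vs" "{vs ! (?n - 1), vs ! ?n} \<in> cycle_edges vs"
    using e f by (simp_all add: cycle_edges_def)
  ultimately show ?thesis using g by (metis insertCI)
qed

text \<open>Each vertex of a cycle lies on two of its edges, an end of a path on one. This keeps
  paths and cycles apart where a balanced decomposition counts its paths.\<close>

lemma path_not_cycle:
  assumes "distinct vs" "2 \<le> length vs"
  shows "\<not> is_cycle (path_edges vs)"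
proof
  assume "is_cycle (path_edges vs)"
  then obtain ws where ws: "distinct ws" "3 \<le> length ws" "path_edges vs = cycle_edges ws"
    by (auto simp: is_cycle_def)
  have "path_end (path_edges vs) (hd vs)" using assms by (auto simp: path_end_def)
  have "\<Union>(cycle_edges ws) = set ws"
    using ws(2) Union_path_edges[of ws] by (cases ws) (auto simp: cycle_edges_def)
  moreover have "hd vs \<in> \<Union>(path_edges vs)" using assms(2) Union_path_edges[OF assms(2)] by (cases vs) auto
  ultimately have "hd vs \<in> set ws" using ws(3) by simp
  from cycle_edges_two[OF ws(1,2) this] ws(3) path_end_unique_edge[OF \<open>path_end (path_edges vs) (hd vs)\<close>]
  show False by metis
qed

section \<open>Chords of paths under a girth bound\<close>

lemma girth_chord:
  assumes girth: "girth_at_least g E" and "distinct xs" "path_edges xs \<subseteq> E"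
    and "Suc i < j" "j < length xs" "{xs ! i, xs ! j} \<in> E"
  shows "i + g \<le> Suc j"
proof -
  define ys where "ys = take (Suc j - i) (drop i xs)"
  have len: "length ys = Suc j - i" using assms by (simp add: ys_def)
  then have ne: "ys \<noteq> []" using assms by auto
  have nth: "ys ! l = xs ! (i + l)" if "l < Suc j - i" for l
    using that assms by (simp add: ys_def)
  have dist: "distinct ys" using assms(2) by (simp add: ys_def)
  have hl: "hd ys = xs ! i" "last ys = xs ! j"
    using ne len nth[of 0] nth[of "j - i"] assms by (simp_all add: hd_conv_nth last_conv_nth Suc_diff_le)
  have "path_edges ys \<subseteq> path_edges xs"
  proof
    fix e assume "e \<in> path_edges ys"
    then obtain l where l: "Suc l < Suc j - i" "e = {ys ! l, ys ! Suc l}"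
      using len by (auto simp: path_edges_conv_nth)
    then have "e = {xs ! (i + l), xs ! Suc (i + l)}" using nth[of l] nth[of "Suc l"] by simp
    then show "e \<in> path_edges xs" using path_edgesI[of "i + l" xs] l assms by simp
  qed
  then have "cycle_edges ys \<subseteq> E" using assms hl by (auto simp: cycle_edges_def insert_commute)
  moreover have "is_cycle (cycle_edges ys)" using dist len assms by (auto simp: is_cycle_def)
  ultimately have "g \<le> card (cycle_edges ys)" using girth by (auto simp: girth_at_least_def)
  also have "\<dots> = Suc j - i" using card_cycle_edges[OF dist] len assms by simp
  finally show ?thesis using assms(4) by simp
qed

text \<open>The source of the later case analyses: when a path has few more vertices than the girth,
  an edge from its end back into the path reaches only positions up to \<open>length xs - g\<close>.
  The neighbour of the end is no exception, since the edge is not on the path.\<close>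

lemma girth_last:
  assumes "girth_at_least g E" "distinct xs" "path_edges xs \<subseteq> E"
    and "{last xs, xs ! i} \<in> E" "{last xs, xs ! i} \<notin> path_edges xs" "i < length xs" "xs ! i \<noteq> last xs"
  shows "i + g \<le> length xs"
proof -
  have ne: "xs \<noteq> []" using assms by auto
  then have l: "last xs = xs ! (length xs - 1)" by (simp add: last_conv_nth)
  then have "i \<noteq> length xs - 1" using assms by auto
  moreover have "i \<noteq> length xs - 2"
  proof
    assume "i = length xs - 2"
    then have "{xs ! i, last xs} \<in> path_edges xs"
      using path_edgesI[of i xs] l calculation assms(6) by (cases "length xs = 1") (auto simp: Suc_diff_Suc numeral_2_eq_2)
    then show False using assms by (simp add: insert_commute)
  qed
  ultimately have "Suc i < length xs - 1" using assms(6) by linarith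
  then show ?thesis
    using girth_chord[OF assms(1-3), of i "length xs - 1"] assms(4) l ne by (simp add: insert_commute)
qed

lemma girth_hd:
  assumes "girth_at_least g E" "distinct xs" "path_edges xs \<subseteq> E"
    and "{hd xs, xs ! i} \<in> E" "{hd xs, xs ! i} \<notin> path_edges xs" "i < length xs" "xs ! i \<noteq> hd xs"
  shows "g \<le> Suc i"
proof -
  have ne: "xs \<noteq> []" using assms by auto
  have "rev xs ! (length xs - Suc i) = xs ! i" using assms(6) by (simp add: rev_nth)
  then have "(length xs - Suc i) + g \<le> length (rev xs)"
    using girth_last[of g E "rev xs" "length xs - Suc i"] assms by (simp add: last_rev)
  then show ?thesis using assms(6) by simp
qed

lemma girth_no_triangle:
  assumes "girth_at_least g E" "4 \<le> g" "{a, b} \<in> E" "{b, c} \<in> E" "{a, c} \<in> E"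
    and "a \<noteq> b" "b \<noteq> c" "a \<noteq> c"
  shows False
  using girth_chord[OF assms(1), of "[a, b, c]" 0 2] assms by (simp add: insert_commute)

lemma girth_four_cycle:
  assumes "girth_at_least g E" "{a, b} \<in> E" "{b, c} \<in> E" "{c, d} \<in> E" "{a, d} \<in> E" "distinct [a, b, c, d]"
  shows "g \<le> 4"
proof -
  have "[a, b, c, d] ! 3 = d" by (simp add: eval_nat_numeral)
  then show ?thesis using girth_chord[OF assms(1), of "[a, b, c, d]" 0 3] assms by (simp add: insert_commute)
qed

section \<open>Exchanging the last two permutations\<close>

text \<open>The last conditions say that no edge arises twice: neither permutation has a 2-cycle,
  and they share no edge. Thus \<open>\<theta>\<close> and \<open>\<rho>\<close> are two oriented
  2-factors that partition \<open>A\<close>; many contradictions below consist in exhibiting a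
  2-cycle.\<close>

definition two_factors :: "'a set \<Rightarrow> 'a set set \<Rightarrow> ('a \<Rightarrow> 'a) \<Rightarrow> ('a \<Rightarrow> 'a) \<Rightarrow> bool" where
  "two_factors V A \<theta> \<rho> \<longleftrightarrow> \<theta> permutes V \<and> \<rho> permutes V \<and>
     A = (\<Union>x\<in>V. {{x, \<theta> x}, {x, \<rho> x}}) \<and>
     (\<forall>x\<in>V. \<theta> x \<noteq> x \<and> \<rho> x \<noteq> x) \<and>
     (\<forall>x\<in>V. \<forall>y\<in>V. ({x, \<theta> x} = {y, \<theta> y} \<longrightarrow> x = y) \<and> ({x, \<rho> x} = {y, \<rho> y} \<longrightarrow> x = y) \<and>
        {x, \<theta> x} \<noteq> {y, \<rho> y})"

text \<open>Here \<open>st\<close> maps each end of a path to its other end, and all paths are about to be prolonged by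
  \<open>\<theta>\<close> and then by \<open>\<rho>\<close>. The tail \<open>a\<close> is bad if \<open>\<rho>\<close> leads from \<open>a\<close> back to the other end of the same
  path.\<close>
definition bad_tails :: "'a set \<Rightarrow> ('a \<Rightarrow> 'a) \<Rightarrow> ('a \<Rightarrow> 'a) \<Rightarrow> ('a \<Rightarrow> 'a) \<Rightarrow> 'a set" where
  "bad_tails V st \<theta> \<rho> = {a \<in> V. \<rho> a = \<theta> (st (inv \<theta> a))}"

lemma two_factorsD:
  assumes "two_factors V A \<theta> \<rho>"
  shows "\<theta> permutes V" "\<rho> permutes V"
    and "x \<in> V \<Longrightarrow> \<theta> x \<noteq> x" "x \<in> V \<Longrightarrow> \<rho> x \<noteq> x"
    and "\<lbrakk>x \<in> V; y \<in> V; {x, \<theta> x} = {y, \<theta> y}\<rbrakk> \<Longrightarrow> x = y"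
    and "\<lbrakk>x \<in> V; y \<in> V; {x, \<rho> x} = {y, \<rho> y}\<rbrakk> \<Longrightarrow> x = y"
    and "\<lbrakk>x \<in> V; y \<in> V\<rbrakk> \<Longrightarrow> {x, \<theta> x} \<noteq> {y, \<rho> y}"
  using assms unfolding two_factors_def by blast+

lemma permutesI_inj:
  assumes "finite V" "\<And>x. x \<in> V \<Longrightarrow> f x \<in> V" "inj_on f V" "\<And>x. x \<notin> V \<Longrightarrow> f x = x"
  shows "f permutes V"
proof (rule bij_imp_permutes)
  have "f ` V = V" using assms by (intro endo_inj_surj) auto
  then show "bij_betw f V V" using assms(3) by (simp add: bij_betw_def)
qed (use assms in auto)

locale involution =
  fixes V :: "'a set" and st :: "'a \<Rightarrow> 'a"
  assumes finV: "finite V" and st_perm: "st permutes V" and st_st: "\<And>x. st (st x) = x"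
begin

text \<open>This permutation, called \<open>lam\<close> below, takes a tail
  \<open>\<theta> x\<close> to the other inner end \<open>st x\<close> of the same path. A tail
  \<open>a\<close> is bad iff the \<open>\<rho>\<close>-arc of \<open>a\<close> and the
  \<open>\<theta>\<close>-arc of \<open>lam a\<close> end in the same vertex.\<close>

lemma lam_perm: "\<theta> permutes V \<Longrightarrow> (\<lambda>a. st (inv \<theta> a)) permutes V"
  using permutes_compose[OF permutes_inv st_perm] by (simp add: o_def)

text \<open>The exchange of \<open>\<theta>\<close> and \<open>\<rho>\<close> on \<open>K\<close>.
  As \<open>\<rho> a = \<theta> (lam a)\<close> on \<open>K\<close> and \<open>lam\<close> preserves
  \<open>K\<close>, both map \<open>K\<close> onto the same set, so the exchanged maps are
  permutations again. The \<open>card K\<close> paths with tail in \<open>K\<close> are no longer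
  counted; the only new bad ones have an inner end \<open>k\<close> in \<open>K\<close> with
  \<open>\<rho> (\<rho> k) = \<theta> (st k)\<close>, and \<open>lam a0\<close> is not such a
  \<open>k\<close>.\<close>

lemma flip_reduces_bad_tails:
  assumes tf: "two_factors V A \<theta> \<rho>" and K: "K \<subseteq> bad_tails V st \<theta> \<rho>"
    and inv: "(\<lambda>a. st (inv \<theta> a)) ` K = K"
    and two: "\<And>a. a \<in> K \<Longrightarrow> st (inv \<theta> (st (inv \<theta> a))) \<noteq> a"
    and ex: "a0 \<in> K" "\<rho> (\<rho> (st (inv \<theta> a0))) \<noteq> a0"
  shows "\<exists>\<theta>' \<rho>'. two_factors V A \<theta>' \<rho>' \<and> card (bad_tails V st \<theta>' \<rho>') < card (bad_tails V st \<theta> \<rho>)"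
proof -
  note tfD = two_factorsD[OF tf]
  define lam where "lam = (\<lambda>a. st (inv \<theta> a))"
  have lamK: "lam a \<in> K \<longleftrightarrow> a \<in> K" for a
  proof
    have "inj lam" using lam_perm[OF tfD(1)] unfolding lam_def by (rule permutes_inj)
    then show "lam a \<in> K \<Longrightarrow> a \<in> K" using inv unfolding lam_def[symmetric] by (metis imageE injD)
  qed (use inv lam_def in auto)
  have KV: "K \<subseteq> V" and badK: "\<And>a. a \<in> K \<Longrightarrow> \<rho> a = \<theta> (lam a)"
    using K by (auto simp: bad_tails_def lam_def)
  have thinj: "\<theta> x = \<theta> y \<longleftrightarrow> x = y" and rhinj: "\<rho> x = \<rho> y \<longleftrightarrow> x = y" for x y
    using tfD(1,2) by (auto dest: permutes_inj injD)
  have thV: "\<theta> x \<in> V \<longleftrightarrow> x \<in> V" and rhV: "\<rho> x \<in> V \<longleftrightarrow> x \<in> V" for x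
    using tfD(1,2) by (simp_all add: permutes_in_image)
  have img: "\<rho> ` K = \<theta> ` K"
  proof -
    have "\<rho> ` K = \<theta> ` (lam ` K)" using badK by (auto simp: image_image)
    then show ?thesis using inv by (simp add: lam_def)
  qed
  have cross: "\<rho> x \<noteq> \<theta> y" if "x \<in> K" "y \<notin> K" for x y
    using that img thinj by (metis imageE imageI)
  have cross': "\<theta> x \<noteq> \<rho> y" if "x \<in> K" "y \<notin> K" for x y
    using that img rhinj by (metis imageE imageI)
  define \<theta>' \<rho>' where "\<theta>' = (\<lambda>x. if x \<in> K then \<rho> x else \<theta> x)"
    and "\<rho>' = (\<lambda>x. if x \<in> K then \<theta> x else \<rho> x)"
  have p1: "\<theta>' permutes V"
  proof (rule permutesI_inj[OF finV])
    show "inj_on \<theta>' V"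
      by (rule inj_onI) (metis \<theta>'_def cross thinj rhinj)
    show "\<theta>' x = x" if "x \<notin> V" for x
      using that KV tfD(1) by (auto simp: \<theta>'_def permutes_not_in)
  qed (simp add: \<theta>'_def thV rhV)
  have p2: "\<rho>' permutes V"
  proof (rule permutesI_inj[OF finV])
    show "inj_on \<rho>' V"
      by (rule inj_onI) (metis \<rho>'_def cross' thinj rhinj)
    show "\<rho>' x = x" if "x \<notin> V" for x
      using that KV tfD(2) by (auto simp: \<rho>'_def permutes_not_in)
  qed (simp add: \<rho>'_def thV rhV)
  have tf': "two_factors V A \<theta>' \<rho>'"
    unfolding two_factors_def
  proof (intro conjI p1 p2 ballI impI)
    have "{{x, \<theta> x}, {x, \<rho> x}} = {{x, \<theta>' x}, {x, \<rho>' x}}" for x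
      by (auto simp: \<theta>'_def \<rho>'_def)
    then show "A = (\<Union>x\<in>V. {{x, \<theta>' x}, {x, \<rho>' x}})"
      using tf unfolding two_factors_def by simp
  next
    fix x y assume xy: "x \<in> V" "y \<in> V"
    show "{x, \<theta>' x} \<noteq> {y, \<rho>' y}"
      using tfD(5,6,7)[OF xy] tfD(7)[OF xy(2,1)] unfolding \<theta>'_def \<rho>'_def
      by (cases "x \<in> K"; cases "y \<in> K") (simp_all, metis+)
    show "x = y" if "{x, \<theta>' x} = {y, \<theta>' y}"
      using that tfD(5,6,7)[OF xy] tfD(7)[OF xy(2,1)] unfolding \<theta>'_def
      by (cases "x \<in> K"; cases "y \<in> K") simp_all
    show "x = y" if "{x, \<rho>' x} = {y, \<rho>' y}"
      using that tfD(5,6,7)[OF xy] tfD(7)[OF xy(2,1)] unfolding \<rho>'_def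
      by (cases "x \<in> K"; cases "y \<in> K") simp_all
  qed (use tfD(3,4) in \<open>auto simp: \<theta>'_def \<rho>'_def\<close>)
  \<comment> \<open>Bad paths are counted by the inner end \<open>x\<close> and not by the tail
    \<open>\<theta> x\<close>, since the exchange changes the tails.\<close>
  define BX :: "('a \<Rightarrow> 'a) \<Rightarrow> ('a \<Rightarrow> 'a) \<Rightarrow> 'a set"
    where "BX = (\<lambda>\<theta> \<rho>. {x \<in> V. \<rho> (\<theta> x) = \<theta> (st x)})"
  have cardBX: "card (bad_tails V st t r) = card (BX t r)" if t: "t permutes V" for t r
  proof -
    have "bad_tails V st t r = t ` BX t r"
    proof (rule set_eqI, rule iffI)
      fix a assume "a \<in> bad_tails V st t r"
      then have "inv t a \<in> BX t r" "a = t (inv t a)"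
        using t by (auto simp: bad_tails_def BX_def permutes_inverses permutes_in_image permutes_inv)
      then show "a \<in> t ` BX t r" by blast
    qed (use t in \<open>auto simp: bad_tails_def BX_def permutes_inverses permutes_in_image\<close>)
    moreover have "inj_on t (BX t r)" using t by (meson permutes_inj inj_on_subset subset_UNIV)
    ultimately show ?thesis by (simp add: card_image)
  qed
  have finBX: "finite (BX t r)" for t r using finV by (simp add: BX_def)
  let ?B1 = "{x \<in> BX \<theta> \<rho>. \<theta> x \<notin> K}" and ?B2 = "{k \<in> K. \<rho> (\<rho> k) = \<theta> (st k)}"
  have finK: "finite K" using KV finV finite_subset by blast
  have "BX \<theta>' \<rho>' \<subseteq> ?B1 \<union> ?B2"
  proof
    fix x assume "x \<in> BX \<theta>' \<rho>'"
    then have x: "x \<in> V" "\<rho>' (\<theta>' x) = \<theta>' (st x)" by (simp_all add: BX_def)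
    have lamth: "lam (\<theta> x) = st x" using tfD(1) by (simp add: lam_def permutes_inverses)
    \<comment> \<open>The two ends of one prolonged path are never both bad: \<open>\<rho>\<close>
      would swap them and have a 2-cycle.\<close>
    have nbad: "\<rho> y \<notin> K" if y: "y \<in> K" for y
    proof
      assume "\<rho> y \<in> K"
      then have "\<rho> (\<rho> y) = \<theta> (lam (\<theta> (lam y)))" using badK y by metis
      also have "\<dots> = y" using tfD(1) by (simp add: lam_def permutes_inverses st_st)
      finally have "{y, \<rho> y} = {\<rho> y, \<rho> (\<rho> y)}" by auto
      moreover have "y \<in> V" using y KV by blast
      ultimately show False using tfD(6)[of y "\<rho> y"] tfD(4)[of y] rhV[of y] by simp
    qed
    show "x \<in> ?B1 \<union> ?B2"
    proof (cases "x \<in> K")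
      case True
      have "\<theta> (st x) \<notin> K" if "st x \<in> K"
      proof -
        have "\<theta> (st x) \<in> \<rho> ` K" using that img by blast
        then show ?thesis by (metis nbad imageE)
      qed
      moreover have "\<rho>' (\<theta>' x) = \<rho> (\<rho> x)" using True nbad by (simp add: \<theta>'_def \<rho>'_def)
      moreover have "st x \<notin> K"
      proof
        assume "st x \<in> K"
        then have "\<theta> x \<in> K" using lamth lamK by metis
        moreover have "\<theta> x \<in> \<rho> ` K" using True img by blast
        ultimately show False by (metis nbad imageE)
      qed
      ultimately show ?thesis using x True by (simp add: \<theta>'_def)
    next
      case False
      \<comment> \<open>If the tail is in \<open>K\<close>, so is \<open>st x\<close>, and the arcs
        at both are exchanged. Badness after the exchange would make \<open>lam\<close> return to
        \<open>\<theta> x\<close> after two steps, against \<open>two\<close>.\<close>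
      have "\<theta> x \<notin> K"
      proof
        assume th: "\<theta> x \<in> K"
        then have stx: "st x \<in> K" using lamth lamK by metis
        have "\<theta> (\<theta> x) = \<rho> (st x)" using x(2) False th stx by (simp add: \<theta>'_def \<rho>'_def)
        also have "\<dots> = \<theta> (lam (lam (\<theta> x)))" using badK[OF stx] lamth by simp
        finally have "\<theta> x = lam (lam (\<theta> x))" using thinj by simp
        then show False using two[OF th] by (simp add: lam_def)
      qed
      moreover have "st x \<notin> K" using calculation lamth lamK by metis
      ultimately have "x \<in> ?B1" using x False by (simp add: BX_def \<theta>'_def \<rho>'_def)
      then show ?thesis by blast
    qed
  qed
  then have "card (BX \<theta>' \<rho>') \<le> card (?B1 \<union> ?B2)" using finBX finK by (intro card_mono) auto
  also have "\<dots> \<le> card ?B1 + card ?B2" by (rule card_Un_le)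
  also have "card ?B2 < card K"
  proof (rule psubset_card_mono[OF finK])
    have "lam a0 \<in> K" using ex lamK by blast
    moreover have "\<theta> (st (lam a0)) = a0" using tfD(1) by (simp add: lam_def st_st permutes_inverses)
    then have "lam a0 \<notin> ?B2" using ex by (simp add: lam_def)
    ultimately show "?B2 \<subset> K" by blast
  qed
  finally have "card (BX \<theta>' \<rho>') < card ?B1 + card K" by simp
  also have "card K = card {x \<in> BX \<theta> \<rho>. \<theta> x \<in> K}"
  proof -
    have "inv \<theta> ` K = {x \<in> BX \<theta> \<rho>. \<theta> x \<in> K}"
    proof (rule set_eqI, rule iffI)
      fix x assume "x \<in> inv \<theta> ` K"
      then obtain a where a: "a \<in> K" "x = inv \<theta> a" by blast
      then show "x \<in> {x \<in> BX \<theta> \<rho>. \<theta> x \<in> K}"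
        using KV badK[OF a(1)] tfD(1)
        by (auto simp: BX_def lam_def permutes_inverses permutes_in_image permutes_inv)
    next
      fix x assume "x \<in> {x \<in> BX \<theta> \<rho>. \<theta> x \<in> K}"
      then have "\<theta> x \<in> K" "x = inv \<theta> (\<theta> x)" using tfD(1) by (auto simp: permutes_inverses)
      then show "x \<in> inv \<theta> ` K" by blast
    qed
    moreover have "inj_on (inv \<theta>) K"
      using permutes_inv[OF tfD(1)] by (meson permutes_inj inj_on_subset subset_UNIV)
    ultimately show ?thesis by (metis card_image)
  qed
  also have "card ?B1 + card {x \<in> BX \<theta> \<rho>. \<theta> x \<in> K} = card (BX \<theta> \<rho>)"
    using finBX by (subst card_Un_disjoint[symmetric]) (auto intro: arg_cong[where f = card])
  finally show ?thesis using tf' cardBX p1 tfD(1) by metis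
qed

text \<open>By \<open>alpha\<close>, \<open>\<rho>\<close> maps the image of \<open>T\<close> back
  onto \<open>T\<close>, so \<open>T\<close> and its image together consist of whole cycles of
  \<open>\<rho>\<close>, which can be run backwards without changing an edge. A bad edge from
  \<open>a\<close> to the opposite end \<open>\<rho> a\<close> is then traversed the other way, so
  badness moves from \<open>a\<close> to the opposite end.\<close>

lemma reverse_bad_tails:
  assumes tf: "two_factors V A \<theta> \<rho>" and T: "T \<subseteq> bad_tails V st \<theta> \<rho>"
    and inv: "(\<lambda>a. st (inv \<theta> a)) ` T = T"
    and alpha: "\<And>a. a \<in> T \<Longrightarrow> \<rho> (\<rho> (st (inv \<theta> a))) = a"
    and r': "\<rho>' = (\<lambda>x. if x \<in> T \<union> \<rho> ` T then inv \<rho> x else \<rho> x)"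
  shows "two_factors V A \<theta> \<rho>'" "bad_tails V st \<theta> \<rho>' = (bad_tails V st \<theta> \<rho> - T) \<union> \<rho> ` T"
    "\<rho> ` T \<inter> T = {}" "\<rho> ` (T \<union> \<rho> ` T) = T \<union> \<rho> ` T"
    "card (bad_tails V st \<theta> \<rho>') = card (bad_tails V st \<theta> \<rho>)"
proof -
  note tfD = two_factorsD[OF tf]
  define lam where "lam = (\<lambda>a. st (inv \<theta> a))"
  have TV: "T \<subseteq> V" and badT: "\<And>a. a \<in> T \<Longrightarrow> \<rho> a = \<theta> (lam a)"
    using T by (auto simp: bad_tails_def lam_def)
  have ri: "\<rho> (inv \<rho> x) = x" "inv \<rho> (\<rho> x) = x" and ti: "\<theta> (inv \<theta> x) = x" "inv \<theta> (\<theta> x) = x" for x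
    using tfD(1,2) by (simp_all add: permutes_inverses)
  have rhV: "\<rho> x \<in> V \<longleftrightarrow> x \<in> V" and riV: "inv \<rho> x \<in> V \<longleftrightarrow> x \<in> V" for x
    using tfD(2) by (simp_all add: permutes_in_image permutes_inv)
  show disj: "\<rho> ` T \<inter> T = {}"
  proof (rule equals0I)
    fix b assume "b \<in> \<rho> ` T \<inter> T"
    then obtain y where y: "y \<in> T" "b = \<rho> y" "b \<in> T" by blast
    have "\<rho> (\<rho> y) = \<theta> (lam (\<theta> (lam y)))" using badT y by metis
    also have "\<dots> = y" by (simp add: lam_def ti st_st)
    finally have "{y, \<rho> y} = {\<rho> y, \<rho> (\<rho> y)}" by auto
    moreover have "y \<in> V" using y TV by blast
    ultimately show False using tfD(6)[of y "\<rho> y"] tfD(4)[of y] rhV[of y] by simp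
  qed
  have rr: "\<rho> ` (\<rho> ` T) = T"
  proof -
    have "\<rho> ` (\<rho> ` T) = \<rho> ` (\<rho> ` (lam ` T))" using inv by (simp add: lam_def)
    also have "\<dots> = T" using alpha by (simp add: image_image lam_def)
    finally show ?thesis .
  qed
  show R: "\<rho> ` (T \<union> \<rho> ` T) = T \<union> \<rho> ` T" using rr by (auto simp: image_Un)
  let ?R = "T \<union> \<rho> ` T"
  have RV: "?R \<subseteq> V" using TV rhV by auto
  have rR: "\<rho> x \<in> ?R \<longleftrightarrow> x \<in> ?R" for x
  proof
    assume "\<rho> x \<in> ?R"
    then obtain y where "y \<in> ?R" "\<rho> x = \<rho> y" using R by blast
    then show "x \<in> ?R" by (metis ri(2))
  qed (use R in blast)
  have riR: "inv \<rho> x \<in> ?R \<longleftrightarrow> x \<in> ?R" for x using rR[of "inv \<rho> x"] by (simp add: ri)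
  have perm: "\<rho>' permutes V"
  proof (rule permutesI_inj[OF finV])
    show "inj_on \<rho>' V"
      by (rule inj_onI) (metis r' ri rR riR)
    show "\<rho>' x = x" if "x \<notin> V" for x
      using that RV tfD(2) by (auto simp: r' permutes_not_in)
    show "\<rho>' x \<in> V" if "x \<in> V" for x using that by (simp add: r' rhV riV)
  qed
  have edge: "\<exists>y\<in>V. {x, \<rho>' x} = {y, \<rho> y} \<and> (x \<in> ?R \<longrightarrow> y = inv \<rho> x) \<and> (x \<notin> ?R \<longrightarrow> y = x)"
    if "x \<in> V" for x
    using that by (cases "x \<in> ?R") (auto simp: r' ri riV insert_commute)
  show tf': "two_factors V A \<theta> \<rho>'"
    unfolding two_factors_def
  proof (intro conjI perm tfD(1) ballI impI)
    have "(\<lambda>x. {x, \<rho>' x}) ` V = (\<lambda>x. {x, \<rho> x}) ` V"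
    proof (rule set_eqI, rule iffI)
      fix e assume "e \<in> (\<lambda>x. {x, \<rho> x}) ` V"
      then obtain x where x: "x \<in> V" "e = {x, \<rho> x}" by blast
      show "e \<in> (\<lambda>x. {x, \<rho>' x}) ` V"
      proof (cases "x \<in> ?R")
        case True
        then have "e = {\<rho> x, \<rho>' (\<rho> x)}" "\<rho> x \<in> V"
          using x rR[of x] by (auto simp: r' ri rhV)
        then show ?thesis by blast
      next
        case False
        then show ?thesis using x by (auto simp: r')
      qed
    qed (use edge in blast)
    then have "(\<Union>x\<in>V. {{x, \<theta> x}, {x, \<rho>' x}}) = (\<Union>x\<in>V. {{x, \<theta> x}, {x, \<rho> x}})" by blast
    then show "A = (\<Union>x\<in>V. {{x, \<theta> x}, {x, \<rho>' x}})"
      using tf unfolding two_factors_def by simp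
  next
    fix x y assume xy: "x \<in> V" "y \<in> V"
    show "{x, \<theta> x} \<noteq> {y, \<rho>' y}" using edge[OF xy(2)] tfD(7)[OF xy(1)] by auto
    show "x = y" if "{x, \<theta> x} = {y, \<theta> y}" using that tfD(5) xy by blast
    show "x = y" if eq: "{x, \<rho>' x} = {y, \<rho>' y}"
    proof -
      obtain x' y' where "x' \<in> V" "y' \<in> V" "{x', \<rho> x'} = {y', \<rho> y'}"
        "(x \<in> ?R \<longrightarrow> x' = inv \<rho> x) \<and> (x \<notin> ?R \<longrightarrow> x' = x)" "(y \<in> ?R \<longrightarrow> y' = inv \<rho> y) \<and> (y \<notin> ?R \<longrightarrow> y' = y)"
        using edge[OF xy(1)] edge[OF xy(2)] eq by metis
      moreover from this have "x' = y'" using tfD(6) by blast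
      ultimately show ?thesis using ri(1) riR by metis
    qed
  next
    fix x assume x: "x \<in> V"
    show "\<theta> x \<noteq> x" using tfD(3) x by blast
    show "\<rho>' x \<noteq> x" using tfD(4)[OF x] ri by (metis r')
  qed
  show bt: "bad_tails V st \<theta> \<rho>' = (bad_tails V st \<theta> \<rho> - T) \<union> \<rho> ` T" (is "_ = ?B")
  proof (rule set_eqI)
    fix a
    have b1: "a \<in> bad_tails V st \<theta> r \<longleftrightarrow> a \<in> V \<and> r a = \<theta> (lam a)" for r
      by (simp add: bad_tails_def lam_def)
    consider "a \<notin> V" | "a \<in> T" | "a \<in> \<rho> ` T" | "a \<in> V" "a \<notin> ?R" by blast
    then show "a \<in> bad_tails V st \<theta> \<rho>' \<longleftrightarrow> a \<in> ?B"
    proof cases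
      case 1
      then show ?thesis using RV by (auto simp: b1)
    next
      case 2
      have "inv \<rho> a \<noteq> \<rho> a"
      proof
        assume "inv \<rho> a = \<rho> a"
        then have "{\<rho> a, \<rho> (\<rho> a)} = {a, \<rho> a}" by (metis ri(1) insert_commute)
        moreover have "a \<in> V" using 2 TV by blast
        ultimately show False using tfD(6)[of "\<rho> a" a] rhV[of a] tfD(4)[of a] by simp
      qed
      then have "a \<notin> bad_tails V st \<theta> \<rho>'" using 2 badT by (auto simp: b1 r')
      moreover have "a \<notin> ?B" using 2 disj by blast
      ultimately show ?thesis by blast
    next
      case 3
      then obtain y where y: "y \<in> T" "a = \<rho> y" by blast
      have "\<theta> (lam a) = y" using badT[OF y(1)] y(2) by (simp add: lam_def ti st_st)
      moreover have "\<rho>' a = y" using 3 y by (simp add: r' ri)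
      ultimately have "a \<in> bad_tails V st \<theta> \<rho>'" using 3 RV by (auto simp: b1)
      then show ?thesis using 3 by blast
    next
      case 4
      then have "\<rho>' a = \<rho> a" by (simp add: r')
      then show ?thesis using 4 by (auto simp: b1)
    qed
  qed
  have finB: "finite (bad_tails V st \<theta> \<rho>)" using finV by (simp add: bad_tails_def)
  then have finT: "finite T" using T finite_subset by blast
  have "bad_tails V st \<theta> \<rho> \<inter> \<rho> ` T = {}"
  proof (rule equals0I)
    fix b assume "b \<in> bad_tails V st \<theta> \<rho> \<inter> \<rho> ` T"
    then obtain y where y: "y \<in> T" "b = \<rho> y" "\<rho> b = \<theta> (lam b)" by (auto simp: bad_tails_def lam_def)
    then have "\<rho> (\<rho> y) = y" using badT[OF y(1)] by (simp add: lam_def ti st_st)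
    then have "{y, \<rho> y} = {\<rho> y, \<rho> (\<rho> y)}" by auto
    moreover have "y \<in> V" using y TV by blast
    ultimately show False using tfD(6)[of y "\<rho> y"] tfD(4)[of y] rhV[of y] by simp
  qed
  moreover have "card (\<rho> ` T) = card T" by (rule card_image) (metis ri(2) inj_onI)
  ultimately have "card ?B = card (bad_tails V st \<theta> \<rho> - T) + card T"
    using finB finT by (subst card_Un_disjoint) auto
  also have "\<dots> = card (bad_tails V st \<theta> \<rho>)"
    using finB finT T by (simp add: card_Diff_subset card_mono)
  finally show "card (bad_tails V st \<theta> \<rho>') = card (bad_tails V st \<theta> \<rho>)" using bt by simp
qed

end

text \<open>A 2-colouring along the orbits of \<open>f\<close>, required only between
  \<open>a\<close> and \<open>f a\<close> with \<open>a\<close> in \<open>B\<close>. It could fail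
  only on an odd cycle inside \<open>B\<close>; by \<open>two\<close> and \<open>fp\<close> all
  cycles inside \<open>B\<close> have length 2, and there the labels \<open>h\<close> decide.
  Elsewhere the colour is the parity of the number of consecutive predecessors in
  \<open>B\<close>.\<close>

lemma alternating_set:
  fixes f :: "'a \<Rightarrow> 'a"
  assumes "finite V" "f permutes V" "B \<subseteq> V"
    and two: "\<And>a. (\<And>n. (inv f ^^ n) a \<in> B) \<Longrightarrow> f (f a) = a"
    and fp: "\<And>a. a \<in> B \<Longrightarrow> f a \<noteq> a"
  shows "\<exists>S. S \<subseteq> f ` B \<and> (\<forall>a\<in>B. a \<in> S \<longleftrightarrow> f a \<notin> S)"
proof -
  let ?g = "inv f"
  have gf: "?g (f a) = a" "f (?g a) = a" for a using assms(2) by (simp_all add: permutes_inverses)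
  have iter: "(?g ^^ Suc n) (f a) = (?g ^^ n) a" for n a
    by (simp add: funpow_Suc_right gf del: funpow.simps)
  obtain h :: "'a \<Rightarrow> nat" where h: "inj_on h V"
    using finite_imp_inj_to_nat_seg[OF assms(1)] by blast
  define allb where "allb a \<longleftrightarrow> (\<forall>n. (?g ^^ Suc n) a \<in> B)" for a
  define n where "n a = (LEAST n. (?g ^^ Suc n) a \<notin> B)" for a
  define S where "S = {a. if allb a then h a < h (f a) else odd (n a)}"
  have allb_f: "allb (f a) \<longleftrightarrow> allb a" if "a \<in> B" for a
  proof -
    have "allb (f a) \<longleftrightarrow> (\<forall>n. (?g ^^ n) a \<in> B)" by (simp only: allb_def iter)
    also have "\<dots> \<longleftrightarrow> allb a"
      unfolding allb_def using that by (metis funpow_0 not0_implies_Suc)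
    finally show ?thesis .
  qed
  have "S \<subseteq> f ` B"
  proof
    fix a assume a: "a \<in> S"
    have "?g a \<in> B"
    proof (cases "allb a")
      case True
      then have "(?g ^^ Suc 0) a \<in> B" unfolding allb_def by blast
      then show ?thesis by simp
    next
      case False
      then have "0 < n a" using a by (simp add: S_def odd_pos)
      then have "\<not> (?g ^^ Suc 0) a \<notin> B" unfolding n_def by (rule not_less_Least)
      then show ?thesis by simp
    qed
    then show "a \<in> f ` B" using gf by (metis imageI)
  qed
  moreover have "a \<in> S \<longleftrightarrow> f a \<notin> S" if a: "a \<in> B" for a
  proof (cases "allb a")
    case True
    then have "(?g ^^ m) a \<in> B" for m
      using a unfolding allb_def by (cases m) simp_all
    then have ffa: "f (f a) = a" by (rule two)
    have "h a \<noteq> h (f a)"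
      using h fp[OF a] a assms(3) permutes_in_image[OF assms(2)] unfolding inj_on_def by (metis subsetD)
    then show ?thesis using True allb_f[OF a] ffa by (auto simp: S_def)
  next
    case False
    then obtain m where "(?g ^^ Suc m) a \<notin> B" by (auto simp: allb_def)
    then have m: "(?g ^^ Suc (Suc m)) (f a) \<notin> B" by (subst iter)
    have "\<not> (?g ^^ Suc 0) (f a) \<notin> B" using a by (simp add: gf)
    from Least_Suc[of "\<lambda>n. (?g ^^ Suc n) (f a) \<notin> B", OF m this]
    have "n (f a) = Suc (LEAST n. (?g ^^ Suc (Suc n)) (f a) \<notin> B)" by (simp only: n_def)
    then have "n (f a) = Suc (n a)" by (simp only: iter n_def)
    then show ?thesis using False allb_f[OF a] by (simp add: S_def)
  qed
  ultimately show ?thesis by blast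
qed

section \<open>An extremal choice of the last two permutations\<close>

context involution
begin

text \<open>Among all ways of splitting the edges into two permutations, take one with the fewest bad tails.
  On a cycle of \<open>st \<circ> inv \<theta>\<close> that consists of bad tails and is longer than 2, exchanging the two
  permutations shows that \<open>\<rho>\<close> runs alternately through the tails and heads of that cycle; reversing
  \<open>\<rho>\<close> there keeps the number of bad tails but destroys this property.\<close>

lemma exists_good_factors:
  assumes "two_factors V A \<theta>0 \<rho>0"
  shows "\<exists>\<theta> \<rho>. two_factors V A \<theta> \<rho> \<and>
    (\<forall>a. (\<forall>n. (inv (\<lambda>a. st (inv \<theta> a)) ^^ n) a \<in> bad_tails V st \<theta> \<rho>) \<longrightarrow>
      st (inv \<theta> (st (inv \<theta> a))) = a)"
proof -
  define P where "P = (\<lambda>p. two_factors V A (fst p) (snd p))"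
  have "P (\<theta>0, \<rho>0)" using assms by (simp add: P_def)
  from ex_has_least_nat[of P, OF this, of "\<lambda>p. card (bad_tails V st (fst p) (snd p))"]
  obtain \<theta> \<rho> where tf: "two_factors V A \<theta> \<rho>"
    and least: "\<And>\<theta>' \<rho>'. two_factors V A \<theta>' \<rho>' \<Longrightarrow>
      card (bad_tails V st \<theta> \<rho>) \<le> card (bad_tails V st \<theta>' \<rho>')"
    unfolding P_def by force
  define lam where "lam = (\<lambda>a. st (inv \<theta> a))"
  \<comment> \<open>The tails on the offending cycles of \<open>lam\<close>: all predecessors, hence
    by finiteness the whole cycle, are bad, and the cycle is longer than 2.\<close>
  define T where "T r = {a \<in> V. (\<forall>n. (inv lam ^^ n) a \<in> bad_tails V st \<theta> r) \<and> lam (lam a) \<noteq> a}" for r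
  note tfD = two_factorsD[OF tf]
  have lp: "lam permutes V" unfolding lam_def by (rule lam_perm[OF tfD(1)])
  have li: "inv lam (lam a) = a" "lam (inv lam a) = a" for a using lp by (simp_all add: permutes_inverses)
  have TB: "T r \<subseteq> bad_tails V st \<theta> r" for r
  proof
    fix a assume "a \<in> T r"
    then have "(inv lam ^^ 0) a \<in> bad_tails V st \<theta> r" unfolding T_def by blast
    then show "a \<in> bad_tails V st \<theta> r" by simp
  qed
  have Tinv: "inv lam a \<in> T r" if "a \<in> T r" for a r
  proof -
    have "(inv lam ^^ n) (inv lam a) \<in> bad_tails V st \<theta> r" for n
    proof -
      have "(inv lam ^^ Suc n) a \<in> bad_tails V st \<theta> r" using that unfolding T_def by blast
      then show ?thesis by (simp only: funpow_Suc_right o_apply)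
    qed
    moreover have "inv lam a \<in> V"
      using that permutes_in_image[OF permutes_inv[OF lp]] by (simp add: T_def)
    moreover have "lam (lam (inv lam a)) \<noteq> inv lam a"
    proof
      assume "lam (lam (inv lam a)) = inv lam a"
      then have "lam (lam (lam (inv lam a))) = lam (inv lam a)" by simp
      then have "lam (lam a) = a" by (simp only: li)
      then show False using that by (simp add: T_def)
    qed
    ultimately show ?thesis by (simp add: T_def)
  qed
  have Timg: "lam ` T r = T r" for r
  proof -
    have "finite (T r)" using finV by (simp add: T_def)
    moreover have "inv lam ` T r \<subseteq> T r" using Tinv by blast
    moreover have "inj_on (inv lam) (T r)" by (metis li(2) inj_onI)
    ultimately have "inv lam ` T r = T r" by (intro endo_inj_surj)
    then have "lam ` T r = lam ` (inv lam ` T r)" by simp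
    then show ?thesis by (simp add: image_image li)
  qed
  \<comment> \<open>Otherwise the exchange on \<open>T r\<close> would beat the minimum. The claim
    covers every \<open>r\<close> that attains the minimum together with \<open>\<theta>\<close>, so
    it applies again after the reversal.\<close>
  have alpha: "r (r (lam a)) = a"
    if "two_factors V A \<theta> r" "card (bad_tails V st \<theta> r) = card (bad_tails V st \<theta> \<rho>)" "a \<in> T r" for r a
  proof (rule ccontr)
    assume "r (r (lam a)) \<noteq> a"
    from flip_reduces_bad_tails[OF that(1) TB[of r] Timg[of r, unfolded lam_def] _ that(3)] this
    have "\<exists>\<theta>' \<rho>'. two_factors V A \<theta>' \<rho>' \<and> card (bad_tails V st \<theta>' \<rho>') < card (bad_tails V st \<theta> r)"
      unfolding lam_def T_def by blast
    then show False using least that(2) by (metis linorder_not_le)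
  qed
  show ?thesis
  proof (cases "T \<rho> = {}")
    case True
    have "bad_tails V st \<theta> \<rho> \<subseteq> V" by (auto simp: bad_tails_def)
    then have "lam (lam a) = a" if a: "\<And>n. (inv lam ^^ n) a \<in> bad_tails V st \<theta> \<rho>" for a
      using True a a[of 0] unfolding T_def by auto
    then show ?thesis using tf unfolding lam_def by blast
  next
    case False
    define \<rho>' where "\<rho>' = (\<lambda>x. if x \<in> T \<rho> \<union> \<rho> ` T \<rho> then inv \<rho> x else \<rho> x)"
    have alp: "\<rho> (\<rho> (lam a)) = a" if "a \<in> T \<rho>" for a using alpha[OF tf refl that] .
    note rev = reverse_bad_tails[OF tf TB Timg[of \<rho>, unfolded lam_def] alp[unfolded lam_def] \<rho>'_def]
    have tf': "two_factors V A \<theta> \<rho>'" and card': "card (bad_tails V st \<theta> \<rho>') = card (bad_tails V st \<theta> \<rho>)"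
      using rev(1,5) by simp_all
    have bt: "bad_tails V st \<theta> \<rho>' = (bad_tails V st \<theta> \<rho> - T \<rho>) \<union> \<rho> ` T \<rho>"
      and disj: "\<rho> ` T \<rho> \<inter> T \<rho> = {}" and R: "\<rho> ` (T \<rho> \<union> \<rho> ` T \<rho>) = T \<rho> \<union> \<rho> ` T \<rho>"
      using rev(2,3,4) by simp_all
    let ?R = "T \<rho> \<union> \<rho> ` T \<rho>"
    have ri: "\<rho> (inv \<rho> x) = x" "inv \<rho> (\<rho> x) = x" and ti: "\<theta> (inv \<theta> x) = x" "inv \<theta> (\<theta> x) = x" for x
      using tfD(1,2) by (simp_all add: permutes_inverses)
    have rR: "\<rho> x \<in> ?R \<longleftrightarrow> x \<in> ?R" for x
    proof
      assume "\<rho> x \<in> ?R"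
      then obtain y where "y \<in> ?R" "\<rho> x = \<rho> y" using R by blast
      then show "x \<in> ?R" by (metis ri(2))
    qed (use R in blast)
    have r'R: "\<rho>' x \<in> ?R \<longleftrightarrow> x \<in> ?R" for x
      using rR[of x] rR[of "inv \<rho> x"] by (simp add: \<rho>'_def ri del: Un_iff)
    \<comment> \<open>An offending cycle for \<open>\<rho>'\<close> that avoids the reversed tails
      would belong to \<open>T \<rho>\<close> already. Otherwise it contains some
      \<open>b = \<rho> a\<close> with \<open>a\<close> in \<open>T \<rho>\<close>, and
      \<open>alpha\<close> for both \<open>\<rho>\<close> and \<open>\<rho>'\<close> makes
      \<open>a\<close> and \<open>lam b\<close> a 2-cycle of \<open>\<theta>\<close>.\<close>
    have "T \<rho>' = {}"
    proof (rule equals0I)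
      fix t assume t: "t \<in> T \<rho>'"
      have tn: "(inv lam ^^ n) t \<in> T \<rho>'" for n by (induction n) (use t Tinv in auto)
      show False
      proof (cases "\<exists>n. (inv lam ^^ n) t \<in> \<rho> ` T \<rho>")
        case no: False
        have "(inv lam ^^ n) t \<in> bad_tails V st \<theta> \<rho> - T \<rho>" for n
          using tn[of n] no TB[of \<rho>'] bt by blast
        then have "t \<in> T \<rho>" "t \<notin> T \<rho>" using t unfolding T_def by (blast, metis (no_types, lifting) Diff_iff T_def funpow_0)
        then show False by blast
      next
        case True
        then obtain n a where a: "a \<in> T \<rho>" "(inv lam ^^ n) t = \<rho> a" by blast
        define b where "b = \<rho> a"
        have bT: "b \<in> T \<rho>'" using tn[of n] a b_def by simp
        have al: "\<rho>' (\<rho>' (lam b)) = b" using alpha[OF tf' card' bT] .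
        have "b \<in> ?R" using a(1) b_def by blast
        then have lR: "lam b \<in> ?R" using al r'R by metis
        have "lam b \<in> T \<rho>'" using bT Timg[of \<rho>'] by blast
        then have "lam b \<in> bad_tails V st \<theta> \<rho>'" using TB by blast
        then have "lam b \<in> \<rho> ` T \<rho>" using lR bt disj by blast
        then obtain a2 where a2: "a2 \<in> T \<rho>" "lam b = \<rho> a2" by blast
        have "\<rho>' (lam b) = a2" using lR a2(2) by (simp add: \<rho>'_def ri)
        then have "inv \<rho> a2 = b" using al a2(1) by (simp add: \<rho>'_def)
        then have a2': "a2 = \<rho> (\<rho> a)" unfolding b_def by (metis ri(1))
        obtain a0 where a0: "a0 \<in> T \<rho>" "a = lam a0" using a(1) Timg[of \<rho>] by blast
        have "a2 = a0" using a2' alp[OF a0(1)] a0(2) by simp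
        moreover have badE: "\<rho> x = \<theta> (lam x)" if "x \<in> T \<rho>" for x
          using that TB[of \<rho>] by (auto simp: bad_tails_def lam_def)
        ultimately have th_a: "\<theta> a = lam b" using a0 a2(2) by simp
        have "lam b = st (lam a)" using badE[OF a(1)] by (simp add: b_def lam_def ti)
        also have "\<dots> = inv \<theta> a" by (simp add: lam_def st_st)
        finally have th_b: "\<theta> (lam b) = a" by (simp add: ti)
        have "{a, \<theta> a} = {lam b, \<theta> (lam b)}" using th_a th_b by auto
        moreover have "a \<in> V" "lam b \<in> V" using a(1) \<open>lam b \<in> T \<rho>'\<close> by (simp_all add: T_def)
        ultimately have "a = lam b" using tfD(5) by blast
        then show False using a(1) \<open>lam b \<in> \<rho> ` T \<rho>\<close> disj by blast
      qed
    qed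
    moreover have "bad_tails V st \<theta> \<rho>' \<subseteq> V" by (auto simp: bad_tails_def)
    ultimately have "lam (lam a) = a" if a: "\<And>n. (inv lam ^^ n) a \<in> bad_tails V st \<theta> \<rho>'" for a
      using a a[of 0] unfolding T_def by auto
    then show ?thesis using tf' unfolding lam_def by blast
  qed
qed

text \<open>\<open>S\<close> is the set of vertices at which \<open>\<theta>\<close> and
  \<open>\<rho>\<close> will trade roles. A bad tail \<open>a\<close> is cured by an exchange at
  \<open>a\<close> or by one at \<open>lam a\<close>, but not by both, and exchanges take place only
  where a bad tail asks for one.\<close>

lemma exists_factors_alternating_set:
  assumes "two_factors V A \<theta>0 \<rho>0"
  shows "\<exists>\<theta> \<rho> S. two_factors V A \<theta> \<rho> \<and> S \<subseteq> (\<lambda>a. st (inv \<theta> a)) ` bad_tails V st \<theta> \<rho> \<and>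
    (\<forall>a\<in>bad_tails V st \<theta> \<rho>. a \<in> S \<longleftrightarrow> st (inv \<theta> a) \<notin> S)"
proof -
  obtain \<theta> \<rho> where tf: "two_factors V A \<theta> \<rho>" and good:
    "\<And>a. (\<And>n. (inv (\<lambda>a. st (inv \<theta> a)) ^^ n) a \<in> bad_tails V st \<theta> \<rho>) \<Longrightarrow>
      st (inv \<theta> (st (inv \<theta> a))) = a"
    using exists_good_factors[OF assms] by blast
  have "st (inv \<theta> a) \<noteq> a" if "a \<in> bad_tails V st \<theta> \<rho>" for a
  proof
    assume "st (inv \<theta> a) = a"
    then have "\<rho> a = \<theta> a" "a \<in> V" using that by (simp_all add: bad_tails_def)
    then show False using two_factorsD(7)[OF tf, of a a] by simp
  qed
  moreover have "bad_tails V st \<theta> \<rho> \<subseteq> V" by (auto simp: bad_tails_def)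
  ultimately have "\<exists>S. S \<subseteq> (\<lambda>a. st (inv \<theta> a)) ` bad_tails V st \<theta> \<rho> \<and>
    (\<forall>a\<in>bad_tails V st \<theta> \<rho>. a \<in> S \<longleftrightarrow> st (inv \<theta> a) \<notin> S)"
    using alternating_set[OF finV lam_perm[OF two_factorsD(1)[OF tf]]] good by blast
  then show ?thesis using tf by blast
qed

end

section \<open>Prolonging systems of paths\<close>

text \<open>\<open>m\<close> counts vertices. Each path is listed twice, as \<open>W x\<close>
  ending in \<open>x\<close> and read backwards as \<open>W (st x)\<close>; so every vertex of
  \<open>V\<close> is an end of exactly one path.\<close>

definition path_system ::
  "nat \<Rightarrow> 'a set \<Rightarrow> ('a \<Rightarrow> 'a list) \<Rightarrow> ('a \<Rightarrow> 'a) \<Rightarrow> 'a set set \<Rightarrow> bool" where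
  "path_system m V W st E0 \<longleftrightarrow> st permutes V \<and> (\<forall>x. st (st x) = x) \<and>
     (\<forall>x\<in>V. st x \<noteq> x \<and> distinct (W x) \<and> length (W x) = m \<and> last (W x) = x \<and> hd (W x) = st x \<and>
        W (st x) = rev (W x)) \<and>
     E0 = (\<Union>x\<in>V. path_edges (W x)) \<and>
     (\<forall>x\<in>V. \<forall>y\<in>V. path_edges (W x) \<inter> path_edges (W y) \<noteq> {} \<longrightarrow> y = x \<or> y = st x)"

lemma path_systemD:
  assumes "path_system m V W st E0"
  shows "st permutes V" "st (st x) = x" "st x \<in> V \<longleftrightarrow> x \<in> V"
    and "x \<in> V \<Longrightarrow> st x \<noteq> x" "x \<in> V \<Longrightarrow> distinct (W x)" "x \<in> V \<Longrightarrow> length (W x) = m"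
    and "x \<in> V \<Longrightarrow> last (W x) = x" "x \<in> V \<Longrightarrow> hd (W x) = st x" "x \<in> V \<Longrightarrow> W (st x) = rev (W x)"
    and "E0 = (\<Union>x\<in>V. path_edges (W x))"
    and "\<lbrakk>x \<in> V; y \<in> V; e \<in> path_edges (W x); e \<in> path_edges (W y)\<rbrakk> \<Longrightarrow> y = x \<or> y = st x"
proof -
  show "y = x \<or> y = st x" if "x \<in> V" "y \<in> V" "e \<in> path_edges (W x)" "e \<in> path_edges (W y)"
    using that assms unfolding path_system_def by blast
qed (use assms in \<open>auto simp: path_system_def permutes_in_image\<close>)

text \<open>With \<open>m + 2 \<le> g\<close> no position among the \<open>m\<close> vertices is
  left to which an edge \<open>{x, \<pi> x}\<close> could return, and injectivity of
  \<open>\<pi>\<close> separates the two new ends. The path that now ends in \<open>y\<close> grew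
  from \<open>W (inv \<pi> y)\<close>.\<close>

lemma path_system_extend:
  assumes ps: "path_system m V W st E0" and "2 \<le> m" "m + 2 \<le> g" "girth_at_least g E" "E0 \<subseteq> E"
    and "\<pi> permutes V" and ne: "\<And>x. x \<in> V \<Longrightarrow> \<pi> x \<noteq> x"
    and edge: "\<And>x. x \<in> V \<Longrightarrow> {x, \<pi> x} \<in> E - E0"
    and inj: "\<And>x y. \<lbrakk>x \<in> V; y \<in> V; {x, \<pi> x} = {y, \<pi> y}\<rbrakk> \<Longrightarrow> x = y"
  shows "path_system (m + 2) V (\<lambda>y. \<pi> (st (inv \<pi> y)) # W (inv \<pi> y) @ [y]) (\<lambda>y. \<pi> (st (inv \<pi> y)))
    (E0 \<union> (\<lambda>x. {x, \<pi> x}) ` V)"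
proof -
  note psD = path_systemD[OF ps]
  have pi: "\<pi> (inv \<pi> x) = x" "inv \<pi> (\<pi> x) = x" for x using assms(6) by (simp_all add: permutes_inverses)
  have piV: "\<pi> x \<in> V \<longleftrightarrow> x \<in> V" "inv \<pi> x \<in> V \<longleftrightarrow> x \<in> V" for x
    using assms(6) by (simp_all add: permutes_in_image permutes_inv)
  have W: "W x \<noteq> []" "path_edges (W x) \<subseteq> E0" "path_edges (W x) \<subseteq> E" if "x \<in> V" for x
    using psD(6)[OF that] psD(10) assms(2,5) that by auto
  have notin: "\<pi> x \<notin> set (W x)" if x: "x \<in> V" for x
  proof
    assume "\<pi> x \<in> set (W x)"
    then obtain i where i: "i < length (W x)" "W x ! i = \<pi> x" by (auto simp: in_set_conv_nth)
    have "i + g \<le> length (W x)"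
      using girth_last[OF assms(4) psD(5)[OF x] W(3)[OF x], of i] i psD(7)[OF x] edge[OF x] ne[OF x]
        W(2)[OF x] by auto
    then show False using psD(6)[OF x] assms(3) by simp
  qed
  have dist: "distinct (\<pi> (st x) # W x @ [\<pi> x])" if x: "x \<in> V" for x
  proof -
    have "\<pi> (st x) \<notin> set (W x)" using notin[of "st x"] psD(3,9) x by simp
    moreover have "\<pi> (st x) \<noteq> \<pi> x"
    proof
      assume "\<pi> (st x) = \<pi> x"
      then have "inv \<pi> (\<pi> (st x)) = inv \<pi> (\<pi> x)" by simp
      then show False using pi psD(4)[OF x] by simp
    qed
    ultimately show ?thesis using notin[OF x] psD(5)[OF x] by auto
  qed
  have edges: "path_edges (\<pi> (st x) # W x @ [\<pi> x]) =
      path_edges (W x) \<union> {{x, \<pi> x}, {st x, \<pi> (st x)}}" if "x \<in> V" for x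
    using W(1)[OF that] psD(7,8)[OF that]
    by (auto simp: path_edges_Cons path_edges_snoc insert_commute)
  let ?W = "\<lambda>y. \<pi> (st (inv \<pi> y)) # W (inv \<pi> y) @ [y]" and ?st = "\<lambda>y. \<pi> (st (inv \<pi> y))"
  show ?thesis
    unfolding path_system_def
  proof (intro conjI allI ballI impI)
    have "\<pi> \<circ> (st \<circ> inv \<pi>) permutes V"
      using assms(6) psD(1) permutes_inv by (intro permutes_compose)
    then show "?st permutes V" by (simp add: o_def)
    show "?st (?st y) = y" for y by (simp add: pi psD(2))
    show "E0 \<union> (\<lambda>x. {x, \<pi> x}) ` V = (\<Union>y\<in>V. path_edges (?W y))" (is "?L = ?R")
    proof (rule equalityI)
      show "?L \<subseteq> ?R"
      proof
        fix e assume "e \<in> ?L"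
        then consider x where "x \<in> V" "e \<in> path_edges (W x)" | x where "x \<in> V" "e = {x, \<pi> x}"
          using psD(10) by blast
        then obtain x where x: "x \<in> V" "e \<in> path_edges (\<pi> (st x) # W x @ [\<pi> x])"
          using edges by cases blast+
        then have "\<pi> x \<in> V" "e \<in> path_edges (?W (\<pi> x))" by (simp_all add: piV pi)
        then show "e \<in> ?R" by blast
      qed
      show "?R \<subseteq> ?L"
      proof
        fix e assume "e \<in> ?R"
        then obtain y where y: "y \<in> V" "e \<in> path_edges (?W y)" by blast
        then have x: "inv \<pi> y \<in> V" "st (inv \<pi> y) \<in> V" using piV psD(3) by simp_all
        have "e \<in> path_edges (W (inv \<pi> y)) \<union> {{inv \<pi> y, \<pi> (inv \<pi> y)}, {st (inv \<pi> y), \<pi> (st (inv \<pi> y))}}"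
          using y(2) edges[OF x(1)] by (simp add: pi)
        then show "e \<in> ?L" using x W(2)[OF x(1)] by blast
      qed
    qed
  next
    fix y assume y: "y \<in> V"
    then have x: "inv \<pi> y \<in> V" using piV by simp
    show "?st y \<noteq> y" using dist[OF x] pi by auto
    show "distinct (?W y)" using dist[OF x] pi by simp
    show "length (?W y) = m + 2" using psD(6)[OF x] by simp
    show "last (?W y) = y" by simp
    show "hd (?W y) = ?st y" by simp
    show "?W (?st y) = rev (?W y)" using x psD(2,9) pi by simp
  next
    fix y z assume yz: "y \<in> V" "z \<in> V" and "path_edges (?W y) \<inter> path_edges (?W z) \<noteq> {}"
    then obtain e where e: "e \<in> path_edges (?W y)" "e \<in> path_edges (?W z)" by blast
    define x u where "x = inv \<pi> y" and "u = inv \<pi> z"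
    have x: "x \<in> V" "y = \<pi> x" and u: "u \<in> V" "z = \<pi> u" using yz piV pi by (simp_all add: x_def u_def)
    have ex: "e \<in> path_edges (W x) \<union> {{x, \<pi> x}, {st x, \<pi> (st x)}}"
      and eu: "e \<in> path_edges (W u) \<union> {{u, \<pi> u}, {st u, \<pi> (st u)}}"
      using e edges[OF x(1)] edges[OF u(1)] by (simp_all add: x u pi)
    have "u = x \<or> u = st x"
    proof (cases "e \<in> E0")
      case True
      have "{w, \<pi> w} \<noteq> e" if "w \<in> V" for w using edge[OF that] True by blast
      then have "e \<in> path_edges (W x)" "e \<in> path_edges (W u)" using ex eu x u psD(3) by blast+
      then show ?thesis using psD(11) x u by blast
    next
      case False
      then have "e \<notin> path_edges (W x)" "e \<notin> path_edges (W u)" using W(2) x u by blast+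
      then obtain p q where "p = x \<or> p = st x" "e = {p, \<pi> p}" "q = u \<or> q = st u" "e = {q, \<pi> q}"
        using ex eu by blast
      moreover from this have "p = q" using inj[of p q] psD(3) x(1) u(1) by metis
      ultimately show ?thesis using psD(2) by metis
    qed
    then show "z = y \<or> z = ?st y" using x u pi by auto
  qed
qed

text \<open>The second prolongation starts from \<open>m + 2\<close> vertices, exactly the girth
  bound, so it can collide only with the far end. For a bad tail \<open>\<theta> x\<close> outside
  \<open>S\<close> the path is twisted: the edge between \<open>\<theta> x\<close> and
  \<open>\<theta> (st x)\<close> is used, the edge \<open>{st x, \<theta> (st x)}\<close> is
  dropped, and the path leaves \<open>st x\<close> along \<open>\<rho>\<close>. The dropped edge
  goes to the path with tail \<open>st x\<close>, which gives up its \<open>\<rho>\<close>-edge in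
  return.\<close>

lemma path_system_extend_two:
  assumes ps: "path_system m V W st E0" and "finite V" "2 \<le> m" "girth_at_least (m + 2) E" "E0 \<subseteq> E"
    and tf0: "two_factors V A \<theta>0 \<rho>0" and A: "A \<subseteq> E - E0"
  shows "\<exists>P \<tau>. path_system (m + 4) V P \<tau> (E0 \<union> A)"
proof -
  note psD = path_systemD[OF ps]
  interpret involution V st by unfold_locales (use assms(2) psD in auto)
  obtain \<theta> \<rho> S where tf: "two_factors V A \<theta> \<rho>"
    and S1: "S \<subseteq> (\<lambda>a. st (inv \<theta> a)) ` bad_tails V st \<theta> \<rho>"
    and S2: "\<And>a. a \<in> bad_tails V st \<theta> \<rho> \<Longrightarrow> a \<in> S \<longleftrightarrow> st (inv \<theta> a) \<notin> S"
    using exists_factors_alternating_set[OF tf0] by blast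
  note tfD = two_factorsD[OF tf]
  have ti: "\<theta> (inv \<theta> x) = x" "inv \<theta> (\<theta> x) = x" for x using tfD(1) by (simp_all add: permutes_inverses)
  have tV: "\<theta> x \<in> V \<longleftrightarrow> x \<in> V" "\<rho> x \<in> V \<longleftrightarrow> x \<in> V" "inv \<theta> x \<in> V \<longleftrightarrow> x \<in> V" for x
    using tfD(1,2) by (simp_all add: permutes_in_image permutes_inv)
  have tinj: "\<theta> x = \<theta> y \<longleftrightarrow> x = y" "\<rho> x = \<rho> y \<longleftrightarrow> x = y" for x y
    using tfD(1,2) by (auto dest: permutes_inj injD)
  define lam where "lam = (\<lambda>a. st (inv \<theta> a))"
  define opp where "opp = (\<lambda>a. \<theta> (st (inv \<theta> a)))"
  define Rot where "Rot a \<longleftrightarrow> a \<in> bad_tails V st \<theta> \<rho> \<and> a \<notin> S" for a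
  \<comment> \<open>\<open>e\<close> gives the outer edge at a tail and \<open>e'\<close> the inner
    edge at an end of \<open>W\<close>; on \<open>S\<close> the two permutations trade these
    roles.\<close>
  define e e' where "e = (\<lambda>x. if x \<in> S then \<theta> x else \<rho> x)" and "e' = (\<lambda>x. if x \<in> S then \<rho> x else \<theta> x)"
  have lam_th: "lam (\<theta> x) = st x" for x by (simp add: lam_def ti)
  have opp_th: "opp (\<theta> x) = \<theta> (st x)" for x by (simp add: opp_def ti)
  have badE: "\<rho> a = opp a" "a \<in> V" if "a \<in> bad_tails V st \<theta> \<rho>" for a
    using that by (simp_all add: bad_tails_def opp_def)
  have badI: "a \<in> bad_tails V st \<theta> \<rho>" if "\<rho> a = opp a" "a \<in> V" for a
    using that by (simp add: bad_tails_def opp_def)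
  have S_Rot: "Rot (\<theta> (st z))" "z \<in> V" if "z \<in> S" for z
  proof -
    from that S1 obtain a where a: "a \<in> bad_tails V st \<theta> \<rho>" "z = st (inv \<theta> a)" by blast
    then have "\<theta> (st z) = a" by (simp add: psD(2) ti)
    then show "Rot (\<theta> (st z))" using a S2[OF a(1)] that by (simp add: Rot_def)
    show "z \<in> V" using a badE(2) tV psD(3) by simp
  qed
  have Rot_S: "st x \<in> S" if "Rot (\<theta> x)" for x
    using that S2[of "\<theta> x"] by (auto simp: Rot_def ti)
  have not_both: "\<not> Rot (\<theta> (st x))" if "Rot (\<theta> x)" for x
  proof
    assume R: "Rot (\<theta> (st x))"
    have "\<rho> (\<theta> x) = \<theta> (st x)" "\<rho> (\<theta> (st x)) = \<theta> x"
      using that R badE(1) by (simp_all add: Rot_def opp_th psD(2))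
    then have "{\<theta> x, \<rho> (\<theta> x)} = {\<theta> (st x), \<rho> (\<theta> (st x))}" by auto
    moreover have "\<theta> x \<in> V" "\<theta> (st x) \<in> V" using that R badE(2) by (auto simp: Rot_def)
    ultimately have "\<theta> x = \<theta> (st x)" using tfD(6) by blast
    moreover have "x \<in> V" using \<open>\<theta> x \<in> V\<close> tV by simp
    ultimately show False using psD(4) tinj(1) by metis
  qed
  have thE: "{x, \<theta> x} \<in> A" and rhE: "{x, \<rho> x} \<in> A" if "x \<in> V" for x
    using tf that unfolding two_factors_def by blast+
  have eE: "{x, e x} \<in> A" "{x, e' x} \<in> A" "e x \<in> V" "e x \<noteq> x" if "x \<in> V" for x
    using thE rhE tV tfD(3,4) that by (auto simp: e_def e'_def)
  have A_eq: "A = (\<Union>x\<in>V. {{x, e x}, {x, e' x}})"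
  proof -
    have "{{x, e x}, {x, e' x}} = {{x, \<theta> x}, {x, \<rho> x}}" for x by (auto simp: e_def e'_def)
    then show ?thesis using tf unfolding two_factors_def by simp
  qed
  have einj: "x = y" if "x \<in> V" "y \<in> V" "{x, e x} = {y, e y}" for x y
    using that tfD(5-7)[of x y] tfD(7)[of y x] by (cases "x \<in> S"; cases "y \<in> S") (simp_all add: e_def)
  have e'inj: "x = y" if "x \<in> V" "y \<in> V" "{x, e' x} = {y, e' y}" for x y
    using that tfD(5-7)[of x y] tfD(7)[of y x] by (cases "x \<in> S"; cases "y \<in> S") (simp_all add: e'_def)
  have ecross: "{x, e x} \<noteq> {y, e' y}" if "x \<in> V" "y \<in> V" for x y
    using that tfD(5-7)[of x y] tfD(7)[of y x]
    by (cases "x \<in> S"; cases "y \<in> S") (auto simp: e_def e'_def)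
  have Wne: "W x \<noteq> []" "path_edges (W x) \<subseteq> E0" if "x \<in> V" for x
    using psD(6)[OF that] psD(10) assms(3) that by auto
  have ext: "path_system (m + 2) V (\<lambda>y. \<theta> (st (inv \<theta> y)) # W (inv \<theta> y) @ [y]) (\<lambda>y. \<theta> (st (inv \<theta> y)))
    (E0 \<union> (\<lambda>x. {x, \<theta> x}) ` V)"
    by (rule path_system_extend[OF ps assms(3) order_refl assms(4,5) tfD(1) tfD(3) subsetD[OF A thE] tfD(5)])
  have distB: "distinct (\<theta> (st x) # W x @ [\<theta> x])" if "x \<in> V" for x
    using path_systemD(5)[OF ext, of "\<theta> x"] that by (simp add: ti tV)
  have edgesB: "path_edges (\<theta> (st x) # W x @ [\<theta> x]) =
      path_edges (W x) \<union> {{x, \<theta> x}, {st x, \<theta> (st x)}}" if "x \<in> V" for x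
    using Wne(1)[OF that] psD(7,8)[OF that]
    by (auto simp: path_edges_Cons path_edges_snoc insert_commute)
  have e_notin: "e (\<theta> x) \<notin> set (\<theta> (st x) # W x @ [\<theta> x])" if x: "x \<in> V" and nR: "\<not> Rot (\<theta> x)" for x
  proof
    let ?B = "\<theta> (st x) # W x @ [\<theta> x]"
    assume "e (\<theta> x) \<in> set ?B"
    then obtain i where i: "i < length ?B" "?B ! i = e (\<theta> x)" by (metis in_set_conv_nth)
    have thx: "\<theta> x \<in> V" "st x \<in> V" using x tV psD(3) by simp_all
    have nin: "\<theta> x \<noteq> x" "\<theta> x \<noteq> st x"
    proof -
      have "x \<in> set (W x)" "st x \<in> set (W x)" using Wne(1)[OF x] psD(7,8)[OF x] by (metis last_in_set, metis hd_in_set)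
      then show "\<theta> x \<noteq> x" "\<theta> x \<noteq> st x" using distB[OF x] by auto
    qed
    have "{\<theta> x, e (\<theta> x)} \<notin> path_edges ?B"
    proof
      assume "{\<theta> x, e (\<theta> x)} \<in> path_edges ?B"
      then have "{\<theta> x, e (\<theta> x)} = {x, \<theta> x} \<or> {\<theta> x, e (\<theta> x)} = {st x, \<theta> (st x)}"
        using edgesB[OF x] Wne(2)[OF x] eE(1)[OF thx(1)] A by blast
      then show False
      proof
        assume "{\<theta> x, e (\<theta> x)} = {x, \<theta> x}"
        then show False using tfD(5)[of "\<theta> x" x] tfD(7)[of x "\<theta> x"] x thx nin by (auto simp: e_def split: if_splits)
      next
        assume "{\<theta> x, e (\<theta> x)} = {st x, \<theta> (st x)}"
        then show False using tfD(5)[of "\<theta> x" "st x"] tfD(7)[of "st x" "\<theta> x"] x thx nin by (auto simp: e_def split: if_splits)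
      qed
    qed
    moreover have "path_edges ?B \<subseteq> E" using edgesB[OF x] Wne(2)[OF x] assms(5) thE[OF x] thE[OF thx(2)] A by auto
    ultimately have "i + (m + 2) \<le> length ?B"
      using girth_last[OF assms(4) distB[OF x], of i] i eE(1,4)[OF thx(1)] A by auto
    then have "i = 0" using psD(6)[OF x] by simp
    then have eq: "e (\<theta> x) = \<theta> (st x)" using i by simp
    show False
    proof (cases "\<theta> x \<in> S")
      case True
      then have "\<theta> x = st x" using eq tinj by (simp add: e_def)
      then show False using nin by blast
    next
      case False
      then have "\<rho> (\<theta> x) = opp (\<theta> x)" using eq by (simp add: e_def opp_th)
      then show False using nR False badI thx by (simp add: Rot_def)
    qed
  qed
  text \<open>The two forms of the new paths: the regular one prolongs both ends of \<open>W x\<close> by two edges; in the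
    other one the bad edge from \<open>\<theta> x\<close> to \<open>\<theta> (st x)\<close> replaces the last edge at \<open>\<theta> (st x)\<close>.\<close>
  define Reg where "Reg = (\<lambda>x. e (\<theta> (st x)) # (\<theta> (st x) # W x @ [\<theta> x]) @ [e (\<theta> x)])"
  define Tw where "Tw = (\<lambda>x. e (\<theta> (st x)) # (\<theta> (st x) # \<theta> x # W (st x)) @ [\<rho> (st x)])"
  define arcs where "arcs x = {{\<theta> x, e (\<theta> x)}, {\<theta> (st x), e (\<theta> (st x))}, {x, e' x}, {st x, e' (st x)}}" for x
  have distReg: "distinct (Reg x)" if x: "x \<in> V" and nR: "\<not> Rot (\<theta> x)" "\<not> Rot (\<theta> (st x))" for x
  proof -
    have thx: "\<theta> x \<in> V" "st x \<in> V" "\<theta> (st x) \<in> V" using x tV psD(3) by simp_all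
    have n1: "e (\<theta> x) \<notin> set (\<theta> (st x) # W x @ [\<theta> x])" by (rule e_notin[OF x nR(1)])
    have n2: "e (\<theta> (st x)) \<notin> set (\<theta> (st x) # W x @ [\<theta> x])"
      using e_notin[OF thx(2) nR(2)] psD(2,9) x by auto
    have "e (\<theta> x) \<noteq> e (\<theta> (st x))"
    proof
      assume eq: "e (\<theta> x) = e (\<theta> (st x))"
      have ne: "x \<noteq> st x" using psD(4)[OF x] by simp
      \<comment> \<open>As \<open>\<theta> y\<close> is in \<open>S\<close>, some rotated tail is
        sent to \<open>\<theta> (\<theta> y)\<close> by \<open>\<rho>\<close>; injectivity
        identifies this tail with \<open>\<theta> z\<close>.\<close>
      have no: False if S: "\<theta> y \<in> S" "\<not> Rot (\<theta> z)" and eq: "\<theta> (\<theta> y) = \<rho> (\<theta> z)" for y z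
      proof -
        have R: "Rot (\<theta> (st (\<theta> y)))" using S_Rot(1) S(1) by blast
        then have "\<rho> (\<theta> (st (\<theta> y))) = \<theta> (\<theta> y)"
          using badE(1) by (simp add: Rot_def opp_th psD(2))
        then have "\<theta> (st (\<theta> y)) = \<theta> z" using eq tinj by simp
        then show False using R S by simp
      qed
      show False
      proof (cases "\<theta> x \<in> S"; cases "\<theta> (st x) \<in> S")
        show False if "\<theta> x \<in> S" "\<theta> (st x) \<notin> S" using that eq no[of x "st x"] nR by (simp add: e_def)
        show False if "\<theta> x \<notin> S" "\<theta> (st x) \<in> S" using that eq no[of "st x" x] nR by (simp add: e_def)
      qed (use eq ne tinj in \<open>auto simp: e_def\<close>)
    qed
    then show ?thesis using n1 n2 distB[OF x] by (auto simp: Reg_def)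
  qed
  have edgesReg: "path_edges (Reg x) = path_edges (W x) \<union> arcs x"
    if x: "x \<in> V" and nR: "\<not> Rot (\<theta> x)" "\<not> Rot (\<theta> (st x))" for x
  proof -
    have "x \<notin> S" "st x \<notin> S" using S_Rot(1)[of x] S_Rot(1)[of "st x"] nR psD(2) by auto
    moreover have "path_edges (Reg x) = insert {e (\<theta> (st x)), \<theta> (st x)}
        (insert {\<theta> x, e (\<theta> x)} (path_edges (\<theta> (st x) # W x @ [\<theta> x])))"
      unfolding Reg_def by (subst path_edges_Cons, simp, subst path_edges_snoc, simp, simp)
    ultimately show ?thesis using edgesB[OF x] by (auto simp: arcs_def e'_def insert_commute)
  qed
  have Tw: "distinct (Tw x) \<and> path_edges (Tw x) = path_edges (W x) \<union> arcs x"
    if x: "x \<in> V" and R: "Rot (\<theta> x)" for x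
  proof -
    have thx: "\<theta> x \<in> V" "st x \<in> V" "\<theta> (st x) \<in> V" using x tV psD(3) by simp_all
    have nR: "\<not> Rot (\<theta> (st x))" by (rule not_both[OF R])
    have rb: "\<rho> (\<theta> x) = \<theta> (st x)" and nS: "\<theta> x \<notin> S" using R badE(1) by (auto simp: Rot_def opp_th)
    have sS: "st x \<in> S" by (rule Rot_S[OF R])
    have xS: "x \<notin> S" using S_Rot(1)[of x] nR by blast
    let ?p = "\<theta> (st x) # \<theta> x # W (st x)"
    have Wst: "W (st x) = rev (W x)" "W (st x) \<noteq> []" "hd (W (st x)) = x" "last (W (st x)) = st x"
      using psD(8,7)[OF thx(2)] psD(2,9) Wne(1)[OF thx(2)] x by simp_all
    have dp: "distinct ?p" using distB[OF x] Wst(1) by auto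
    have setp: "set ?p = set (\<theta> (st x) # W x @ [\<theta> x])" using Wst(1) by auto
    have ep: "path_edges ?p = path_edges (W x) \<union> {{\<theta> x, \<rho> (\<theta> x)}, {x, \<theta> x}}"
      using Wst rb by (auto simp: path_edges_Cons insert_commute)
    have pE: "path_edges ?p \<subseteq> E" using ep Wne(2)[OF x] assms(5) thE[OF x] rhE[OF thx(1)] A by auto
    have "st x \<in> set (W x)" using Wne(1)[OF x] psD(8)[OF x] by (metis hd_in_set)
    then have nin: "\<theta> x \<noteq> st x" using distB[OF x] by auto
    have nr: "\<rho> (st x) \<notin> set ?p"
    proof
      assume "\<rho> (st x) \<in> set ?p"
      then obtain i where i: "i < length ?p" "?p ! i = \<rho> (st x)" by (metis in_set_conv_nth)
      have "{st x, \<rho> (st x)} \<notin> path_edges ?p"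
      proof
        assume "{st x, \<rho> (st x)} \<in> path_edges ?p"
        then have "{st x, \<rho> (st x)} = {\<theta> x, \<rho> (\<theta> x)} \<or> {st x, \<rho> (st x)} = {x, \<theta> x}"
          using ep Wne(2)[OF x] rhE[OF thx(2)] A by blast
        then show False using tfD(6)[of "st x" "\<theta> x"] tfD(7)[of x "st x"] x thx nin by auto
      qed
      then have "i + (m + 2) \<le> length ?p"
        using girth_last[OF assms(4) dp pE, of i] i rhE[OF thx(2)] A tfD(4)[OF thx(2)] Wst by auto
      then have "i = 0" using psD(6)[OF thx(2)] by simp
      then have "\<rho> (st x) = \<rho> (\<theta> x)" using i rb by simp
      then show False using tinj nin by simp
    qed
    have ne: "e (\<theta> (st x)) \<notin> set ?p"
      using e_notin[OF thx(2) nR] psD(2,9) x setp by auto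
    have "e (\<theta> (st x)) \<noteq> \<rho> (st x)"
    proof
      assume eq: "e (\<theta> (st x)) = \<rho> (st x)"
      show False
        by (rule girth_no_triangle[OF assms(4), of "\<theta> (st x)" "st x" "\<rho> (st x)"])
          (use thE[OF thx(2)] rhE[OF thx(2)] eE(1)[OF thx(3)] eq A tfD(3,4)[OF thx(2)] eE(4)[OF thx(3)] assms(3)
            in \<open>auto simp: insert_commute\<close>)
    qed
    then have d: "distinct (Tw x)" using dp nr ne by (auto simp: Tw_def)
    have "path_edges (Tw x) = insert {e (\<theta> (st x)), \<theta> (st x)}
        (insert {st x, \<rho> (st x)} (path_edges ?p))"
      unfolding Tw_def using Wst by (subst path_edges_Cons, simp, subst path_edges_snoc, simp, simp)
    moreover have "{e (\<theta> (st x)), \<theta> (st x)} = {\<theta> (st x), e (\<theta> (st x))}" by (rule insert_commute)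
    moreover have "e (\<theta> x) = \<rho> (\<theta> x)" "e' x = \<theta> x" "e' (st x) = \<rho> (st x)"
      using xS sS nS by (simp_all add: e_def e'_def)
    ultimately have "path_edges (Tw x) = path_edges (W x) \<union> arcs x"
      unfolding arcs_def ep by (simp only:) blast
    then show ?thesis using d by blast
  qed
  define Q where "Q = (\<lambda>x. if Rot (\<theta> x) then Tw x else if Rot (\<theta> (st x)) then rev (Tw (st x)) else Reg x)"
  define \<epsilon> where "\<epsilon> = (\<lambda>a. if Rot a then \<rho> (lam a) else e a)"
  have arcs_st: "arcs (st x) = arcs x" for x by (auto simp: arcs_def psD(2))
  have Q: "distinct (Q x) \<and> length (Q x) = m + 4 \<and> last (Q x) = \<epsilon> (\<theta> x) \<and> hd (Q x) = \<epsilon> (\<theta> (st x)) \<and>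
      Q (st x) = rev (Q x) \<and> path_edges (Q x) = path_edges (W x) \<union> arcs x" if x: "x \<in> V" for x
  proof -
    have sx: "st x \<in> V" using x psD(3) by simp
    have len: "length (W x) = m" "length (W (st x)) = m" "W (st x) = rev (W x)" using psD(6,9) x sx by simp_all
    consider "Rot (\<theta> x)" "\<not> Rot (\<theta> (st x))" | "\<not> Rot (\<theta> x)" "Rot (\<theta> (st x))" | "\<not> Rot (\<theta> x)" "\<not> Rot (\<theta> (st x))"
      using not_both by blast
    then show ?thesis
    proof cases
      case 1
      then show ?thesis using Tw[OF x] len psD(2) by (simp add: Q_def Tw_def \<epsilon>_def lam_th)
    next
      case 2
      then show ?thesis using Tw[OF sx] len psD(2) arcs_st[of x]
        by (simp add: Q_def \<epsilon>_def lam_th) (simp add: Tw_def last_rev hd_rev psD(2))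
    next
      case 3
      then have "Reg (st x) = rev (Reg x)" using len psD(2) by (simp add: Reg_def)
      then show ?thesis using 3 distReg[OF x] edgesReg[OF x] len psD(2) by (simp add: Q_def Reg_def \<epsilon>_def)
    qed
  qed
  \<comment> \<open>\<open>s\<close> swaps each rotated tail \<open>a\<close> with the vertex
    \<open>lam a\<close> of \<open>S\<close>. The ends reached from the tails satisfy
    \<open>\<epsilon> a = \<rho> (s a)\<close>, so \<open>\<epsilon>\<close> is a permutation and
    every vertex is again the end of one path.\<close>
  define s where "s = (\<lambda>a. if Rot a then lam a else if a \<in> S then \<theta> (st a) else a)"
  have lam_inv: "lam (\<theta> (st a)) = a" "\<theta> (st (lam a)) = a" for a by (simp_all add: lam_def ti psD(2))
  have RotS: "lam a \<in> S" if "Rot a" for a using that S2[of a] by (auto simp: Rot_def lam_def)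
  have RotnS: "\<not> Rot a" if "a \<in> S" for a using that by (simp add: Rot_def)
  have ss: "s (s a) = a" for a
  proof -
    consider "Rot a" | "a \<in> S" "\<not> Rot a" | "a \<notin> S" "\<not> Rot a" by blast
    then show ?thesis
    proof cases
      case 1
      then show ?thesis using RotS[OF 1] RotnS[OF RotS[OF 1]] by (simp add: s_def lam_inv)
    next
      case 2
      then show ?thesis using S_Rot(1)[OF 2(1)] by (simp add: s_def lam_inv)
    qed (simp add: s_def)
  qed
  have eps_s: "\<epsilon> a = \<rho> (s a)" for a
  proof -
    have "\<theta> a = \<rho> (\<theta> (st a))" if "a \<in> S"
      using S_Rot(1)[OF that] badE(1) by (simp add: Rot_def opp_th psD(2))
    then show ?thesis by (simp add: \<epsilon>_def s_def e_def)
  qed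
  have sV: "s a \<in> V" if "a \<in> V" for a
    using that tV psD(3) by (simp add: s_def lam_def)
  have eps_perm: "\<epsilon> permutes V"
  proof (rule permutesI_inj[OF finV])
    show "inj_on \<epsilon> V" by (rule inj_onI) (metis eps_s tinj(2) ss)
    show "\<epsilon> x \<in> V" if "x \<in> V" for x using that eps_s sV tV by simp
    show "\<epsilon> x = x" if "x \<notin> V" for x
      using that S_Rot(2) badE(2) tfD(2) by (auto simp: \<epsilon>_def Rot_def e_def permutes_not_in)
  qed
  define r where "r = (\<lambda>v. inv \<theta> (inv \<epsilon> v))"
  have ei: "\<epsilon> (inv \<epsilon> v) = v" "inv \<epsilon> (\<epsilon> v) = v" for v using eps_perm by (simp_all add: permutes_inverses)
  have r: "\<epsilon> (\<theta> (r v)) = v" "r (\<epsilon> (\<theta> x)) = x" for v x by (simp_all add: r_def ti ei)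
  have rV: "r v \<in> V \<longleftrightarrow> v \<in> V" for v
    using eps_perm tV by (simp add: r_def permutes_in_image permutes_inv)
  have V_iff: "v \<in> V \<longleftrightarrow> (\<exists>x\<in>V. v = \<epsilon> (\<theta> x))" for v
    using r rV by metis
  let ?P = "\<lambda>v. Q (r v)" and ?\<tau> = "\<lambda>v. \<epsilon> (\<theta> (st (r v)))"
  have "path_system (m + 4) V ?P ?\<tau> (E0 \<union> A)"
    unfolding path_system_def
  proof (intro conjI allI ballI impI)
    show "?\<tau> (?\<tau> v) = v" for v by (simp add: r psD(2))
    show "?\<tau> permutes V"
    proof (rule permutesI_inj[OF finV])
      show "inj_on ?\<tau> V" by (rule inj_onI) (metis r psD(2))
      show "?\<tau> v \<in> V" if "v \<in> V" for v using that rV psD(3) V_iff by metis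
      show "?\<tau> v = v" if "v \<notin> V" for v
        using that rV psD(1) r by (metis permutes_not_in)
    qed
    show "E0 \<union> A = (\<Union>v\<in>V. path_edges (?P v))"
    proof -
      have "r ` V = V"
      proof (rule equalityI)
        show "V \<subseteq> r ` V" using r(2) V_iff by (metis imageI subsetI)
      qed (use rV in blast)
      then have "(\<Union>v\<in>V. path_edges (?P v)) = (\<Union>x\<in>V. path_edges (Q x))" by (metis image_image)
      also have "\<dots> = (\<Union>x\<in>V. path_edges (W x)) \<union> (\<Union>x\<in>V. arcs x)" using Q by auto
      also have "(\<Union>x\<in>V. arcs x) = A"
      proof (rule equalityI)
        show "(\<Union>x\<in>V. arcs x) \<subseteq> A" using eE tV psD(3) by (auto simp: arcs_def)
        show "A \<subseteq> (\<Union>x\<in>V. arcs x)"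
        proof
          fix a assume "a \<in> A"
          then obtain x where x: "x \<in> V" "a = {x, e x} \<or> a = {x, e' x}" using A_eq by blast
          have "inv \<theta> x \<in> V" using x tV by simp
          have m: "{\<theta> y, e (\<theta> y)} \<in> arcs y" "{y, e' y} \<in> arcs y" for y
            unfolding arcs_def by (rule insertI1, intro insertI2 insertI1)
          have "a \<in> arcs x \<union> arcs (inv \<theta> x)"
            using x(2) m(1)[of "inv \<theta> x", unfolded ti] m(2)[of x] by (metis UnI1 UnI2)
          then show "a \<in> (\<Union>x\<in>V. arcs x)" using x(1) \<open>inv \<theta> x \<in> V\<close> by (metis UN_I UnE)
        qed
      qed
      finally show ?thesis using psD(10) by simp
    qed
  next
    fix v assume v: "v \<in> V"
    then have x: "r v \<in> V" using rV by simp
    note Qv = Q[OF x]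
    show "?\<tau> v \<noteq> v"
    proof
      assume "?\<tau> v = v"
      then have "r (?\<tau> v) = r v" by simp
      then show False using r psD(4)[OF x] by simp
    qed
    show "distinct (?P v)" "length (?P v) = m + 4" "last (?P v) = v" "hd (?P v) = ?\<tau> v" "?P (?\<tau> v) = rev (?P v)"
      using Qv r by simp_all
  next
    fix v w assume vw: "v \<in> V" "w \<in> V" and "path_edges (?P v) \<inter> path_edges (?P w) \<noteq> {}"
    define x y where "x = r v" and "y = r w"
    have xy: "x \<in> V" "y \<in> V" "st x \<in> V" "st y \<in> V" using vw rV psD(3) by (simp_all add: x_def y_def)
    have thxy: "\<theta> x \<in> V" "\<theta> (st x) \<in> V" "\<theta> y \<in> V" "\<theta> (st y) \<in> V" using xy tV by simp_all
    obtain c where c: "c \<in> path_edges (W x) \<union> arcs x" "c \<in> path_edges (W y) \<union> arcs y"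
      using \<open>_ \<noteq> {}\<close> Q[OF xy(1)] Q[OF xy(2)] by (auto simp: x_def y_def)
    have aA: "arcs x \<subseteq> A" "arcs y \<subseteq> A" using eE xy thxy by (auto simp: arcs_def)
    have "y = x \<or> y = st x"
    proof (cases "c \<in> E0")
      case True
      then have "c \<in> path_edges (W x)" "c \<in> path_edges (W y)" using c aA A by blast+
      then show ?thesis using psD(11) xy by blast
    next
      case False
      then have c': "c \<in> arcs x" "c \<in> arcs y" using c Wne(2) xy by blast+
      have 1: "p = q" if "{p, e p} = c" "{q, e q} = c" "p \<in> V" "q \<in> V" for p q using einj that by metis
      have 2: "p = q" if "{p, e' p} = c" "{q, e' q} = c" "p \<in> V" "q \<in> V" for p q using e'inj that by metis
      have 3: False if "{p, e p} = c" "{q, e' q} = c" "p \<in> V" "q \<in> V" for p q using ecross that by metis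
      show ?thesis
      proof (cases "\<exists>p\<in>{\<theta> x, \<theta> (st x)}. c = {p, e p}")
        case True
        then obtain p where p: "p \<in> {\<theta> x, \<theta> (st x)}" "c = {p, e p}" by blast
        have "p \<in> V" using p thxy by auto
        then have "\<exists>q\<in>{\<theta> y, \<theta> (st y)}. c = {q, e q}"
          using c'(2) 3[of p] p xy unfolding arcs_def by blast
        then obtain q where q: "q \<in> {\<theta> y, \<theta> (st y)}" "c = {q, e q}" by blast
        have "p = q" using 1[of p q] p q thxy by auto
        then have "(x = y \<or> x = st y) \<or> (st x = y \<or> st x = st y)" using p q tinj by auto
        then show ?thesis using psD(2) by metis
      next
        case False
        then obtain p where p: "p \<in> {x, st x}" "c = {p, e' p}" using c'(1) by (auto simp: arcs_def)
        have "p \<in> V" using p xy by auto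
        then have "\<exists>q\<in>{y, st y}. c = {q, e' q}"
          using c'(2) 3[of _ p] p thxy unfolding arcs_def by blast
        then obtain q where q: "q \<in> {y, st y}" "c = {q, e' q}" by blast
        have "p = q" using 2[of p q] p q xy by auto
        then show ?thesis using p q psD(2) by (metis insertE singletonD)
      qed
    qed
    then show "w = v \<or> w = ?\<tau> v" using r x_def y_def by metis
  qed
  then show ?thesis by blast
qed

section \<open>From two disjoint perfect matchings to paths with \<open>2*k\<close> vertices\<close>

lemma perfect_matching_partner:
  assumes sg: "simple_graph V E" and pm: "perfect_matching V E M"
  shows "\<exists>\<mu>. \<mu> permutes V \<and> (\<forall>x. \<mu> (\<mu> x) = x) \<and> (\<forall>x\<in>V. \<mu> x \<noteq> x) \<and> M = (\<lambda>x. {x, \<mu> x}) ` V"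
proof -
  have ME: "M \<subseteq> E" and uniq: "\<And>v e f. \<lbrakk>v \<in> V; e \<in> M; f \<in> M; v \<in> e; v \<in> f\<rbrakk> \<Longrightarrow> e = f"
    and ex: "\<And>v. v \<in> V \<Longrightarrow> \<exists>e. e \<in> M \<and> v \<in> e"
    using pm unfolding perfect_matching_def by blast+
  have form: "\<exists>u w. e = {u, w} \<and> u \<noteq> w \<and> u \<in> V \<and> w \<in> V" if "e \<in> M" for e
    using sg ME that unfolding simple_graph_def by blast
  have "\<exists>w. {v, w} \<in> M \<and> w \<noteq> v \<and> w \<in> V" if v: "v \<in> V" for v
  proof -
    obtain e where e: "e \<in> M" "v \<in> e" using ex[OF v] by blast
    obtain a b where ab: "e = {a, b}" "a \<noteq> b" "a \<in> V" "b \<in> V" using form[OF e(1)] by blast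
    show ?thesis
    proof (cases "v = a")
      case True
      then show ?thesis using e ab by blast
    next
      case False
      then have "v = b" using e ab by simp
      then have "{v, a} \<in> M" using e ab by (simp add: insert_commute)
      then show ?thesis using ab \<open>v = b\<close> by blast
    qed
  qed
  then obtain f where f: "\<And>v. v \<in> V \<Longrightarrow> {v, f v} \<in> M \<and> f v \<noteq> v \<and> f v \<in> V" by metis
  define \<mu> where "\<mu> = (\<lambda>v. if v \<in> V then f v else v)"
  have \<mu>: "{v, \<mu> v} \<in> M" "\<mu> v \<noteq> v" "\<mu> v \<in> V" if "v \<in> V" for v using f[OF that] that by (simp_all add: \<mu>_def)
  have inv: "\<mu> (\<mu> v) = v" for v
  proof (cases "v \<in> V")
    case True
    have "{v, \<mu> v} = {\<mu> v, \<mu> (\<mu> v)}"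
      by (rule uniq[of "\<mu> v"]) (use \<mu> True in auto)
    then show ?thesis using \<mu>(2)[OF True] by (auto simp: doubleton_eq_iff)
  qed (simp add: \<mu>_def)
  have "\<mu> permutes V"
  proof (rule permutesI_inj)
    show "finite V" using sg by (simp add: simple_graph_def)
    show "inj_on \<mu> V" by (rule inj_onI) (metis inv)
  qed (simp_all add: \<mu>(3), simp add: \<mu>_def)
  moreover have "M = (\<lambda>x. {x, \<mu> x}) ` V"
  proof (rule equalityI)
    show "M \<subseteq> (\<lambda>x. {x, \<mu> x}) ` V"
    proof
      fix e assume e: "e \<in> M"
      then obtain u where u: "u \<in> e" "u \<in> V" using form by blast
      then have "e = {u, \<mu> u}" using uniq[OF u(2) e \<mu>(1)[OF u(2)]] by blast
      then show "e \<in> (\<lambda>x. {x, \<mu> x}) ` V" using u by blast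
    qed
  qed (use \<mu> in blast)
  ultimately show ?thesis using inv \<mu>(2) by blast
qed

lemma asym_doubleton:
  assumes "asym D" "(x, y) \<in> D" "(u, v) \<in> D" "{x, y} = {u, v}"
  shows "x = u" "y = v"
  using assms by (auto simp: doubleton_eq_iff dest: asymD)

lemma diregular_one_edges:
  assumes "diregular 1 V D" "\<rho> permutes V" "\<And>v. v \<in> V \<Longrightarrow> (v, \<rho> v) \<in> D"
  shows "D = (\<lambda>v. (v, \<rho> v)) ` V"
proof (rule equalityI)
  show "D \<subseteq> (\<lambda>v. (v, \<rho> v)) ` V"
  proof
    fix p assume p: "p \<in> D"
    obtain x y where xy: "p = (x, y)" by (cases p)
    then have x: "x \<in> V" using assms(1) p by (auto simp: diregular_def)
    then have "card {y. (x, y) \<in> D} = 1" using assms(1) by (simp add: diregular_def)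
    then have "y = \<rho> x" using assms(3)[OF x] p xy by (metis (no_types, lifting) card_1_singletonE mem_Collect_eq singletonD)
    then show "p \<in> (\<lambda>v. (v, \<rho> v)) ` V" using xy x by blast
  qed
qed (use assms(3) in blast)

text \<open>An edge of \<open>M2\<close> has 2 vertices and each permutation adds 2. After
  \<open>k - 3\<close> plain rounds the paths have \<open>2*k - 4\<close> vertices, and girth
  \<open>2*k - 2\<close> is exactly what the two-step prolongation then requires.\<close>

lemma exists_path_system:
  assumes k: "3 \<le> k" and sg: "simple_graph V E" and reg: "regular (2 * k) V E"
    and girth: "girth_at_least (2 * k - 2) E"
    and M1: "perfect_matching V E M1" and M2: "perfect_matching V E M2" and disj: "M1 \<inter> M2 = {}"
  shows "\<exists>P \<tau>. path_system (2 * k) V P \<tau> (E - M1)"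
proof -
  have finV: "finite V" using sg by (simp add: simple_graph_def)
  define F where "F = E - M1 - M2"
  have sgF: "simple_graph V F" using sg by (simp add: simple_graph_def F_def)
  have ME: "M1 \<subseteq> E" "M2 \<subseteq> E" using M1 M2 by (simp_all add: perfect_matching_def)
  have "e \<subseteq> V" if "e \<in> E" for e
    using sg that unfolding simple_graph_def by (metis empty_subsetI insert_subset)
  then have "E \<subseteq> Pow V" by auto
  then have finE: "finite E" using finV by (meson finite_Pow_iff finite_subset)
  have "degree F v = 2 * (k - 1)" if v: "v \<in> V" for v
  proof -
    obtain e1 where e1: "\<And>e. e \<in> M1 \<and> v \<in> e \<longleftrightarrow> e = e1" using M1 v unfolding perfect_matching_def by metis
    obtain e2 where e2: "\<And>e. e \<in> M2 \<and> v \<in> e \<longleftrightarrow> e = e2" using M2 v unfolding perfect_matching_def by metis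
    have "e1 \<in> M1" "e2 \<in> M2" "v \<in> e1" "v \<in> e2" using e1 e2 by blast+
    then have sub: "{e1, e2} \<subseteq> {e \<in> E. v \<in> e}" "e1 \<noteq> e2" using ME disj by auto
    have "e \<in> F \<and> v \<in> e \<longleftrightarrow> e \<in> E \<and> v \<in> e \<and> e \<noteq> e1 \<and> e \<noteq> e2" for e
      using e1[of e] e2[of e] by (auto simp: F_def)
    then have "{e \<in> F. v \<in> e} = {e \<in> E. v \<in> e} - {e1, e2}" by auto
    then have "degree F v = card {e \<in> E. v \<in> e} - card {e1, e2}"
      unfolding degree_def using card_Diff_subset[OF _ sub(1)] by simp
    also have "\<dots> = 2 * k - 2" using reg v sub(2) by (simp add: regular_def degree_def)
    finally show ?thesis using k by simp
  qed
  then have "regular (2 * (k - 1)) V F" by (simp add: regular_def)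
  from eulerian_orientation[OF sgF this] obtain D0 where
    D0: "diregular (k - 1) V D0" "(\<lambda>(x, y). {x, y}) ` D0 = F" "asym D0" by blast
  obtain \<mu> where \<mu>: "\<mu> permutes V" "\<And>x. \<mu> (\<mu> x) = x" "\<And>x. x \<in> V \<Longrightarrow> \<mu> x \<noteq> x" "M2 = (\<lambda>x. {x, \<mu> x}) ` V"
    using perfect_matching_partner[OF sg M2] by blast
  let ?ed = "\<lambda>D. (\<lambda>(x, y). {x, y}) ` D"
  have edge_ne: "\<pi> x \<noteq> x" if "(x, \<pi> x) \<in> D0" for \<pi> x
    using asymD[OF D0(3) that] that by auto
  have peel: "(\<lambda>x. {x, \<pi> x}) ` V \<union> ?ed (D - (\<lambda>v. (v, \<pi> v)) ` V) = ?ed D"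
    "(\<lambda>x. {x, \<pi> x}) ` V \<inter> ?ed (D - (\<lambda>v. (v, \<pi> v)) ` V) = {}"
    if D: "D \<subseteq> D0" and mem: "\<And>v. v \<in> V \<Longrightarrow> (v, \<pi> v) \<in> D" for D and \<pi> :: "'a \<Rightarrow> 'a"
  proof -
    have 1: "(\<lambda>x. {x, \<pi> x}) ` V = ?ed ((\<lambda>v. (v, \<pi> v)) ` V)" by (simp add: image_image)
    have 2: "(\<lambda>v. (v, \<pi> v)) ` V \<subseteq> D" using mem by blast
    show "(\<lambda>x. {x, \<pi> x}) ` V \<union> ?ed (D - (\<lambda>v. (v, \<pi> v)) ` V) = ?ed D"
    proof -
      have "(\<lambda>v. (v, \<pi> v)) ` V \<union> (D - (\<lambda>v. (v, \<pi> v)) ` V) = D" using 2 by blast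
      then show ?thesis unfolding 1 by (simp only: image_Un[symmetric])
    qed
    show "(\<lambda>x. {x, \<pi> x}) ` V \<inter> ?ed (D - (\<lambda>v. (v, \<pi> v)) ` V) = {}"
    proof (rule equals0I)
      fix e assume "e \<in> (\<lambda>x. {x, \<pi> x}) ` V \<inter> ?ed (D - (\<lambda>v. (v, \<pi> v)) ` V)"
      then have e: "e \<in> (\<lambda>x. {x, \<pi> x}) ` V" "e \<in> ?ed (D - (\<lambda>v. (v, \<pi> v)) ` V)" by simp_all
      from e(1) obtain x where x: "x \<in> V" "e = {x, \<pi> x}" by (rule imageE)
      from e(2) obtain p where p: "e = (\<lambda>(x, y). {x, y}) p" "p \<in> D - (\<lambda>v. (v, \<pi> v)) ` V" by (rule imageE)
      obtain u w where "p = (u, w)" by (cases p)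
      then have uw: "(u, w) \<in> D" "(u, w) \<notin> (\<lambda>v. (v, \<pi> v)) ` V" "e = {u, w}" using p by simp_all
      have "(x, \<pi> x) \<in> D0" "(u, w) \<in> D0" using mem[OF x(1)] uw(1) D by (simp_all only: subsetD)
      then have "x = u" "\<pi> x = w" using asym_doubleton[OF D0(3)] uw(3) x(2) by metis+
      then show False using uw(2) x(1) by blast
    qed
  qed
  have "\<exists>W st E0 D. path_system (2 + 2 * j) V W st E0 \<and> diregular (k - 1 - j) V D \<and> D \<subseteq> D0 \<and>
      E0 \<union> ?ed D = E - M1 \<and> E0 \<inter> ?ed D = {}" if "j \<le> k - 3" for j
    using that
  proof (induction j)
    case 0
    have "path_system 2 V (\<lambda>x. [\<mu> x, x]) \<mu> M2"
      unfolding path_system_def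
    proof (intro conjI ballI allI impI)
      show "M2 = (\<Union>x\<in>V. path_edges [\<mu> x, x])" using \<mu>(4) by (auto simp: insert_commute)
      fix x y assume "x \<in> V" "y \<in> V" "path_edges [\<mu> x, x] \<inter> path_edges [\<mu> y, y] \<noteq> {}"
      then have "{\<mu> x, x} = {\<mu> y, y}" by auto
      then show "y = x \<or> y = \<mu> x" by (auto simp: doubleton_eq_iff)
    qed (use \<mu> in auto)
    moreover have "M2 \<union> ?ed D0 = E - M1" "M2 \<inter> ?ed D0 = {}" using D0(2) ME disj by (auto simp: F_def)
    ultimately show ?case using D0(1) by (intro exI[of _ "\<lambda>x. [\<mu> x, x]"] exI[of _ \<mu>] exI[of _ M2] exI[of _ D0]) simp
  next
    case (Suc j)
    then obtain W st E0 D where IH: "path_system (2 + 2 * j) V W st E0" "diregular (k - 1 - j) V D" "D \<subseteq> D0"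
      "E0 \<union> ?ed D = E - M1" "E0 \<inter> ?ed D = {}" by auto
    have "0 < k - 1 - j" using Suc.prems k by simp
    from diregular_permutation[OF finV IH(2) this] obtain \<pi> where
      \<pi>: "\<pi> permutes V" "\<And>v. v \<in> V \<Longrightarrow> (v, \<pi> v) \<in> D" "diregular (k - 1 - j - 1) V (D - (\<lambda>v. (v, \<pi> v)) ` V)"
      by blast
    let ?D = "D - (\<lambda>v. (v, \<pi> v)) ` V"
    note pl = peel[OF IH(3) \<pi>(2)]
    have "path_system (2 + 2 * j + 2) V (\<lambda>y. \<pi> (st (inv \<pi> y)) # W (inv \<pi> y) @ [y])
      (\<lambda>y. \<pi> (st (inv \<pi> y))) (E0 \<union> (\<lambda>x. {x, \<pi> x}) ` V)"
    proof (rule path_system_extend[OF IH(1) _ _ girth _ \<pi>(1)])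
      show "2 + 2 * j + 2 \<le> 2 * k - 2" using Suc.prems k by simp
      show "E0 \<subseteq> E" using IH(4) by blast
      show "\<pi> x \<noteq> x" if "x \<in> V" for x using edge_ne[of x \<pi>] \<pi>(2)[OF that] IH(3) by blast
      show "{x, \<pi> x} \<in> E - E0" if "x \<in> V" for x
      proof -
        have "{x, \<pi> x} \<in> ?ed D" by (rule image_eqI[OF _ \<pi>(2)[OF that]]) simp
        moreover from this have "{x, \<pi> x} \<notin> E0" using IH(5) by (simp only: disjoint_iff) metis
        ultimately have "{x, \<pi> x} \<in> E0 \<union> ?ed D" "{x, \<pi> x} \<notin> E0" by (simp_all only: Un_iff simp_thms)
        then show ?thesis unfolding IH(4) by simp
      qed
      show "x = y" if "x \<in> V" "y \<in> V" "{x, \<pi> x} = {y, \<pi> y}" for x y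
        using asym_doubleton(1)[OF D0(3) subsetD[OF IH(3) \<pi>(2)] subsetD[OF IH(3) \<pi>(2)] that(3)] that(1,2) .
    qed simp
    moreover have "E0 \<union> (\<lambda>x. {x, \<pi> x}) ` V \<union> ?ed ?D = E - M1" using pl(1) IH(4) by (simp add: Un_assoc)
    moreover have "(E0 \<union> (\<lambda>x. {x, \<pi> x}) ` V) \<inter> ?ed ?D = {}"
    proof -
      have "?ed ?D \<subseteq> ?ed D" by (rule image_mono) (rule Diff_subset)
      then have "E0 \<inter> ?ed ?D \<subseteq> E0 \<inter> ?ed D" by (rule Int_mono[OF order_refl])
      then have "E0 \<inter> ?ed ?D = {}" unfolding IH(5) by (rule subset_empty[THEN iffD1])
      then show ?thesis using pl(2) by (simp only: Int_Un_distrib2 Un_empty_left)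
    qed
    moreover have "?D \<subseteq> D0" using IH(3) by blast
    moreover have "2 + 2 * j + 2 = 2 + 2 * Suc j" "k - 1 - j - 1 = k - 1 - Suc j" by simp_all
    moreover have "diregular (k - 1 - Suc j) V ?D" using \<pi>(3) calculation by simp
    ultimately show ?case
      by (intro exI[of _ "\<lambda>y. \<pi> (st (inv \<pi> y)) # W (inv \<pi> y) @ [y]"] exI[of _ "\<lambda>y. \<pi> (st (inv \<pi> y))"]
          exI[of _ "E0 \<union> (\<lambda>x. {x, \<pi> x}) ` V"] exI[of _ ?D] conjI) (simp_all only:)
  qed
  from this[of "k - 3"] obtain W st E0 D where IH: "path_system (2 + 2 * (k - 3)) V W st E0"
    "diregular (k - 1 - (k - 3)) V D" "D \<subseteq> D0" "E0 \<union> ?ed D = E - M1" "E0 \<inter> ?ed D = {}" by auto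
  have ar: "k - 1 - (k - 3) = 2" "2 + 2 * (k - 3) + 2 = 2 * k - 2" "2 + 2 * (k - 3) + 4 = 2 * k" using k by simp_all
  have IH2: "diregular 2 V D" using IH(2) unfolding ar .
  from diregular_permutation[OF finV IH2] obtain \<theta> where
    \<theta>: "\<theta> permutes V" "\<And>v. v \<in> V \<Longrightarrow> (v, \<theta> v) \<in> D" "diregular 1 V (D - (\<lambda>v. (v, \<theta> v)) ` V)"
    by auto
  let ?D = "D - (\<lambda>v. (v, \<theta> v)) ` V"
  from diregular_permutation[OF finV \<theta>(3)] obtain \<rho> where
    \<rho>: "\<rho> permutes V" "\<And>v. v \<in> V \<Longrightarrow> (v, \<rho> v) \<in> ?D" by auto
  have D_eq: "?D = (\<lambda>v. (v, \<rho> v)) ` V" by (rule diregular_one_edges[OF \<theta>(3) \<rho>])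
  note pl = peel[OF IH(3) \<theta>(2)]
  have edD: "?ed ?D = (\<lambda>x. {x, \<rho> x}) ` V" unfolding D_eq by (simp add: image_image)
  have "two_factors V (?ed D) \<theta> \<rho>"
    unfolding two_factors_def
  proof (intro conjI \<theta>(1) \<rho>(1) ballI impI)
    have "?ed D = (\<lambda>x. {x, \<theta> x}) ` V \<union> (\<lambda>x. {x, \<rho> x}) ` V" using pl(1) unfolding edD by simp
    also have "\<dots> = (\<Union>x\<in>V. {{x, \<theta> x}, {x, \<rho> x}})" by (rule set_eqI) (simp only: Un_iff image_iff UN_iff insert_iff empty_iff, metis)
    finally show "?ed D = (\<Union>x\<in>V. {{x, \<theta> x}, {x, \<rho> x}})" .
    show "\<theta> x \<noteq> x" if "x \<in> V" for x using edge_ne[of x \<theta>] \<theta>(2)[OF that] IH(3) by blast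
    show "\<rho> x \<noteq> x" if "x \<in> V" for x using edge_ne[of x \<rho>] \<rho>(2)[OF that] IH(3) by blast
    fix x y assume xy: "x \<in> V" "y \<in> V"
    show "x = y" if "{x, \<theta> x} = {y, \<theta> y}"
      using asym_doubleton(1)[OF D0(3) subsetD[OF IH(3) \<theta>(2)] subsetD[OF IH(3) \<theta>(2)] that] xy .
    show "x = y" if "{x, \<rho> x} = {y, \<rho> y}"
      using asym_doubleton(1)[OF D0(3) subsetD[OF IH(3) DiffD1[OF \<rho>(2)]] subsetD[OF IH(3) DiffD1[OF \<rho>(2)]] that] xy .
    show "{x, \<theta> x} \<noteq> {y, \<rho> y}"
    proof
      assume "{x, \<theta> x} = {y, \<rho> y}"
      then have "{y, \<rho> y} \<in> (\<lambda>x. {x, \<theta> x}) ` V" using imageI[OF xy(1), of "\<lambda>x. {x, \<theta> x}"] by simp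
      moreover have "{y, \<rho> y} \<in> (\<lambda>x. {x, \<rho> x}) ` V" using xy(2) by (rule imageI)
      ultimately show False using pl(2) unfolding edD by (metis disjoint_iff)
    qed
  qed
  note ext = path_system_extend_two[OF IH(1) finV _ _ _ this, unfolded ar, OF _ girth]
  have sub: "E0 \<subseteq> E - M1" "?ed D \<subseteq> E - M1" unfolding IH(4)[symmetric] by (rule Un_upper1, rule Un_upper2)
  have "E0 \<subseteq> E" using sub(1) by (rule subset_trans) (rule Diff_subset)
  moreover have "?ed D \<subseteq> E - E0"
  proof
    fix e assume e: "e \<in> ?ed D"
    then have "e \<in> E - M1" using sub(2) by (rule subsetD[rotated])
    moreover have "e \<notin> E0" using IH(5) e by (metis disjoint_iff)
    ultimately show "e \<in> E - E0" by simp
  qed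
  ultimately have "\<exists>P \<tau>. path_system (2 * k) V P \<tau> (E0 \<union> ?ed D)" by (rule ext[rotated]) simp
  then show ?thesis unfolding IH(4) .
qed

section \<open>Attaching edges to a system of paths\<close>

lemma is_path_path_edges: "distinct vs \<Longrightarrow> 2 \<le> length vs \<Longrightarrow> is_path (path_edges vs)"
  by (auto simp: is_path_def)

lemma path_end_iff:
  assumes "distinct vs" "2 \<le> length vs"
  shows "path_end (path_edges vs) y \<longleftrightarrow> y = hd vs \<or> y = last vs"
  using assms path_end_path_edges[OF assms] by (auto simp: path_end_def)

text \<open>Each of the edges \<open>{v, t v}\<close> is attached either to the head \<open>v\<close> of its own path \<open>c v\<close>
  (\<open>v \<in> Hd\<close>), or to the end of the path \<open>c (tgt v)\<close>; then \<open>h v\<close> is the new end. An end of a long path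
  is the far end of an attached edge; there are as many of these as path ends without an attached
  edge, which belong to short paths.\<close>

lemma assemble_balanced_decomposition:
  fixes c :: "'a \<Rightarrow> 'a list"
  assumes k: "2 \<le> k" and finU: "finite U"
    and c: "\<And>u. u \<in> U \<Longrightarrow> distinct (c u) \<and> length (c u) = 2 * k \<and> hd (c u) = u"
    and nu: "bij_betw \<nu> U U" "\<And>v. v \<in> U \<Longrightarrow> last (c (\<nu> v)) = t v"
    and E: "E = (\<Union>u\<in>U. path_edges (c u)) \<union> (\<Union>v\<in>U. {{v, t v}})"
    and disj: "\<And>u w e. \<lbrakk>u \<in> U; w \<in> U; e \<in> path_edges (c u); e \<in> path_edges (c w)\<rbrakk> \<Longrightarrow> u = w"
      "\<And>u v. \<lbrakk>u \<in> U; v \<in> U\<rbrakk> \<Longrightarrow> {v, t v} \<notin> path_edges (c u)"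
      "\<And>v w. \<lbrakk>v \<in> U; w \<in> U; {v, t v} = {w, t w}\<rbrakk> \<Longrightarrow> v = w"
    and Hd: "Hd \<subseteq> U" and tgt: "inj_on tgt (U - Hd)" "tgt ` (U - Hd) \<subseteq> U"
    and h: "\<And>v. v \<in> U - Hd \<Longrightarrow> {v, t v} = {last (c (tgt v)), h v}"
    and head: "\<And>u. u \<in> Hd \<Longrightarrow> t u \<notin> set (c u) \<or> (t u = last (c u) \<and> u \<notin> tgt ` (U - Hd))"
    and tail: "\<And>v. v \<in> U - Hd \<Longrightarrow>
      (h v \<notin> set (c (tgt v)) \<and> (tgt v \<in> Hd \<longrightarrow> t (tgt v) \<noteq> h v)) \<or> (h v = tgt v \<and> tgt v \<notin> Hd)"
  shows "\<exists>D. k_balanced_decomposition k V E D \<and> (\<forall>H\<in>D. is_cycle H \<longrightarrow> card H = 2 * k)"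
proof -
  let ?T = "tgt ` (U - Hd)"
  define g where "g = inv_into (U - Hd) tgt"
  have g_tgt: "g (tgt v) = v" if "v \<in> U - Hd" for v using that tgt(1) by (simp add: g_def)
  have gT: "g u \<in> U - Hd" "tgt (g u) = u" if "u \<in> ?T" for u
    unfolding g_def using that by (rule inv_into_into, rule f_inv_into_f)
  define H where "H u = path_edges (c u) \<union> (if u \<in> Hd then {{u, t u}} else {}) \<union>
    (if u \<in> ?T then {{g u, t (g u)}} else {})" for u
  define Sh where "Sh u y \<longleftrightarrow> is_path (H u) \<and> card (H u) \<le> 2 * k \<and> path_end (H u) y" for u y
  define Lo where "Lo u y \<longleftrightarrow> is_path (H u) \<and> 2 * k + 1 \<le> card (H u) \<and> path_end (H u) y" for u y
  \<comment> \<open>\<open>A\<close> and \<open>B\<close> score the head and the tail of piece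
    \<open>u\<close>: +1 at an end without attached edge, -1 at the new end of an attached edge. A
    path of length \<open>2*k\<close> has one end of each kind but counts as short at both, which is
    why \<open>piece\<close> has only an inequality; in a cycle the two scores fall on one vertex
    and cancel.\<close>
  define A where "A u y = (if u \<in> Hd then - of_bool (y = t u) else of_bool (y = u) :: int)" for u y
  define B where "B u y = (if u \<in> ?T then - of_bool (y = h (g u)) else of_bool (y = last (c u)) :: int)" for u y
  have piece: "(is_path (H u) \<or> is_cycle (H u)) \<and> (is_cycle (H u) \<longrightarrow> card (H u) = 2 * k) \<and>
      card (H u) = 2 * k - 1 + of_bool (u \<in> Hd) + of_bool (u \<in> ?T) \<and>
      (\<forall>y. A u y + B u y \<le> of_bool (Sh u y) - of_bool (Lo u y))" if u: "u \<in> U" for u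
  proof -
    have cu: "distinct (c u)" "length (c u) = 2 * k" "hd (c u) = u" "c u \<noteq> []" using c[OF u] k by auto
    have ul: "last (c u) \<noteq> u"
    proof -
      have "c u ! 0 \<noteq> c u ! (length (c u) - 1)"
        using cu k nth_eq_iff_index_eq[OF cu(1), of 0 "length (c u) - 1"] by auto
      then show ?thesis using cu(3,4) by (metis hd_conv_nth last_conv_nth)
    qed
    have plain: ?thesis if vs: "distinct vs" "H u = path_edges vs"
      "length vs = 2 * k + of_bool (u \<in> Hd) + of_bool (u \<in> ?T)"
      "hd vs = (if u \<in> Hd then t u else u)" "last vs = (if u \<in> ?T then h (g u) else last (c u))" for vs
    proof -
      have len: "2 \<le> length vs" using vs(3) k by simp
      have card: "card (H u) = 2 * k - 1 + of_bool (u \<in> Hd) + of_bool (u \<in> ?T)"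
        using card_path_edges[OF vs(1)] vs(2,3) k by simp
      have ends: "path_end (H u) y \<longleftrightarrow> y = hd vs \<or> y = last vs" for y
        unfolding vs(2) by (rule path_end_iff[OF vs(1) len])
      have ip: "is_path (H u)" "\<not> is_cycle (H u)"
        unfolding vs(2) using is_path_path_edges path_not_cycle vs(1) len by blast+
      have "vs \<noteq> []" using len by auto
      moreover from this have "vs ! 0 \<noteq> vs ! (length vs - 1)"
        using len nth_eq_iff_index_eq[OF vs(1), of 0 "length vs - 1"] by auto
      ultimately have hl: "hd vs \<noteq> last vs" by (simp add: hd_conv_nth last_conv_nth)
      have cS: "card (H u) \<le> 2 * k \<longleftrightarrow> \<not> (u \<in> Hd \<and> u \<in> ?T)"
        and cL: "2 * k + 1 \<le> card (H u) \<longleftrightarrow> u \<in> Hd \<and> u \<in> ?T"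
        unfolding card using k by (cases "u \<in> Hd"; cases "u \<in> ?T"; simp)+
      have "A u y + B u y \<le> of_bool (Sh u y) - of_bool (Lo u y)" for y
        using hl unfolding A_def B_def Sh_def Lo_def cS cL ends vs(4,5)
        by (cases "u \<in> Hd"; cases "u \<in> ?T"; simp add: ip(1); force)
      then show ?thesis using ip card by blast
    qed
    have closed: ?thesis if cl: "H u = cycle_edges (c u)" "of_bool (u \<in> Hd) + of_bool (u \<in> ?T) = (1 :: nat)"
      "\<And>y. A u y + B u y \<le> 0"
    proof -
      have card: "card (H u) = 2 * k" using card_cycle_edges[OF cu(1)] cu(2) k cl(1) by simp
      have "is_cycle (H u)" using cu k unfolding cl(1) is_cycle_def by (intro exI[of _ "c u"]) auto
      moreover have "\<not> Lo u y" for y using card by (simp add: Lo_def)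
      moreover have "2 * k = 2 * k - 1 + of_bool (u \<in> Hd) + of_bool (u \<in> ?T)" using cl(2) k by linarith
      moreover have "A u y + B u y \<le> of_bool (Sh u y)" for y
        using cl(3)[of y] by (cases "Sh u y") simp_all
      ultimately show ?thesis using card by simp
    qed
    show ?thesis
    proof (cases "u \<in> Hd"; cases "u \<in> ?T")
      assume "u \<notin> Hd" "u \<notin> ?T"
      then show ?thesis using cu by (intro plain[of "c u"]) (simp_all add: H_def)
    next
      assume uH: "u \<in> Hd" and uT: "u \<notin> ?T"
      show ?thesis
      proof (cases "t u \<in> set (c u)")
        case False
        then show ?thesis using cu uH uT
          by (intro plain[of "t u # c u"]) (simp_all add: H_def path_edges_Cons insert_commute)
      next
        case True
        then have tl: "t u = last (c u)" using head[OF uH] by blast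
        show ?thesis
          by (rule closed) (use uH uT tl cu in \<open>simp_all add: H_def cycle_edges_def A_def B_def insert_commute\<close>)
      qed
    next
      assume uH: "u \<notin> Hd" and uT: "u \<in> ?T"
      have he: "{g u, t (g u)} = {last (c u), h (g u)}" using h[OF gT(1)[OF uT]] gT(2)[OF uT] by simp
      show ?thesis
      proof (cases "h (g u) = u")
        case False
        then have "h (g u) \<notin> set (c u)" using tail[OF gT(1)[OF uT]] gT(2)[OF uT] by auto
        then show ?thesis using cu uH uT he
          by (intro plain[of "c u @ [h (g u)]"]) (simp_all add: H_def path_edges_snoc)
      next
        case True
        show ?thesis
          by (rule closed) (use uH uT True he cu in \<open>simp_all add: H_def cycle_edges_def A_def B_def\<close>)
      qed
    next
      assume uH: "u \<in> Hd" and uT: "u \<in> ?T"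
      have he: "{g u, t (g u)} = {last (c u), h (g u)}" using h[OF gT(1)[OF uT]] gT(2)[OF uT] by simp
      have "t u \<notin> set (c u)" "h (g u) \<notin> set (c u)" "t u \<noteq> h (g u)"
        using head[OF uH] uT tail[OF gT(1)[OF uT]] gT(2)[OF uT] uH by auto
      then show ?thesis using cu uH uT he
        by (intro plain[of "t u # c u @ [h (g u)]"])
          (simp_all add: H_def path_edges_snoc path_edges_Cons insert_commute)
    qed
  qed
  \<comment> \<open>The heads of the \<open>c u\<close> are the \<open>v\<close> in
    \<open>U\<close>, and by \<open>\<nu>\<close> their tails are the \<open>t v\<close>. Attaching
    \<open>{v, t v}\<close> uses up one of these two ends and creates the other, so at each vertex
    everything cancels.\<close>
  have sum0: "(\<Sum>u\<in>U. A u y + B u y) = 0" for y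
  proof -
    define a where "a = (\<lambda>v. of_bool (y = v) :: int)"
    have finH: "finite Hd" "finite (U - Hd)" using finU Hd finite_subset by auto
    have split: "sum f U = sum f Hd + sum f (U - Hd)" for f :: "'a \<Rightarrow> int"
      using sum.subset_diff[OF Hd finU, of f] by simp
    have "(\<Sum>u\<in>U. A u y) = (\<Sum>u\<in>Hd. - a (t u)) + (\<Sum>u\<in>U - Hd. a u)"
      unfolding split by (intro arg_cong2[where f = "(+)"] sum.cong) (simp_all add: A_def a_def)
    moreover have "(\<Sum>u\<in>U. B u y) = (\<Sum>v\<in>U - Hd. - a (h v)) + (\<Sum>u\<in>U - ?T. a (last (c u)))"
    proof -
      have "(\<Sum>u\<in>U. B u y) = (\<Sum>u\<in>?T. B u y) + (\<Sum>u\<in>U - ?T. B u y)"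
        using sum.subset_diff[OF tgt(2) finU, of "\<lambda>u. B u y"] by simp
      also have "(\<Sum>u\<in>?T. B u y) = (\<Sum>v\<in>U - Hd. - a (h v))"
        using g_tgt by (subst sum.reindex[OF tgt(1)]) (auto intro!: sum.cong simp: B_def a_def)
      also have "(\<Sum>u\<in>U - ?T. B u y) = (\<Sum>u\<in>U - ?T. a (last (c u)))"
        by (rule sum.cong) (simp_all add: B_def a_def)
      finally show ?thesis .
    qed
    moreover have "(\<Sum>u\<in>U - ?T. a (last (c u))) = (\<Sum>v\<in>U. a (t v)) - (\<Sum>v\<in>U - Hd. a (last (c (tgt v))))"
    proof -
      have "(\<Sum>u\<in>U. a (last (c u))) = (\<Sum>v\<in>U. a (last (c (\<nu> v))))"
        by (rule sum.reindex_bij_betw[OF nu(1), symmetric])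
      also have "\<dots> = (\<Sum>v\<in>U. a (t v))" using nu(2) by (intro sum.cong) simp_all
      finally have 1: "(\<Sum>u\<in>U. a (last (c u))) = (\<Sum>v\<in>U. a (t v))" .
      have "(\<Sum>u\<in>?T. a (last (c u))) = (\<Sum>v\<in>U - Hd. a (last (c (tgt v))))"
        by (subst sum.reindex[OF tgt(1)]) simp
      then show ?thesis using 1 sum.subset_diff[OF tgt(2) finU, of "\<lambda>u. a (last (c u))"] by simp
    qed
    moreover have "(\<Sum>v\<in>U. a (t v)) = (\<Sum>v\<in>Hd. a (t v)) + (\<Sum>v\<in>U - Hd. a (t v))" by (rule split)
    moreover have "(\<Sum>v\<in>U - Hd. a (h v)) + (\<Sum>v\<in>U - Hd. a (last (c (tgt v)))) =
      (\<Sum>v\<in>U - Hd. a v) + (\<Sum>v\<in>U - Hd. a (t v))"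
    proof -
      have "a (h v) + a (last (c (tgt v))) = a v + a (t v)" if "v \<in> U - Hd" for v
        using h[OF that] by (auto simp: doubleton_eq_iff)
      then show ?thesis by (simp flip: sum.distrib)
    qed
    ultimately show ?thesis by (simp add: sum.distrib sum_negf)
  qed
  have H_edge: "e \<in> H u \<longleftrightarrow> e \<in> path_edges (c u) \<or> (u \<in> Hd \<and> e = {u, t u}) \<or>
      (\<exists>v\<in>U - Hd. tgt v = u \<and> e = {v, t v})" for e u
  proof -
    have "(\<exists>v\<in>U - Hd. tgt v = u \<and> e = {v, t v}) \<longleftrightarrow> u \<in> ?T \<and> e = {g u, t (g u)}"
      using g_tgt gT by (metis imageI)
    then show ?thesis by (simp add: H_def)
  qed
  have Hdisj: "u = w" if uw: "u \<in> U" "w \<in> U" "e \<in> H u" "e \<in> H w" for u w e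
  proof (cases "e \<in> path_edges (c u) \<or> e \<in> path_edges (c w)")
    case True
    have no: "{v, t v} \<noteq> e" if "v \<in> U" for v using disj(2)[OF _ that] True uw(1,2) by metis
    have "e \<in> path_edges (c u)" using uw(1,3) no unfolding H_edge by auto
    moreover have "e \<in> path_edges (c w)" using uw(2,4) no unfolding H_edge by auto
    ultimately show ?thesis using disj(1) uw by blast
  next
    case False
    obtain v where v: "v \<in> U" "e = {v, t v}" "v \<in> Hd \<and> u = v \<or> v \<notin> Hd \<and> u = tgt v"
      using uw(1,3) False unfolding H_edge by blast
    obtain v' where v': "v' \<in> U" "e = {v', t v'}" "v' \<in> Hd \<and> w = v' \<or> v' \<notin> Hd \<and> w = tgt v'"
      using uw(2,4) False unfolding H_edge by blast
    have "v = v'" using disj(3) v v' by metis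
    then show ?thesis using v v' by blast
  qed
  have Hne: "H u \<noteq> {}" if "u \<in> U" for u
  proof
    assume "H u = {}"
    then have "card (H u) = 0" by simp
    then show False using piece[OF that] k by simp
  qed
  have Hinj: "inj_on H U"
  proof (rule inj_onI)
    fix u w assume "u \<in> U" "w \<in> U" "H u = H w"
    then show "u = w" using Hne[of u] Hdisj[of u w] by auto
  qed
  have UH: "\<Union>(H ` U) = E"
  proof (rule set_eqI)
    fix e
    have "e \<in> \<Union>(H ` U) \<longleftrightarrow> (\<exists>u\<in>U. e \<in> path_edges (c u)) \<or> (\<exists>v\<in>U. e = {v, t v})"
    proof
      assume "e \<in> \<Union>(H ` U)"
      then obtain u where "u \<in> U" "e \<in> H u" by blast
      then show "(\<exists>u\<in>U. e \<in> path_edges (c u)) \<or> (\<exists>v\<in>U. e = {v, t v})" unfolding H_edge by blast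
    next
      assume "(\<exists>u\<in>U. e \<in> path_edges (c u)) \<or> (\<exists>v\<in>U. e = {v, t v})"
      then consider u where "u \<in> U" "e \<in> path_edges (c u)" | v where "v \<in> U" "e = {v, t v}" by blast
      then show "e \<in> \<Union>(H ` U)"
      proof cases
        case 1
        then have "e \<in> H u" by (simp add: H_edge)
        then show ?thesis using 1 by blast
      next
        case 2
        show ?thesis
        proof (cases "v \<in> Hd")
          case True
          then have "e \<in> H v" using 2 by (simp add: H_edge)
          then show ?thesis using 2 by blast
        next
          case False
          then have "e \<in> H (tgt v)" "tgt v \<in> U" using 2 tgt(2) unfolding H_edge by blast+
          then show ?thesis by blast
        qed
      qed
    qed
    then show "e \<in> \<Union>(H ` U) \<longleftrightarrow> e \<in> E" unfolding E by simp
  qed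
  have dec: "decomposition E (H ` U)"
    unfolding decomposition_def
  proof (intro conjI ballI impI)
    show "{} \<notin> H ` U" using Hne by auto
    fix X Y assume "X \<in> H ` U" "Y \<in> H ` U" "X \<noteq> Y"
    then show "X \<inter> Y = {}" using Hdisj by blast
  qed (rule UH)
  have cardD: "card {X \<in> H ` U. P X} = card {u \<in> U. P (H u)}" for P
  proof -
    have "{X \<in> H ` U. P X} = H ` {u \<in> U. P (H u)}" by blast
    moreover have "inj_on H {u \<in> U. P (H u)}" by (rule inj_on_subset[OF Hinj]) blast
    ultimately show ?thesis by (simp add: card_image)
  qed
  have Nd: "N_decomposition {2 * k - 1, 2 * k, 2 * k + 1} E (H ` U)"
    unfolding N_decomposition_def
  proof (intro conjI dec ballI)
    fix X assume "X \<in> H ` U"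
    then obtain u where u: "u \<in> U" "X = H u" by blast
    show "is_path X \<or> is_cycle X" using piece[OF u(1)] u(2) by blast
    have "card X = 2 * k - 1 + of_bool (u \<in> Hd) + of_bool (u \<in> ?T)" using piece[OF u(1)] u(2) by blast
    then show "card X \<in> {2 * k - 1, 2 * k, 2 * k + 1}"
      using k by (cases "u \<in> Hd"; cases "u \<in> ?T") auto
  qed
  have bal: "balanced_at k (H ` U) y" for y
  proof -
    have "0 \<le> (\<Sum>u\<in>U. of_bool (Sh u y) - of_bool (Lo u y) :: int)"
      unfolding sum0[of y, symmetric] using piece by (intro sum_mono) blast
    also have "\<dots> = int (card {u \<in> U. Sh u y}) - int (card {u \<in> U. Lo u y})"
      using finU by (simp add: sum_subtractf Int_def)
    finally have "card {u \<in> U. Lo u y} \<le> card {u \<in> U. Sh u y}" by simp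
    then show ?thesis unfolding balanced_at_def cardD Sh_def Lo_def .
  qed
  have "card {X \<in> H ` U. is_path X \<and> card X = 2 * k - 1} = card {X \<in> H ` U. is_path X \<and> card X = 2 * k + 1}"
  proof -
    have "is_path (H u) \<and> card (H u) = 2 * k - 1 \<longleftrightarrow> u \<notin> Hd \<and> u \<notin> ?T" if "u \<in> U" for u
      using piece[OF that] k by (cases "u \<in> Hd"; cases "u \<in> ?T") auto
    then have 1: "{u \<in> U. is_path (H u) \<and> card (H u) = 2 * k - 1} = U - (Hd \<union> ?T)" by (intro set_eqI) (simp only: mem_Collect_eq Diff_iff Un_iff, metis)
    have "is_path (H u) \<and> card (H u) = 2 * k + 1 \<longleftrightarrow> u \<in> Hd \<and> u \<in> ?T" if "u \<in> U" for u
      using piece[OF that] k by (cases "u \<in> Hd"; cases "u \<in> ?T") auto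
    then have 2: "{u \<in> U. is_path (H u) \<and> card (H u) = 2 * k + 1} = Hd \<inter> ?T" using subsetD[OF Hd]
      by (intro set_eqI) (simp only: mem_Collect_eq Int_iff, metis)
    have fin: "finite Hd" "finite ?T" using finU Hd finite_subset by auto
    have "card ?T = card U - card Hd" using tgt(1) fin Hd by (simp add: card_image card_Diff_subset)
    \<comment> \<open>There are as many attached edges as pieces, so pieces with two of them are as
      numerous as pieces with none.\<close>
    then have "card Hd + card ?T = card U" using card_mono[OF finU Hd] by simp
    moreover have "card (Hd \<union> ?T) + card (Hd \<inter> ?T) = card Hd + card ?T" using fin by (rule card_Un_Int[symmetric])
    moreover have "card (U - (Hd \<union> ?T)) = card U - card (Hd \<union> ?T)"
      using fin Hd tgt(2) by (intro card_Diff_subset) auto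
    ultimately have "card (U - (Hd \<union> ?T)) = card (Hd \<inter> ?T)" by simp
    then show ?thesis unfolding cardD 1 2 .
  qed
  then have "k_balanced_decomposition k V E (H ` U)"
    using Nd bal by (simp add: k_balanced_decomposition_def)
  moreover have "\<forall>X\<in>H ` U. is_cycle X \<longrightarrow> card X = 2 * k" using piece by blast
  ultimately show ?thesis by blast
qed

section \<open>Rotating conflicting paths\<close>

text \<open>On a cycle of alternating \<open>\<mu>\<close>- and \<open>\<tau>\<close>-edges,
  \<open>\<nu>\<close> moves two steps. The colour classes are the two \<open>\<nu>\<close>-orbits,
  interchanged by \<open>\<mu>\<close> and \<open>\<tau>\<close>; \<open>U\<close> takes the one
  that contains the smaller least label.\<close>

lemma two_colouring:
  fixes \<mu> \<tau> :: "'a \<Rightarrow> 'a"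
  assumes fin: "finite V" and mu: "\<mu> permutes V" "\<And>x. \<mu> (\<mu> x) = x" "\<And>x. x \<in> V \<Longrightarrow> \<mu> x \<noteq> x"
    and tau: "\<tau> permutes V" "\<And>x. \<tau> (\<tau> x) = x" "\<And>x. x \<in> V \<Longrightarrow> \<tau> x \<noteq> x"
  shows "\<exists>U. U \<subseteq> V \<and> (\<forall>v\<in>V. (\<mu> v \<in> U \<longleftrightarrow> v \<notin> U) \<and> (\<tau> v \<in> U \<longleftrightarrow> v \<notin> U))"
proof -
  define \<nu> where "\<nu> = (\<lambda>v. \<tau> (\<mu> v))"
  have nuV: "\<nu> v \<in> V \<longleftrightarrow> v \<in> V" for v
    using mu(1) tau(1) by (simp add: \<nu>_def permutes_in_image)
  have "\<tau> \<circ> \<mu> permutes V" using mu(1) tau(1) by (intro permutes_compose)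
  then have perm: "\<nu> permutes V" by (simp add: \<nu>_def o_def)
  then have "permutation \<nu>" using fin permutation_permutes by blast
  from permutation_is_nilpotent[OF this] obtain N where N: "\<nu> ^^ N = id" "N > 0" by blast
  have nuV': "(\<nu> ^^ n) v \<in> V \<longleftrightarrow> v \<in> V" for n v by (induction n) (simp_all add: nuV)
  have period: "(\<nu> ^^ (N * n - n)) ((\<nu> ^^ n) v) = v" for n v
  proof -
    have "N * n - n + n = N * n" using N(2) by simp
    then have "(\<nu> ^^ (N * n - n)) ((\<nu> ^^ n) v) = (\<nu> ^^ (N * n)) v"
      by (metis comp_apply funpow_add)
    also have "\<dots> = ((\<nu> ^^ N) ^^ n) v" by (simp only: funpow_mult)
    also have "\<dots> = v" unfolding N(1) by simp
    finally show ?thesis .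
  qed
  \<comment> \<open>\<open>v\<close> and \<open>\<mu> v\<close> lie in different
    \<open>\<nu>\<close>-orbits: cancelling turns the equation for \<open>v\<close> and
    \<open>l\<close> into the same one for \<open>\<nu> v\<close> and \<open>l - 2\<close>, and at
    the bottom \<open>\<mu>\<close> or \<open>\<tau>\<close> has a fixed point.\<close>
  have no: "(\<nu> ^^ l) v \<noteq> \<mu> v" if "v \<in> V" for l v
    using that
  proof (induction l arbitrary: v rule: less_induct)
    case (less l)
    show ?case
    proof
      assume eq: "(\<nu> ^^ l) v = \<mu> v"
      consider "l = 0" | "l = 1" | m where "l = Suc (Suc m)" by (metis One_nat_def not0_implies_Suc)
      then show False
      proof cases
        case 1
        then show False using eq mu(3)[OF less.prems] by simp
      next
        case 2
        have "\<mu> v \<in> V" using less.prems mu(1) by (simp add: permutes_in_image)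
        then show False using 2 eq tau(3)[of "\<mu> v"] by (simp add: \<nu>_def)
      next
        case 3
        have "\<nu> ((\<nu> ^^ m) (\<nu> v)) = \<mu> v" using eq 3 by (simp add: funpow_swap1)
        then have "\<mu> (\<tau> (\<nu> ((\<nu> ^^ m) (\<nu> v)))) = \<mu> (\<tau> (\<mu> v))" by simp
        then have "(\<nu> ^^ m) (\<nu> v) = \<mu> (\<nu> v)" by (simp add: \<nu>_def mu(2) tau(2))
        then show False using less.IH[of m "\<nu> v"] 3 nuV less.prems by simp
      qed
    qed
  qed
  obtain h :: "'a \<Rightarrow> nat" where h: "inj_on h V"
    using finite_imp_inj_to_nat_seg[OF fin] by blast
  define key where "key v = (LEAST m. \<exists>n. h ((\<nu> ^^ n) v) = m)" for v
  have key_at: "\<exists>n. h ((\<nu> ^^ n) v) = key v" for v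
    unfolding key_def by (rule LeastI_ex) blast
  have key_nu: "key (\<nu> v) = key v" for v
  proof -
    have "(\<exists>n. h ((\<nu> ^^ n) (\<nu> v)) = m) \<longleftrightarrow> (\<exists>n. h ((\<nu> ^^ n) v) = m)" for m
    proof
      assume "\<exists>n. h ((\<nu> ^^ n) (\<nu> v)) = m"
      then obtain n where "h ((\<nu> ^^ Suc n) v) = m" by (auto simp: funpow_swap1)
      then show "\<exists>n. h ((\<nu> ^^ n) v) = m" by blast
    next
      assume "\<exists>n. h ((\<nu> ^^ n) v) = m"
      then obtain n where n: "h ((\<nu> ^^ n) v) = m" by blast
      have "(\<nu> ^^ n) v = (\<nu> ^^ n) ((\<nu> ^^ Suc (N - 1)) v)" using N by simp
      also have "\<dots> = (\<nu> ^^ (n + (N - 1))) (\<nu> v)"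
        by (simp only: funpow_add funpow_Suc_right o_apply)
      finally show "\<exists>n. h ((\<nu> ^^ n) (\<nu> v)) = m" using n by metis
    qed
    then show ?thesis by (simp add: key_def)
  qed
  have key_ne: "key v \<noteq> key (\<mu> v)" if v: "v \<in> V" for v
  proof
    assume eq: "key v = key (\<mu> v)"
    obtain n m where "h ((\<nu> ^^ n) v) = key v" "h ((\<nu> ^^ m) (\<mu> v)) = key (\<mu> v)" using key_at by blast
    moreover have "\<mu> v \<in> V" using v mu(1) by (simp add: permutes_in_image)
    ultimately have "(\<nu> ^^ n) v = (\<nu> ^^ m) (\<mu> v)" using eq h v nuV' by (metis inj_onD)
    then have "(\<nu> ^^ (N * m - m)) ((\<nu> ^^ n) v) = \<mu> v" using period by metis
    then have "(\<nu> ^^ (N * m - m + n)) v = \<mu> v" by (simp add: funpow_add)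
    then show False using no[OF v] by blast
  qed
  have key_tau: "key (\<tau> v) = key (\<mu> v)" "key (\<mu> (\<tau> v)) = key v" for v
    using key_nu[of "\<mu> v"] key_nu[of "\<mu> (\<tau> v)"] by (simp_all add: \<nu>_def mu(2) tau(2))
  define U where "U = {v \<in> V. key v < key (\<mu> v)}"
  have "(\<mu> v \<in> U \<longleftrightarrow> v \<notin> U) \<and> (\<tau> v \<in> U \<longleftrightarrow> v \<notin> U)" if v: "v \<in> V" for v
    using v key_ne[OF v] mu(1) tau(1)
    by (auto simp: U_def permutes_in_image mu(2) key_tau)
  moreover have "U \<subseteq> V" by (auto simp: U_def)
  ultimately show ?thesis by blast
qed

text \<open>\<open>U\<close> contains one end of each path and one end of each M1-edge. So both the
  paths, by their heads, and the edges to be attached are indexed by \<open>U\<close>.\<close>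

locale matched_path_system =
  fixes k :: nat and V :: "'a set" and E :: "'a set set" and P :: "'a \<Rightarrow> 'a list" and \<tau> \<mu> :: "'a \<Rightarrow> 'a"
    and E0 :: "'a set set" and U :: "'a set"
  assumes k: "3 \<le> k" and finV: "finite V" and girth: "girth_at_least (2 * k - 2) E"
    and ps: "path_system (2 * k) V P \<tau> E0" and E: "E = E0 \<union> (\<lambda>x. {x, \<mu> x}) ` V"
    and disjE: "\<And>x. x \<in> V \<Longrightarrow> {x, \<mu> x} \<notin> E0"
    and mu_perm: "\<mu> permutes V" and mu_mu: "\<And>x. \<mu> (\<mu> x) = x" and mu_ne: "\<And>x. x \<in> V \<Longrightarrow> \<mu> x \<noteq> x"
    and U: "U \<subseteq> V" and mu_U: "\<And>v. v \<in> V \<Longrightarrow> \<mu> v \<in> U \<longleftrightarrow> v \<notin> U"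
    and tau_U: "\<And>v. v \<in> V \<Longrightarrow> \<tau> v \<in> U \<longleftrightarrow> v \<notin> U"
begin

lemmas psD = path_systemD[OF ps]

lemma mu_V [simp]: "\<mu> x \<in> V \<longleftrightarrow> x \<in> V" using mu_perm by (rule permutes_in_image)

text \<open>For \<open>v\<close> in \<open>U\<close>, the head of the path whose tail is
  \<open>\<mu> v\<close>.\<close>

definition \<nu> :: "'a \<Rightarrow> 'a" where "\<nu> v = \<tau> (\<mu> v)"

lemma nu_V: "\<nu> v \<in> V \<longleftrightarrow> v \<in> V" by (simp add: \<nu>_def psD(3))

lemma nu_U: "v \<in> V \<Longrightarrow> \<nu> v \<in> U \<longleftrightarrow> v \<in> U" by (simp add: \<nu>_def mu_U tau_U)

lemma nu_UI: "v \<in> U \<Longrightarrow> \<nu> v \<in> U" using nu_U U by blast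

lemma tau_nu: "\<tau> (\<nu> v) = \<mu> v" by (simp add: \<nu>_def psD(2))

lemma nu_inj: "\<nu> v = \<nu> w \<longleftrightarrow> v = w" by (metis tau_nu mu_mu)

lemma g4: "4 \<le> 2 * k - 2" using k by simp

lemma tri: "\<lbrakk>{a, b} \<in> E; {b, c} \<in> E; {a, c} \<in> E; a \<noteq> b; b \<noteq> c; a \<noteq> c\<rbrakk> \<Longrightarrow> False"
  by (rule girth_no_triangle[OF girth g4])

lemma pe: "x \<in> V \<Longrightarrow> path_edges (P x) \<subseteq> E0" "x \<in> V \<Longrightarrow> path_edges (P x) \<subseteq> E"
  using psD(10) E by auto

lemma muE: "x \<in> V \<Longrightarrow> {x, \<mu> x} \<in> E" using E by blast

lemma mu_not_pe: "x \<in> V \<Longrightarrow> y \<in> V \<Longrightarrow> {x, \<mu> x} \<notin> path_edges (P y)" using pe(1) disjE by blast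

lemma P_ne: "x \<in> V \<Longrightarrow> P x \<noteq> []" using psD(6)[of x] k by auto

lemma set_P_tau: "x \<in> V \<Longrightarrow> set (P (\<tau> x)) = set (P x)" by (simp add: psD(9))

text \<open>The edge from \<open>v \<in> U\<close> to \<open>\<mu> v\<close> can be attached at \<open>v\<close>.\<close>
definition Hm :: "'a \<Rightarrow> bool" where "Hm v \<longleftrightarrow> \<mu> v \<notin> set (P v) \<or> \<mu> v = \<tau> v"

text \<open>It can be attached neither at \<open>v\<close> nor at \<open>\<mu> v\<close>.\<close>
definition C0 :: "'a \<Rightarrow> bool" where "C0 v \<longleftrightarrow> v \<in> U \<and> \<not> Hm v \<and> v \<in> set (P (\<mu> v))"

text \<open>The successor of \<open>v\<close> on \<open>P (\<mu> v)\<close> in the direction of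
  \<open>\<mu> v\<close>. Rotating along the chord \<open>{v, \<mu> v}\<close> frees
  \<open>{v, nx v}\<close> and makes \<open>nx v\<close> the new end.\<close>

definition nx :: "'a \<Rightarrow> 'a" where "nx v = (SOME z. \<exists>ys zs. P (\<mu> v) = ys @ v # z # zs)"

text \<open>The chord bound leaves the positions 0, 1 and 2 for \<open>v\<close>. At position 0,
  \<open>\<mu> v\<close> would equal \<open>\<tau> v\<close>, and \<open>Hm v\<close> would hold
  because the edge closes a cycle.\<close>

lemma C0_split:
  assumes "C0 v"
  obtains ys zs where "P (\<mu> v) = ys @ v # nx v # zs" "length ys = 1 \<or> length ys = 2"
proof -
  have v: "v \<in> U" "v \<in> V" "v \<in> set (P (\<mu> v))" "\<mu> v \<noteq> \<tau> v" using assms U by (auto simp: C0_def Hm_def)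
  have mv: "\<mu> v \<in> V" using v by simp
  obtain ys rest where sp: "P (\<mu> v) = ys @ v # rest" using v(3) by (meson split_list)
  have "rest \<noteq> []"
  proof
    assume "rest = []"
    then have "last (P (\<mu> v)) = v" using sp by simp
    then show False using psD(7)[OF mv] mu_ne[OF v(2)] by simp
  qed
  then have "\<exists>z ys zs. P (\<mu> v) = ys @ v # z # zs" using sp by (cases rest) auto
  then have "\<exists>ys zs. P (\<mu> v) = ys @ v # nx v # zs" unfolding nx_def by (rule someI_ex)
  then obtain ys zs where sp: "P (\<mu> v) = ys @ v # nx v # zs" by blast
  have "ys \<noteq> []"
  proof
    assume "ys = []"
    then have "\<tau> (\<mu> v) = v" using sp psD(8)[OF mv] by simp
    then have "\<tau> v = \<mu> v" by (metis psD(2))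
    then show False using v(4) by simp
  qed
  moreover have "length ys + (2 * k - 2) \<le> length (P (\<mu> v))"
  proof (rule girth_last[OF girth psD(5)[OF mv] pe(2)[OF mv]])
    have nth: "P (\<mu> v) ! length ys = v" by (simp add: sp)
    show "{last (P (\<mu> v)), P (\<mu> v) ! length ys} \<in> E"
      "{last (P (\<mu> v)), P (\<mu> v) ! length ys} \<notin> path_edges (P (\<mu> v))"
      unfolding nth psD(7)[OF mv] using muE[OF v(2)] mu_not_pe[OF v(2) mv] by (simp_all add: insert_commute)
    show "P (\<mu> v) ! length ys \<noteq> last (P (\<mu> v))" unfolding nth psD(7)[OF mv] using mu_ne[OF v(2)] by simp
    show "length ys < length (P (\<mu> v))" by (simp add: sp)
  qed
  moreover have "length ys \<noteq> 0" using calculation(1) by simp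
  ultimately have "length ys = 1 \<or> length ys = 2" using psD(6)[OF mv] k by linarith
  then show ?thesis using that sp by blast
qed

lemma C0D:
  assumes "C0 v"
  shows "v \<in> U" "v \<in> V" "\<mu> v \<in> V" "\<nu> v \<in> V" "\<mu> v \<in> set (P v)" "\<mu> v \<noteq> \<tau> v" "v \<in> set (P (\<mu> v))"
  using assms U by (auto simp: C0_def Hm_def nu_V)

lemma nxD:
  assumes "C0 v"
  shows "{v, nx v} \<in> path_edges (P (\<mu> v))" "{v, nx v} \<in> E" "nx v \<noteq> v" "nx v \<noteq> \<mu> v" "nx v \<noteq> \<nu> v"
    "nx v \<in> set (P (\<mu> v))" "{v, nx v} \<notin> path_edges (P v)"
proof -
  note v = C0D[OF assms]
  obtain ys zs where sp: "P (\<mu> v) = ys @ v # nx v # zs" "length ys = 1 \<or> length ys = 2"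
    using C0_split[OF assms] by blast
  have d: "distinct (ys @ v # nx v # zs)" using psD(5)[OF v(3)] sp(1) by simp
  have "ys \<noteq> []" using sp(2) by auto
  then show e: "{v, nx v} \<in> path_edges (P (\<mu> v))" unfolding sp(1) by (simp add: path_edges_append)
  then show "{v, nx v} \<in> E" using pe(2)[OF v(3)] by blast
  show "nx v \<noteq> v" using d by auto
  show "nx v \<noteq> \<mu> v" using e mu_not_pe[OF v(2,3)] by metis
  have "hd ys = \<nu> v" using psD(8)[OF v(3)] sp(1) \<open>ys \<noteq> []\<close> by (simp add: \<nu>_def)
  then have "\<nu> v \<in> set ys" using \<open>ys \<noteq> []\<close> by (metis hd_in_set)
  then show "nx v \<noteq> \<nu> v" using d by auto
  show "nx v \<in> set (P (\<mu> v))" unfolding sp(1) by simp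
  show "{v, nx v} \<notin> path_edges (P v)"
  proof
    assume "{v, nx v} \<in> path_edges (P v)"
    then have "\<mu> v = v \<or> \<mu> v = \<tau> v" using psD(11)[OF v(2,3)] e by blast
    then show False using v(6) mu_ne[OF v(2)] by simp
  qed
qed

text \<open>Both \<open>\<mu> v\<close> and \<open>nx v\<close> are then joined to \<open>v\<close>
  by chords of \<open>P v\<close>, hence are among its first three vertices. Since
  \<open>\<mu> v\<close> is not the first one, \<open>nx v\<close> must be: otherwise the two are
  consecutive and form a triangle with \<open>v\<close>.\<close>

lemma nx_in_own_path:
  assumes "C0 v" "nx v \<in> set (P v)"
  shows "nx v = \<tau> v"
proof -
  note v = C0D[OF assms(1)] and nx = nxD[OF assms(1)]
  let ?X = "P v"
  obtain i where i: "i < length ?X" "?X ! i = \<mu> v" using v(5) by (auto simp: in_set_conv_nth)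
  obtain j where j: "j < length ?X" "?X ! j = nx v" using assms(2) by (auto simp: in_set_conv_nth)
  have "i + (2 * k - 2) \<le> length ?X"
    by (rule girth_last[OF girth psD(5)[OF v(2)] pe(2)[OF v(2)]])
      (use i psD(7)[OF v(2)] muE[OF v(2)] mu_not_pe[OF v(2,2)] mu_ne[OF v(2)] in auto)
  then have i2: "i \<le> 2" using psD(6)[OF v(2)] k by simp
  have "j + (2 * k - 2) \<le> length ?X"
    by (rule girth_last[OF girth psD(5)[OF v(2)] pe(2)[OF v(2)]])
      (use j psD(7)[OF v(2)] nx in auto)
  then have j2: "j \<le> 2" using psD(6)[OF v(2)] k by simp
  have hd: "?X ! 0 = \<tau> v" using psD(8)[OF v(2)] P_ne[OF v(2)] by (simp add: hd_conv_nth)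
  have "i \<noteq> 0" using i hd v(6) by metis
  have "i \<noteq> j" using i j nx(4) by auto
  show ?thesis
  proof (cases "j = 0")
    case True
    then show ?thesis using j hd by simp
  next
    case False
    have "{?X ! 1, ?X ! 2} \<in> path_edges ?X"
      using path_edgesI[of 1 ?X] psD(6)[OF v(2)] k by (simp add: numeral_2_eq_2)
    moreover have "(i = 1 \<and> j = 2) \<or> (i = 2 \<and> j = 1)" using i2 j2 False \<open>i \<noteq> 0\<close> \<open>i \<noteq> j\<close> by linarith
    then have "{?X ! 1, ?X ! 2} = {\<mu> v, nx v}" using i(2) j(2) by auto
    ultimately have "{\<mu> v, nx v} \<in> E" using pe(2)[OF v(2)] by auto
    then show ?thesis using tri[of v "\<mu> v" "nx v"] muE[OF v(2)] nx mu_ne[OF v(2)] by metis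
  qed
qed

text \<open>\<open>nx w\<close> has position 2 or 3, so a chord from it reaches only the head
  \<open>\<nu> w\<close> or the tail \<open>\<mu> w\<close>, and \<open>\<mu> w\<close> is already
  the partner of \<open>w\<close>. This is needed when an edge is pushed on to the end
  \<open>nx w\<close> of a rotated path.\<close>

lemma mate_nx_in_path:
  assumes "C0 w" "\<mu> (nx w) \<in> set (P (\<mu> w))" "nx w \<in> V"
  shows "\<mu> (nx w) = \<nu> w"
proof -
  note w = C0D[OF assms(1)] and nx = nxD[OF assms(1)]
  let ?X = "P (\<mu> w)"
  obtain ys zs where sp: "?X = ys @ w # nx w # zs" "length ys = 1 \<or> length ys = 2"
    using C0_split[OF assms(1)] by blast
  define i where "i = Suc (length ys)"
  have i: "?X ! i = nx w" "i < length ?X" "i = 2 \<or> i = 3" using sp by (auto simp: i_def nth_append)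
  obtain j where j: "j < length ?X" "?X ! j = \<mu> (nx w)" using assms(2) by (auto simp: in_set_conv_nth)
  have len: "length ?X = 2 * k" using psD(6)[OF w(3)] .
  have ne: "{nx w, \<mu> (nx w)} \<notin> path_edges ?X" using mu_not_pe[OF assms(3) w(3)] .
  have "i \<noteq> j" using i j mu_ne[OF assms(3)] by auto
  have "j \<noteq> Suc i"
  proof
    assume "j = Suc i"
    then show False using path_edgesI[of i ?X] i j ne by auto
  qed
  have "i \<noteq> Suc j"
  proof
    assume "i = Suc j"
    then show False using path_edgesI[of j ?X] i j ne by (auto simp: insert_commute)
  qed
  consider "Suc j < i" | "Suc i < j" using \<open>i \<noteq> j\<close> \<open>j \<noteq> Suc i\<close> \<open>i \<noteq> Suc j\<close> by linarith
  then show ?thesis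
  proof cases
    case 1
    have "{?X ! j, ?X ! i} \<in> E" using i j muE[OF assms(3)] by (simp add: insert_commute)
    from girth_chord[OF girth psD(5)[OF w(3)] pe(2)[OF w(3)] 1 i(2) this]
    have "j = 0" using i(3) k by auto
    then show ?thesis using j psD(8)[OF w(3)] P_ne[OF w(3)] by (simp add: hd_conv_nth \<nu>_def)
  next
    case 2
    have "{?X ! i, ?X ! j} \<in> E" using i j muE[OF assms(3)] by simp
    from girth_chord[OF girth psD(5)[OF w(3)] pe(2)[OF w(3)] 2 j(1) this]
    have "j = 2 * k - 1" using i(3) k j(1) len by auto
    then have "\<mu> (nx w) = \<mu> w" using j(2) psD(7)[OF w(3)] P_ne[OF w(3)] len by (simp add: last_conv_nth)
    then show ?thesis using nx(3) mu_mu by metis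
  qed
qed

text \<open>The new ends of the path with head \<open>\<nu> v\<close>, attached at its head because of \<open>\<nu> v\<close> and at its
  tail because of \<open>v\<close>, would coincide.\<close>
definition trouble :: "'a \<Rightarrow> bool" where
  "trouble v \<longleftrightarrow> C0 v \<and> C0 (\<nu> v) \<and> nx (\<nu> v) \<in> {v, \<mu> v}"

text \<open>With \<open>u = \<nu> v\<close> and \<open>u2 = \<nu> u\<close>, the second trouble
  yields an edge between the ends \<open>u2\<close> and \<open>\<mu> u\<close> of
  \<open>P (\<mu> u)\<close>. Together with the chord from \<open>u\<close> to
  \<open>\<mu> u\<close> it closes a triangle or a four-cycle; the latter forces
  \<open>k = 3\<close>, and checking the positions of \<open>\<mu> u2\<close> on the six vertices
  leaves only \<open>u2 = v\<close>. So consecutive troubles occur only on 2-cycles of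
  \<open>\<nu>\<close>, where a tie-break suffices.\<close>

lemma trouble_twice:
  assumes "trouble v" "trouble (\<nu> v)"
  shows "\<nu> (\<nu> v) = v"
proof -
  define u u2 where "u = \<nu> v" and "u2 = \<nu> u"
  have C: "C0 v" "C0 u" "C0 u2" and nu: "nx u \<in> {v, \<mu> v}" "nx u2 \<in> {u, \<mu> u}"
    using assms by (auto simp: trouble_def u_def u2_def)
  note u = C0D[OF C(2)] and u2 = C0D[OF C(3)] and v = C0D[OF C(1)]
  have tu2: "\<tau> u2 = \<mu> u" by (simp add: u2_def tau_nu)
  let ?X = "P (\<mu> u)"
  have X: "set (P u2) = set ?X" using set_P_tau[OF u2(2)] tu2 by simp
  have Xl: "last ?X = \<mu> u" "hd ?X = u2" "length ?X = 2 * k" "distinct ?X" "?X \<noteq> []"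
    using psD(5-8)[OF u(3)] P_ne[OF u(3)] by (simp_all add: u2_def \<nu>_def)
  have "nx u2 \<in> set ?X" using nu(2) u(7) Xl(1,5) by (metis empty_iff insert_iff last_in_set)
  then have nx2: "nx u2 = \<mu> u" using nx_in_own_path[OF C(3)] X tu2 by simp
  then have e2: "{u2, \<mu> u} \<in> E" using nxD(2)[OF C(3)] by simp
  obtain ys zs where sp: "?X = ys @ u # nx u # zs" "length ys = 1 \<or> length ys = 2"
    using C0_split[OF C(2)] by blast
  have X0: "?X ! 0 = u2" using Xl(2,5) by (simp add: hd_conv_nth)
  have edge: "{?X ! i, ?X ! Suc i} \<in> E" if "Suc i < length ?X" for i
    using path_edgesI[OF that] pe(2)[OF u(3)] by blast
  have muu: "\<mu> u \<noteq> u" "\<mu> u \<noteq> u2" using mu_ne[OF u(2)] nx2 nxD(3)[OF C(3)] by simp_all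
  have l2: "length ys = 2"
  proof (rule ccontr)
    assume "length ys \<noteq> 2"
    then have l1: "length ys = 1" using sp(2) by simp
    then have "?X ! 1 = u" using sp(1) by (simp add: nth_append)
    then have "{u2, u} \<in> E" using edge[of 0] X0 Xl(3) k by simp
    moreover have "u2 \<noteq> u" using X0 \<open>?X ! 1 = u\<close> nth_eq_iff_index_eq[OF Xl(4), of 0 1] Xl(3) k by auto
    ultimately show False using tri[of u2 u "\<mu> u"] muE[OF u(2)] e2 muu by metis
  qed
  have X2: "?X ! 2 = u" "?X ! 3 = nx u" using sp(1) l2 by (auto simp: nth_append)
  have idx: "?X ! i = ?X ! j \<longleftrightarrow> i = j" if "i < 2 * k" "j < 2 * k" for i j
    using that Xl(3,4) by (simp add: nth_eq_iff_index_eq)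
  have Xlast: "?X ! (2 * k - 1) = \<mu> u" using Xl(1,3,5) by (simp add: last_conv_nth)
  have "2 * k - 2 \<le> 4"
  proof (rule girth_four_cycle[OF girth])
    show "{?X ! 0, ?X ! 1} \<in> E" using edge[of 0] Xl(3) k by simp
    show "{?X ! 1, ?X ! 2} \<in> E" using edge[of 1] Xl(3) k by (simp add: numeral_2_eq_2)
    show "{?X ! 2, \<mu> u} \<in> E" using X2 muE[OF u(2)] by simp
    show "{?X ! 0, \<mu> u} \<in> E" using X0 e2 by simp
    show "distinct [?X ! 0, ?X ! 1, ?X ! 2, \<mu> u]"
    proof -
      have neq: "?X ! i \<noteq> ?X ! j" if "i < j" "j < 2 * k" for i j
        using that idx[of i j] by simp
      have lt: "(2::nat) < 2 * k - 1" "2 * k - 1 < 2 * k" using k by linarith+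
      have "?X ! 0 \<noteq> ?X ! 1" "?X ! 0 \<noteq> ?X ! 2" "?X ! 1 \<noteq> ?X ! 2" by (rule neq; use k in linarith)+
      moreover have "?X ! 0 \<noteq> ?X ! (2 * k - 1)" "?X ! 1 \<noteq> ?X ! (2 * k - 1)" "?X ! 2 \<noteq> ?X ! (2 * k - 1)"
        by (rule neq; use lt in linarith)+
      ultimately have "distinct [?X ! 0, ?X ! 1, ?X ! 2, ?X ! (2 * k - 1)]"
        by (simp only: distinct.simps list.set insert_iff empty_iff simp_thms)
      then show ?thesis unfolding Xlast .
    qed
  qed
  then have k3: "k = 3" using k by simp
  have "\<mu> u2 \<in> set ?X" using u2(5) X by simp
  then obtain j where j: "j < 2 * k" "?X ! j = \<mu> u2" using Xl(3) by (auto simp: in_set_conv_nth)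
  have "2 * k - 2 \<le> Suc j"
    by (rule girth_hd[OF girth Xl(4) pe(2)[OF u(3)]])
      (use j Xl muE[OF u2(2)] mu_not_pe[OF u2(2) u(3)] mu_ne[OF u2(2)] in auto)
  then consider "j = 3" | "j = 4" | "j = 5" using j(1) k3 by linarith
  then show ?thesis
  proof cases
    case 1
    then have "nx u = \<mu> u2" using j X2 by simp
    then have "\<mu> u2 = v \<or> \<mu> u2 = \<mu> v" using nu(1) by auto
    moreover have "\<mu> u2 \<noteq> v" using mu_U[OF u2(2)] u2(1) v(1) by auto
    ultimately have "u2 = v" by (metis mu_mu)
    then show ?thesis by (simp add: u_def u2_def)
  next
    case 2
    have "{\<mu> u2, \<mu> u} \<in> E" using edge[of 4] j 2 Xlast Xl(3) k3 by simp
    moreover have "\<mu> u2 \<noteq> \<mu> u" using j 2 Xlast idx[of 4 5] k3 by auto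
    ultimately show ?thesis using tri[of u2 "\<mu> u2" "\<mu> u"] muE[OF u2(2)] e2 muu mu_ne[OF u2(2)] by metis
  next
    case 3
    then have "\<mu> u2 = \<mu> u" using j Xlast k3 by simp
    then have "u2 = u" by (metis mu_mu)
    then show ?thesis using X0 X2 idx[of 0 2] k3 by simp
  qed
qed

end

context matched_path_system
begin

section \<open>Deciding between rotating and pushing\<close>

definition wt :: "'a \<Rightarrow> nat" where "wt = (SOME h. inj_on h V)"

lemma wt_inj: "inj_on wt V"
proof -
  have "\<exists>h :: 'a \<Rightarrow> nat. inj_on h V" using finite_imp_inj_to_nat_seg[OF finV] by metis
  then show ?thesis unfolding wt_def by (rule someI_ex)
qed

text \<open>The edge at \<open>v\<close> is pushed on along the \<open>\<nu>\<close>-orbit of \<open>v\<close>; the weights break ties.\<close>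
definition pushed :: "'a \<Rightarrow> bool" where
  "pushed v \<longleftrightarrow> trouble v \<and> (trouble (\<nu> v) \<longrightarrow> wt v < wt (\<nu> v))"

text \<open>The vertices at which a rotation is actually carried out.\<close>

definition C :: "'a \<Rightarrow> bool" where "C v \<longleftrightarrow> C0 v \<and> \<not> pushed v"

lemma C_imp_C0: "C v \<Longrightarrow> C0 v" by (simp add: C_def)

lemma troubleD: "trouble v \<Longrightarrow> v \<in> V \<and> \<nu> v \<in> V \<and> \<nu> v \<noteq> v"
  using C0D(2,4,6)[of v] by (metis tau_nu trouble_def)

text \<open>If only \<open>w\<close> is in trouble, it is pushed outright. If both are, they form a
  2-cycle of \<open>\<nu>\<close>, and since \<open>u\<close> was not pushed, the weights push
  \<open>w\<close>.\<close>

lemma not_C_if_trouble: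
  assumes "C u" "C0 w" "\<nu> w = u" "nx u \<in> {w, \<mu> w}"
  shows "\<not> C w"
proof -
  have t: "trouble w" using assms by (auto simp: trouble_def C_def)
  have "wt w < wt u" if tu: "trouble u"
  proof -
    have "\<nu> u = w" using trouble_twice[OF t] tu assms(3) by simp
    then have "\<not> wt u < wt w" using assms(1) tu t by (simp add: C_def pushed_def)
    moreover have "wt u \<noteq> wt w" using troubleD[OF t] assms(3) wt_inj by (metis inj_onD)
    ultimately show ?thesis by simp
  qed
  then have "pushed w" using t assms(3) by (simp add: pushed_def)
  then show ?thesis by (simp add: C_def)
qed

text \<open>The successor of a pushed vertex is itself rotated, and the tail of its rotated path is
  an end of the pushed edge, which can therefore be attached there.\<close>

lemma C_if_pushed:
  assumes "pushed v"
  shows "C (\<nu> v)" "nx (\<nu> v) \<in> {v, \<mu> v}"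
proof -
  have t: "trouble v" using assms by (simp add: pushed_def)
  then have "C0 (\<nu> v)" by (simp add: trouble_def)
  moreover have "\<not> pushed (\<nu> v)"
  proof
    assume p: "pushed (\<nu> v)"
    then have t2: "trouble (\<nu> v)" by (simp add: pushed_def)
    have "\<nu> (\<nu> v) = v" by (rule trouble_twice[OF t t2])
    then show False using assms p t t2 by (simp add: pushed_def)
  qed
  ultimately show "C (\<nu> v)" by (simp add: C_def)
  show "nx (\<nu> v) \<in> {v, \<mu> v}" using t by (simp add: trouble_def)
qed

section \<open>Rotated paths and the final places of the edges\<close>

definition pr :: "'a \<Rightarrow> 'a" where "pr u = \<mu> (\<tau> u)"

lemma pr_nu: "pr (\<nu> v) = v" "\<nu> (pr u) = u"
  by (simp_all add: pr_def tau_nu mu_mu \<nu>_def psD(2))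

lemma mu_pr: "\<mu> (pr u) = \<tau> u" by (simp add: pr_def mu_mu)

lemma pr_U: "u \<in> U \<Longrightarrow> pr u \<in> U"
  using nu_U[of "pr u"] U pr_nu(2)[of u] nu_V[of "pr u"] by auto

text \<open>If \<open>P (\<mu> w)\<close> is \<open>ys @ w # nx w # zs\<close>, this is
  \<open>ys @ w # rev (nx w # zs)\<close>, the rotation along the chord between \<open>w\<close> and
  the last vertex \<open>\<mu> w\<close>.\<close>

definition rot :: "'a \<Rightarrow> 'a list" where
  "rot w = takeWhile (\<lambda>x. x \<noteq> w) (P (\<mu> w)) @ w # rev (tl (dropWhile (\<lambda>x. x \<noteq> w) (P (\<mu> w))))"

lemma rot:
  assumes "C0 w"
  shows "distinct (rot w)" "length (rot w) = 2 * k" "hd (rot w) = \<nu> w" "last (rot w) = nx w"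
    "set (rot w) = set (P (\<mu> w))"
    "path_edges (rot w) = path_edges (P (\<mu> w)) - {{w, nx w}} \<union> {{w, \<mu> w}}"
proof -
  note w = C0D[OF assms]
  obtain ys zs where sp: "P (\<mu> w) = ys @ w # nx w # zs" "length ys = 1 \<or> length ys = 2"
    using C0_split[OF assms] by blast
  have d: "distinct (ys @ w # nx w # zs)" using psD(5)[OF w(3)] sp(1) by simp
  have ys: "ys \<noteq> []" using sp(2) by auto
  have nin: "\<And>y. y \<in> set ys \<Longrightarrow> y \<noteq> w" using d by auto
  have "takeWhile (\<lambda>x. x \<noteq> w) (P (\<mu> w)) = ys"
    unfolding sp(1) using nin by (subst takeWhile_append2) auto
  moreover have "dropWhile (\<lambda>x. x \<noteq> w) (P (\<mu> w)) = w # nx w # zs"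
    unfolding sp(1) using nin by (subst dropWhile_append2) auto
  ultimately have r: "rot w = (ys @ [w]) @ rev (nx w # zs)" by (simp add: rot_def)
  have X: "P (\<mu> w) = (ys @ [w]) @ nx w # zs" using sp(1) by simp
  show "distinct (rot w)" unfolding r using d by auto
  show "length (rot w) = 2 * k" using psD(6)[OF w(3)] unfolding r X by simp
  show "set (rot w) = set (P (\<mu> w))" unfolding r X by auto
  show "hd (rot w) = \<nu> w" using psD(8)[OF w(3)] ys unfolding r X by (simp add: \<nu>_def)
  show "last (rot w) = nx w" unfolding r by simp
  have l: "last (nx w # zs) = \<mu> w" using psD(7)[OF w(3)] unfolding X by simp
  have "hd (rev (nx w # zs)) = \<mu> w" using l by (simp only: hd_rev)
  then have er: "path_edges (rot w) = insert {w, \<mu> w} (path_edges (ys @ [w]) \<union> path_edges (nx w # zs))"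
    unfolding r by (subst path_edges_append) (simp_all del: rev.simps)
  have eX: "path_edges (P (\<mu> w)) = insert {w, nx w} (path_edges (ys @ [w]) \<union> path_edges (nx w # zs))"
    unfolding X by (subst path_edges_append) simp_all
  have "{w, nx w} \<notin> path_edges (ys @ [w])" using path_edges_subset_set[of "{w, nx w}" "ys @ [w]"] d by auto
  moreover have "{w, nx w} \<notin> path_edges (nx w # zs)"
    using path_edges_subset_set[of "{w, nx w}" "nx w # zs"] d by auto
  ultimately show "path_edges (rot w) = path_edges (P (\<mu> w)) - {{w, nx w}} \<union> {{w, \<mu> w}}"
    unfolding er eX by auto
qed

definition core :: "'a \<Rightarrow> 'a list" where "core u = (if C (pr u) then rot (pr u) else P (\<tau> u))"

text \<open>\<open>{v, t v}\<close> is the edge to be attached on behalf of \<open>v\<close>: after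
  a rotation at \<open>v\<close> the M1-edge lies inside a path and \<open>{v, nx v}\<close> is free
  instead.\<close>

definition t :: "'a \<Rightarrow> 'a" where "t v = (if C v then nx v else \<mu> v)"

lemma core:
  assumes "u \<in> U"
  shows "distinct (core u)" "length (core u) = 2 * k" "hd (core u) = u" "last (core u) = t (pr u)"
    "set (core u) = set (P (\<tau> u))"
proof -
  have V: "u \<in> V" "\<tau> u \<in> V" using assms U psD(3) by auto
  note R = rot[OF C_imp_C0, of "pr u", unfolded mu_pr pr_nu]
  have last: "last (P (\<tau> u)) = \<tau> u" "hd (P (\<tau> u)) = u" using psD(2) psD(7,8)[OF V(2)] by simp_all
  show "distinct (core u)" using R(1) psD(5)[OF V(2)] by (simp add: core_def)
  show "length (core u) = 2 * k" using R(2) psD(6)[OF V(2)] by (simp add: core_def)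
  show "hd (core u) = u" using R(3) last by (simp add: core_def)
  show "last (core u) = t (pr u)" using R(4) last by (simp add: core_def t_def mu_pr)
  show "set (core u) = set (P (\<tau> u))" using R(5) by (simp add: core_def)
qed

lemma core_edges:
  assumes "u \<in> U"
  shows "e \<in> path_edges (core u) \<longleftrightarrow>
    (e \<in> path_edges (P (\<tau> u)) \<and> \<not> (C (pr u) \<and> e = {pr u, nx (pr u)})) \<or>
    (C (pr u) \<and> e = {pr u, \<mu> (pr u)})"
  using rot(6)[OF C_imp_C0, of "pr u", unfolded mu_pr] by (auto simp: core_def mu_pr)

text \<open>The edge \<open>{v, \<mu> v}\<close> cannot stay at the tail of the path with head
  \<open>u = (\<nu> ^^ i) v\<close> if the edge attached at that head ends in \<open>nx u\<close>,
  one of \<open>v\<close> and \<open>\<mu> v\<close>. It then moves on to the path with head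
  \<open>\<nu> u\<close>, whose tail is this \<open>nx u\<close>. For \<open>i = 1\<close> it sits
  on the path with tail \<open>\<mu> v\<close>.\<close>

definition stop :: "'a \<Rightarrow> nat \<Rightarrow> bool" where
  "stop v i \<longleftrightarrow> \<not> (C ((\<nu> ^^ i) v) \<and> nx ((\<nu> ^^ i) v) \<in> {v, \<mu> v})"

definition idx :: "'a \<Rightarrow> nat" where "idx v = (LEAST i. 1 \<le> i \<and> stop v i)"

definition tgt :: "'a \<Rightarrow> 'a" where "tgt v = (\<nu> ^^ idx v) v"

definition Hd :: "'a set" where "Hd = {v \<in> U. Hm v \<or> C v}"

definition h :: "'a \<Rightarrow> 'a" where "h v = (if last (core (tgt v)) = v then \<mu> v else v)"

lemma nu_pow_U: "v \<in> U \<Longrightarrow> (\<nu> ^^ n) v \<in> U"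
  by (induction n) (simp_all add: nu_UI)

lemma nu_perm: "\<nu> permutes V"
proof -
  have "\<tau> \<circ> \<mu> permutes V" using mu_perm psD(1) by (intro permutes_compose)
  moreover have "\<tau> \<circ> \<mu> = \<nu>" by (rule ext) (simp add: \<nu>_def)
  ultimately show ?thesis by simp
qed

lemma nu_pow_inj: "(\<nu> ^^ n) v = (\<nu> ^^ n) w \<longleftrightarrow> v = w"
  by (induction n) (simp_all add: nu_inj)

lemma MD:
  assumes "v \<in> U - Hd"
  shows "v \<in> U" "v \<in> V" "\<not> Hm v" "\<not> C v" "t v = \<mu> v" "\<mu> v \<notin> U" "\<mu> v \<noteq> v"
  using assms U mu_U mu_ne by (auto simp: Hd_def t_def)

lemma idx:
  assumes "v \<in> U - Hd"
  shows "1 \<le> idx v" "stop v (idx v)" "\<And>i. \<lbrakk>1 \<le> i; i < idx v\<rbrakk> \<Longrightarrow> \<not> stop v i"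
proof -
  have "permutation \<nu>" using nu_perm finV permutation_permutes by blast
  then obtain N where N: "\<nu> ^^ N = id" "N > 0" by (rule permutation_is_nilpotent)
  \<comment> \<open>The search ends at the latest when the orbit returns to \<open>v\<close>, where
    \<open>C\<close> fails.\<close>
  have "1 \<le> N \<and> stop v N" using N MD(4)[OF assms] by (simp add: stop_def)
  then have "1 \<le> idx v \<and> stop v (idx v)" unfolding idx_def by (rule LeastI)
  then show "1 \<le> idx v" "stop v (idx v)" by simp_all
  show "\<not> stop v i" if "1 \<le> i" "i < idx v" for i
    using not_less_Least[of i "\<lambda>i. 1 \<le> i \<and> stop v i"] that by (simp add: idx_def)
qed

lemma tgt_U: "v \<in> U - Hd \<Longrightarrow> tgt v \<in> U"
  by (simp add: tgt_def nu_pow_U)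

text \<open>If two edges stop at the same path, the one that travelled farther has passed the
  starting vertex of the other. It can pass only vertices with \<open>C\<close>, whereas these edges
  start at vertices without \<open>C\<close>.\<close>

lemma tgt_inj: "inj_on tgt (U - Hd)"
proof -
  have le: "v = w" if "v \<in> U - Hd" "w \<in> U - Hd" "tgt v = tgt w" "idx v \<le> idx w" for v w
  proof -
    let ?d = "idx w - idx v"
    have "(\<nu> ^^ idx w) w = (\<nu> ^^ idx v) ((\<nu> ^^ ?d) w)"
      using that(4) by (metis add.commute comp_apply funpow_add le_add_diff_inverse2)
    then have v: "v = (\<nu> ^^ ?d) w" using that(3) by (simp add: tgt_def nu_pow_inj)
    show ?thesis
    proof (cases "?d = 0")
      case True
      then show ?thesis using v by simp
    next
      case False
      then have "\<not> stop w ?d" using idx(1)[OF that(1)] by (intro idx(3)[OF that(2)]) linarith+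
      then have "C v" using v by (simp add: stop_def)
      then show ?thesis using MD(4)[OF that(1)] by blast
    qed
  qed
  show ?thesis
  proof (rule inj_onI)
    fix v w assume "v \<in> U - Hd" "w \<in> U - Hd" "tgt v = tgt w"
    then show "v = w" using le[of v w] le[of w v] by (metis linear)
  qed
qed

lemma tgt_cases:
  assumes v: "v \<in> U - Hd"
  obtains (one) "tgt v = \<nu> v" "pr (tgt v) = v" "last (core (tgt v)) = \<mu> v"
  | (more) y where "C y" "y \<in> U" "tgt v = \<nu> y" "pr (tgt v) = y" "last (core (tgt v)) = nx y" "nx y \<in> {v, \<mu> v}"
proof -
  define y where "y = (\<nu> ^^ (idx v - 1)) v"
  have "tgt v = (\<nu> ^^ Suc (idx v - 1)) v" using idx(1)[OF v] by (simp add: tgt_def)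
  then have ty: "tgt v = \<nu> y" by (simp add: y_def)
  then have pr: "pr (tgt v) = y" by (simp add: pr_nu)
  have l: "last (core (tgt v)) = t y" using core(4)[OF tgt_U[OF v]] pr by simp
  show ?thesis
  proof (cases "idx v = 1")
    case True
    then have "y = v" by (simp add: y_def)
    then show ?thesis using one ty pr l MD(5)[OF v] by simp
  next
    case False
    then have "\<not> stop v (idx v - 1)" using idx(1)[OF v] by (intro idx(3)[OF v]) linarith+
    then have y: "C y" "nx y \<in> {v, \<mu> v}" by (simp_all add: stop_def y_def)
    moreover have "y \<in> U" using MD(1)[OF v] by (simp add: y_def nu_pow_U)
    ultimately show ?thesis using more[of y] ty pr l by (simp add: t_def)
  qed
qed

lemma h_edge:
  assumes v: "v \<in> U - Hd"
  shows "{v, t v} = {last (core (tgt v)), h v}"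
proof -
  have "last (core (tgt v)) \<in> {v, \<mu> v}" by (rule tgt_cases[OF v]) simp_all
  then show ?thesis using MD(5)[OF v] by (auto simp: h_def)
qed

lemma stop_tgt: "v \<in> U - Hd \<Longrightarrow> \<not> (C (tgt v) \<and> nx (tgt v) \<in> {v, \<mu> v})"
  using idx(2) by (simp add: stop_def tgt_def)

text \<open>A new end already on the path must be its far end, and then no edge may be attached at
  the tail. For rotated \<open>u\<close> this far end is \<open>\<tau> u\<close>, the partner of
  \<open>pr u\<close>; the trouble rule then forbids a rotation at \<open>pr u\<close>, so the tail
  is still \<open>\<tau> u\<close>, and \<open>stop\<close> keeps every pushed edge away.\<close>

lemma head_ok:
  assumes u: "u \<in> Hd"
  shows "t u \<notin> set (core u) \<or> (t u = last (core u) \<and> u \<notin> tgt ` (U - Hd))"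
proof -
  have uU: "u \<in> U" "u \<in> V" using u U by (auto simp: Hd_def)
  have set: "set (core u) = set (P u)" using core(5)[OF uU(1)] set_P_tau[OF uU(2)] by simp
  show ?thesis
  proof (cases "C u")
    case True
    note Cu = C_imp_C0[OF True]
    show ?thesis
    proof (cases "nx u \<in> set (P u)")
      case False
      then show ?thesis using True set by (simp add: t_def)
    next
      case nin: True
      have nx: "nx u = \<tau> u" by (rule nx_in_own_path[OF Cu nin])
      then have nxp: "nx u \<in> {pr u, \<mu> (pr u)}" by (simp add: mu_pr)
      have nC: "\<not> C (pr u)"
        using not_C_if_trouble[OF True C_imp_C0 pr_nu(2) nxp] by blast
      then have "last (core u) = \<tau> u" using core(4)[OF uU(1)] by (simp add: t_def mu_pr)
      moreover have "u \<notin> tgt ` (U - Hd)"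
      proof
        assume "u \<in> tgt ` (U - Hd)"
        then obtain v where v: "v \<in> U - Hd" "tgt v = u" by blast
        show False
        proof (cases rule: tgt_cases[OF v(1)])
          case 1
          then have "pr u = v" using v(2) by simp
          then show False using stop_tgt[OF v(1)] True v(2) nxp by simp
        next
          case (2 y)
          then show False using nC v(2) by simp
        qed
      qed
      ultimately show ?thesis using nx True by (simp add: t_def)
    qed
  next
    case False
    then have H: "Hm u" "t u = \<mu> u" using u by (simp_all add: Hd_def t_def)
    show ?thesis
    proof (cases "\<mu> u \<in> set (P u)")
      case True
      then have mt: "\<mu> u = \<tau> u" using H by (simp add: Hm_def)
      then have nu: "\<nu> u = u" by (simp add: \<nu>_def psD(2))
      then have pu: "pr u = u" using pr_nu(1)[of u] by simp
      then have "last (core u) = \<mu> u" using core(4)[OF uU(1)] H by simp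
      moreover have "u \<notin> tgt ` (U - Hd)"
      proof
        assume "u \<in> tgt ` (U - Hd)"
        then obtain v where v: "v \<in> U - Hd" "tgt v = u" by blast
        have "(\<nu> ^^ n) u = u" for n by (induction n) (simp_all add: nu)
        then have "(\<nu> ^^ idx v) v = (\<nu> ^^ idx v) u" using v(2) by (simp add: tgt_def)
        then have "v = u" by (simp only: nu_pow_inj)
        then show False using v(1) u by simp
      qed
      ultimately show ?thesis using H by simp
    qed (use H set in simp)
  qed
qed

text \<open>On the path with tail \<open>\<mu> v\<close>, a vertex \<open>v\<close> on that path
  would be in unrotated conflict, hence pushed, and the edge would not have stopped there. On a
  rotated path only the head can be hit; lying in \<open>U\<close>, it is \<open>v\<close> itself,
  which has no edge at its head, so a cycle closes.\<close>

lemma tail_ok: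
  assumes v: "v \<in> U - Hd"
  shows "(h v \<notin> set (core (tgt v)) \<and> (tgt v \<in> Hd \<longrightarrow> t (tgt v) \<noteq> h v)) \<or> (h v = tgt v \<and> tgt v \<notin> Hd)"
proof -
  note vD = MD[OF v]
  define u where "u = tgt v"
  have u: "u \<in> U" "u \<in> V" using tgt_U[OF v] U by (auto simp: u_def)
  have st: "\<not> (C u \<and> nx u \<in> {v, \<mu> v})" unfolding u_def by (rule stop_tgt[OF v])
  show ?thesis
    unfolding u_def[symmetric]
  proof (cases rule: tgt_cases[OF v])
    case 1
    then have un: "u = \<nu> v" "pr u = v" and hv: "h v = v" using vD(7) by (simp_all add: u_def h_def)
    have set: "set (core u) = set (P (\<mu> v))" using core(5)[OF u(1)] un(1) tau_nu by simp
    have "v \<notin> set (P (\<mu> v))"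
    proof
      assume "v \<in> set (P (\<mu> v))"
      then have "C0 v" using vD by (simp add: C0_def)
      then have "pushed v" using vD(4) by (simp add: C_def)
      then show False using C_if_pushed[of v] st un(1) by simp
    qed
    moreover have "t u \<noteq> v"
    proof (cases "C u")
      case True
      then show ?thesis using st by (auto simp: t_def)
    next
      case False
      then show ?thesis using mu_U[OF u(2)] u(1) vD(1) by (auto simp: t_def)
    qed
    ultimately show "(h v \<notin> set (core u) \<and> (u \<in> Hd \<longrightarrow> t u \<noteq> h v)) \<or> (h v = u \<and> u \<notin> Hd)"
      using hv set by simp
  next
    case (2 y)
    note Cy = C_imp_C0[OF 2(1)]
    have un: "u = \<nu> y" "pr u = y" using 2 by (simp_all add: u_def)
    have hn: "h v = \<mu> (nx y)" using 2(5,6) vD(7) by (auto simp: h_def mu_mu)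
    have nV: "nx y \<in> V" using 2(6) vD(2) by auto
    have hin: "h v \<in> {v, \<mu> v}" by (simp add: h_def)
    have set: "set (core u) = set (P (\<mu> y))" using core(5)[OF u(1)] un(1) tau_nu by simp
    show "(h v \<notin> set (core u) \<and> (u \<in> Hd \<longrightarrow> t u \<noteq> h v)) \<or> (h v = u \<and> u \<notin> Hd)"
    proof (cases "h v \<in> set (core u)")
      case True
      then have "h v = u" using mate_nx_in_path[OF Cy _ nV] set hn un(1) by simp
      then have "u = v" using hin u(1) vD(6) by auto
      then show ?thesis using \<open>h v = u\<close> v by simp
    next
      case False
      moreover have "t u \<noteq> h v"
      proof (cases "C u")
        case True
        then have "nx u \<notin> {v, \<mu> v}" using st by simp
        then show ?thesis using True hin by (metis t_def)
      next
        case nC: False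
        show ?thesis
        proof
          assume "t u = h v"
          then have "\<mu> u = \<mu> (nx y)" using nC hn by (simp add: t_def)
          then have "u = nx y" by (metis mu_mu)
          then show False using nxD(5)[OF Cy] un(1) by simp
        qed
      qed
      ultimately show ?thesis by blast
    qed
  qed
qed

lemma mu_edge_eq:
  assumes "v \<in> U" "w \<in> U" "{v, \<mu> v} = {w, \<mu> w}"
  shows "v = w"
  using assms mu_U[of v] mu_U[of w] U by (auto simp: doubleton_eq_iff)

lemma exists_balanced_decomposition:
  "\<exists>D. k_balanced_decomposition k V E D \<and> (\<forall>H\<in>D. is_cycle H \<longrightarrow> card H = 2 * k)"
proof (rule assemble_balanced_decomposition[where U = U and c = core and t = t and \<nu> = \<nu> and Hd = Hd
      and tgt = tgt and h = h])
  show "2 \<le> k" using k by simp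
  show "finite U" using U finV finite_subset by blast
  show "distinct (core u) \<and> length (core u) = 2 * k \<and> hd (core u) = u" if "u \<in> U" for u
    using core[OF that] by simp
  show "bij_betw \<nu> U U"
    by (rule bij_betw_byWitness[where f' = pr]) (use pr_nu pr_U nu_UI in auto)
  show "last (core (\<nu> v)) = t v" if "v \<in> U" for v using core(4)[OF nu_UI[OF that]] by (simp add: pr_nu)
  show "Hd \<subseteq> U" by (auto simp: Hd_def)
  show "inj_on tgt (U - Hd)" by (rule tgt_inj)
  show "tgt ` (U - Hd) \<subseteq> U" using tgt_U by blast
  show "{v, t v} = {last (core (tgt v)), h v}" if "v \<in> U - Hd" for v by (rule h_edge[OF that])
  show "t u \<notin> set (core u) \<or> (t u = last (core u) \<and> u \<notin> tgt ` (U - Hd))" if "u \<in> Hd" for u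
    by (rule head_ok[OF that])
  show "(h v \<notin> set (core (tgt v)) \<and> (tgt v \<in> Hd \<longrightarrow> t (tgt v) \<noteq> h v)) \<or> (h v = tgt v \<and> tgt v \<notin> Hd)"
    if "v \<in> U - Hd" for v by (rule tail_ok[OF that])
next
  have UV: "u \<in> V" if "u \<in> U" for u using that U by blast
  have tV: "\<tau> u \<in> V" if "u \<in> U" for u using UV[OF that] psD(3) by simp
  have eE0: "e \<in> E0" if "u \<in> U" "e \<in> path_edges (P (\<tau> u))" for u e
    using pe(1)[OF tV[OF that(1)]] that(2) by blast
  have muE0: "{v, \<mu> v} \<notin> E0" if "v \<in> U" for v using disjE[OF UV[OF that]] .
  have nxE: "{v, nx v} \<in> path_edges (P (\<tau> (\<nu> v)))" if "C v" for v
    using nxD(1)[OF C_imp_C0[OF that]] by (simp add: tau_nu)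
  \<comment> \<open>Two listings with a common edge are equal or reverses of each other; in the
    latter case only one of the two heads is in \<open>U\<close>.\<close>
  have same: "u = w" if "u \<in> U" "w \<in> U" "e \<in> path_edges (P (\<tau> u))" "e \<in> path_edges (P (\<tau> w))" for u w e
  proof -
    have "\<tau> w = \<tau> u \<or> \<tau> w = \<tau> (\<tau> u)"
      by (rule psD(11)) (use that tV in auto)
    then show ?thesis
    proof
      assume "\<tau> w = \<tau> u"
      then show ?thesis by (metis psD(2))
    next
      assume "\<tau> w = \<tau> (\<tau> u)"
      then have "\<tau> w = u" by (simp add: psD(2))
      then show ?thesis using tau_U[OF UV[OF that(2)]] that(1,2) by simp
    qed
  qed
  show "u = w" if uw: "u \<in> U" "w \<in> U" "e \<in> path_edges (core u)" "e \<in> path_edges (core w)" for u w e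
  proof (cases "e \<in> E0")
    case True
    then have "e \<noteq> {pr u, \<mu> (pr u)}" "e \<noteq> {pr w, \<mu> (pr w)}"
      using muE0[OF pr_U[OF uw(1)]] muE0[OF pr_U[OF uw(2)]] by auto
    then show ?thesis using same[OF uw(1,2)] uw(3,4) core_edges[OF uw(1)] core_edges[OF uw(2)] by blast
  next
    case False
    then have "e = {pr u, \<mu> (pr u)}" "e = {pr w, \<mu> (pr w)}"
      using uw(3,4) core_edges[OF uw(1)] core_edges[OF uw(2)] eE0[OF uw(1)] eE0[OF uw(2)] by blast+
    then have "pr u = pr w" using mu_edge_eq[OF pr_U[OF uw(1)] pr_U[OF uw(2)]] by simp
    then show ?thesis by (metis pr_nu(2))
  qed
  have nE0: "{v, t v} \<in> E0 \<longleftrightarrow> C v" if "v \<in> U" for v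
  proof (cases "C v")
    case True
    then show ?thesis using eE0[OF nu_UI[OF that] nxE[OF True]] by (simp add: t_def)
  next
    case False
    then show ?thesis using muE0[OF that] by (simp add: t_def)
  qed
  show "{v, t v} \<notin> path_edges (core u)" if uv: "u \<in> U" "v \<in> U" for u v
  proof
    assume e: "{v, t v} \<in> path_edges (core u)"
    show False
    proof (cases "C v")
      case True
      then have tv: "t v = nx v" by (simp add: t_def)
      have "{v, t v} \<noteq> {pr u, \<mu> (pr u)}" using nE0[OF uv(2)] True muE0[OF pr_U[OF uv(1)]] by metis
      then have *: "{v, t v} \<in> path_edges (P (\<tau> u))" "\<not> (C (pr u) \<and> {v, t v} = {pr u, nx (pr u)})"
        using e core_edges[OF uv(1)] by blast+
      have "u = \<nu> v" using same[OF uv(1) nu_UI[OF uv(2)] *(1)] nxE[OF True] tv by simp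
      then show False using *(2) True tv by (simp add: pr_nu)
    next
      case False
      then have "{v, t v} \<notin> E0" "t v = \<mu> v" using nE0[OF uv(2)] by (simp_all add: t_def)
      then have "C (pr u)" "{v, \<mu> v} = {pr u, \<mu> (pr u)}"
        using e core_edges[OF uv(1)] eE0[OF uv(1)] by auto
      then show False using mu_edge_eq[OF uv(2) pr_U[OF uv(1)]] False by simp
    qed
  qed
  show "v = w" if vw: "v \<in> U" "w \<in> U" "{v, t v} = {w, t w}" for v w
  proof (cases "C v")
    case True
    then have Cw: "C w" using nE0[OF vw(1)] nE0[OF vw(2)] vw(3) by simp
    have "\<nu> v = \<nu> w"
      using same[OF nu_UI[OF vw(1)] nu_UI[OF vw(2)] nxE[OF True]] nxE[OF Cw] vw(3) True Cw by (simp add: t_def)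
    then show ?thesis by (simp add: nu_inj)
  next
    case False
    then have "\<not> C w" using nE0[OF vw(1)] nE0[OF vw(2)] vw(3) by simp
    then show ?thesis using False vw mu_edge_eq by (simp add: t_def)
  qed
  show "E = (\<Union>u\<in>U. path_edges (core u)) \<union> (\<Union>v\<in>U. {{v, t v}})" (is "E = ?R")
  proof (rule equalityI)
    show "?R \<subseteq> E"
    proof
      fix e assume "e \<in> ?R"
      then consider u where "u \<in> U" "e \<in> path_edges (core u)" | v where "v \<in> U" "e = {v, t v}" by blast
      then show "e \<in> E"
      proof cases
        case 1
        show ?thesis
        proof (cases "e \<in> E0")
          case True
          then show ?thesis by (simp add: E)
        next
          case False
          then have "e = {pr u, \<mu> (pr u)}" using 1 core_edges[OF 1(1)] eE0[OF 1(1)] by blast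
          then show ?thesis using muE[OF UV[OF pr_U[OF 1(1)]]] by simp
        qed
      next
        case 2
        then show ?thesis using nE0[OF 2(1)] muE[OF UV[OF 2(1)]] by (cases "C v") (auto simp: E t_def)
      qed
    qed
    show "E \<subseteq> ?R"
    proof
      fix e assume e: "e \<in> E"
      show "e \<in> ?R"
      proof (cases "e \<in> E0")
        case True
        then obtain x where x: "x \<in> V" "e \<in> path_edges (P x)" using psD(10) by blast
        define u where "u = (if x \<in> U then x else \<tau> x)"
        have u: "u \<in> U" using tau_U[OF x(1)] by (simp add: u_def)
        have eu: "e \<in> path_edges (P (\<tau> u))" using x psD(2,9) by (simp add: u_def)
        show ?thesis
        proof (cases "C (pr u) \<and> e = {pr u, nx (pr u)}")
          case True
          then have "e = {pr u, t (pr u)}" by (simp add: t_def)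
          then show ?thesis using pr_U[OF u] by blast
        next
          case False
          then have "e \<in> path_edges (core u)" using core_edges[OF u] eu by blast
          then show ?thesis using u by blast
        qed
      next
        case False
        then obtain x where x: "x \<in> V" "e = {x, \<mu> x}" using e E by blast
        define v where "v = (if x \<in> U then x else \<mu> x)"
        have v: "v \<in> U" "e = {v, \<mu> v}" using mu_U[OF x(1)] x by (auto simp: v_def mu_mu)
        show ?thesis
        proof (cases "C v")
          case True
          then have "e \<in> path_edges (core (\<nu> v))" using core_edges[OF nu_UI[OF v(1)]] v by (simp add: pr_nu)
          then show ?thesis using nu_UI[OF v(1)] by blast
        next
          case False
          then have "e = {v, t v}" using v by (simp add: t_def)
          then show ?thesis using v(1) by blast
        qed
      qed
    qed
  qed
qed

end

theorem mainTheorem3: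
  fixes k :: nat and V :: "'a set" and E :: "'a set set"
  assumes "k \<ge> 3" and "class_G k V E"
  shows "\<exists>D. k_balanced_decomposition k V E D \<and> (\<forall>H\<in>D. is_cycle H \<longrightarrow> card H = 2*k)"
proof -
  obtain M1 M2 where G: "simple_graph V E" "regular (2 * k) V E" "girth_at_least (2 * k - 2) E"
    and M: "perfect_matching V E M1" "perfect_matching V E M2" "M1 \<inter> M2 = {}"
    using assms(2) by (auto simp: class_G_def)
  obtain P \<tau> where ps: "path_system (2 * k) V P \<tau> (E - M1)"
    using exists_path_system[OF assms(1) G M] by blast
  obtain \<mu> where mu: "\<mu> permutes V" "\<And>x. \<mu> (\<mu> x) = x" "\<And>x. x \<in> V \<Longrightarrow> \<mu> x \<noteq> x" "M1 = (\<lambda>x. {x, \<mu> x}) ` V"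
    using perfect_matching_partner[OF G(1) M(1)] by blast
  have fin: "finite V" using G(1) by (simp add: simple_graph_def)
  note psD = path_systemD[OF ps]
  obtain U where U: "U \<subseteq> V" "\<And>v. v \<in> V \<Longrightarrow> \<mu> v \<in> U \<longleftrightarrow> v \<notin> U" "\<And>v. v \<in> V \<Longrightarrow> \<tau> v \<in> U \<longleftrightarrow> v \<notin> U"
    using two_colouring[OF fin mu(1-3) psD(1,2,4)] by blast
  have "M1 \<subseteq> E" using M(1) by (simp add: perfect_matching_def)
  then interpret matched_path_system k V E P \<tau> \<mu> "E - M1" U
    by unfold_locales (use assms(1) fin G(3) ps mu U in auto)
  show ?thesis by (rule exists_balanced_decomposition)
qed

end
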